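(* Let $n\ge 2$ be an integer, let $R>0$, let $B_R\subset\mathbb{R}^n$ be the ball of radius $R$ centered at the origin, let $\mu_n(y)=\frac{n}{\omega_n\left(1+|y|^{\frac{n}{n-1}}\right)^n}$ for $y\in\mathbb{R}^n$, write $\mathrm{d}\mu_n=\mu_n(x)\,\mathrm{d}x$, and set $\theta_R:=\int_{B_R}\mu_n(y)\,\mathrm{d}y=\frac{R^n}{\left(1+R^{\frac{n}{n-1}}\right)^{n-1}}$. Consider the functionals $$J_R(\rho)=\alpha(n)\int_{B_R}\rho(y)^{\frac{n-1}{n}}\,\mathrm{d}y-\int_{B_R}|y|^{\frac{n}{n-1}}\rho(y)\,\mathrm{d}y\quad\text{for }\rho\in\mathcal{P}(\mathbb{R}^n),$$ and $$I_R(u)=\frac{1}{\beta(n)}\int_{B_R}H_n(u,\mu_n)\,\mathrm{d}x+\int_{B_R}u(x)\,\mathrm{d}\mu_n\quad\text{for }u\in W^{1,n}_0(B_R),$$ where $$\alpha(n)=\frac{n}{n-1}\left(\frac{n}{\omega_n}\right)^{1/n},\qquad \beta(n)=\left(\frac{n}{n-1}\right)^{n-1}n^n\,\omega_n,$$ and $$H_n(u,\mu_n):=|\nabla u+\nabla(\log\mu_n)|^n-|\nabla(\log\mu_n)|^n-n|\nabla(\log\mu_n)|^{n-2}\,\nabla(\log\mu_n)\cdot\nabla u.$$ Then $$\sup\left\{J_R(\rho)-J_R(\mu_n):\ \rho\in\mathcal{P}(\mathbb{R}^n),\ \int_{B_R}\rho\,\mathrm{d}y=\theta_R\right\}=\inf\left\{I_R(u):\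 u\in W^{1,n}_0(B_R),\ \int_{B_R}e^u\,\mathrm{d}\mu_n=\theta_R\right\}.$$ Moreover, the supremum on the left-hand side is attained at $\rho_{\max}=\mu_n$, the infimum on the right-hand side is attained at $u_{\min}=0$, and the common value of both sides is $0$.
   Context: $\omega_n$ denotes the area (surface measure) of the unit sphere in $\mathbb{R}^n$; with this normalization $\mu_n$ is a probability density on $\mathbb{R}^n$. $\mathcal{P}(\mathbb{R}^n)$ denotes the set of probability densities on $\mathbb{R}^n$ (nonnegative measurable functions with integral $1$ with respect to Lebesgue measure). $W^{1,n}_0(B_R)$ is the usual Sobolev space of real-valued functions with zero trace on $\partial B_R$. *)

theory Defs
  imports "HOL-Analysis.Analysis"
begin

text \<open>
  Euclidean space \<open>\<real>\<^sup>n\<close> is \<open>real ^ 'n\<close> with \<open>n = CARD('n)\<close>. Quantities depending only on the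
  dimension take an argument of type \<open>'n itself\<close>.
\<close>

section \<open>Calculus and Sobolev spaces\<close>

text \<open>The classical gradient; unspecified where \<open>f\<close> is not differentiable.\<close>

definition grad :: "(real ^ 'n \<Rightarrow> real) \<Rightarrow> real ^ 'n \<Rightarrow> real ^ 'n" where
  "grad f x = (THE D. GDERIV f x :> D)"

primrec continuously_differentiable :: "nat \<Rightarrow> (real ^ 'n \<Rightarrow> real) \<Rightarrow> bool" where
  "continuously_differentiable 0 f \<longleftrightarrow> continuous_on UNIV f"
| "continuously_differentiable (Suc k) f \<longleftrightarrow>
     (\<forall>x. f differentiable (at x)) \<and>
     (\<forall>i. continuously_differentiable k (\<lambda>x. grad f x $ i))"

definition test_functions :: "(real ^ 'n) set \<Rightarrow> (real ^ 'n \<Rightarrow> real) set" where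
  "test_functions \<Omega> = {\<phi>. (\<forall>k. continuously_differentiable k \<phi>) \<and>
     compact (closure {x. \<phi> x \<noteq> 0}) \<and> closure {x. \<phi> x \<noteq> 0} \<subseteq> \<Omega>}"

text \<open>
  Functions on an open set \<open>\<Omega>\<close> are represented by total functions whose values outside \<open>\<Omega>\<close>
  are ignored.
\<close>

definition has_weak_grad ::
  "(real ^ 'n) set \<Rightarrow> (real ^ 'n \<Rightarrow> real) \<Rightarrow> (real ^ 'n \<Rightarrow> real ^ 'n) \<Rightarrow> bool" where
  "has_weak_grad \<Omega> u v \<longleftrightarrow>
     (\<forall>K. compact K \<and> K \<subseteq> \<Omega> \<longrightarrow>
        set_integrable lebesgue K u \<and> set_integrable lebesgue K v) \<and>
     (\<forall>\<phi>\<in>test_functions \<Omega>.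
        (LINT x:\<Omega>|lebesgue. u x *\<^sub>R grad \<phi> x) = - (LINT x:\<Omega>|lebesgue. \<phi> x *\<^sub>R v x))"

text \<open>The weak gradient is determined only almost everywhere in \<open>\<Omega>\<close>; one version is chosen.\<close>

definition weak_grad ::
  "(real ^ 'n) set \<Rightarrow> (real ^ 'n \<Rightarrow> real) \<Rightarrow> real ^ 'n \<Rightarrow> real ^ 'n" where
  "weak_grad \<Omega> u = (SOME v. has_weak_grad \<Omega> u v)"

definition Lp_on ::
  "nat \<Rightarrow> (real ^ 'n) set \<Rightarrow> (real ^ 'n \<Rightarrow> 'b::euclidean_space) set" where
  "Lp_on p \<Omega> = {f. set_borel_measurable lebesgue \<Omega> f \<and>
     set_integrable lebesgue \<Omega> (\<lambda>x. norm (f x) ^ p)}"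

definition sobolev_W1 :: "nat \<Rightarrow> (real ^ 'n) set \<Rightarrow> (real ^ 'n \<Rightarrow> real) set" where
  "sobolev_W1 p \<Omega> = {u \<in> Lp_on p \<Omega>. \<exists>v \<in> Lp_on p \<Omega>. has_weak_grad \<Omega> u v}"

definition sobolev_norm :: "nat \<Rightarrow> (real ^ 'n) set \<Rightarrow> (real ^ 'n \<Rightarrow> real) \<Rightarrow> real" where
  "sobolev_norm p \<Omega> u =
     root p ((LINT x:\<Omega>|lebesgue. \<bar>u x\<bar> ^ p) + (LINT x:\<Omega>|lebesgue. norm (weak_grad \<Omega> u x) ^ p))"

text \<open>
  \<open>W\<^sub>0\<^sup>1\<^sup>,\<^sup>p(\<Omega>)\<close> as the closure of the test functions in \<open>W\<^sup>1\<^sup>,\<^sup>p(\<Omega>)\<close>; on a ball these are the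
  functions with zero trace on the boundary.
\<close>

definition sobolev_W1_0 :: "nat \<Rightarrow> (real ^ 'n) set \<Rightarrow> (real ^ 'n \<Rightarrow> real) set" where
  "sobolev_W1_0 p \<Omega> = {u \<in> sobolev_W1 p \<Omega>. \<exists>\<phi>. (\<forall>k. \<phi> k \<in> test_functions \<Omega>) \<and>
     (\<lambda>k. sobolev_norm p \<Omega> (\<lambda>x. u x - \<phi> k x)) \<longlonglongrightarrow> 0}"

section \<open>The functionals\<close>

text \<open>
  Surface measure of a subset \<open>E\<close> of the unit sphere, defined as usual through polar coordinates
  by \<open>n\<close> times the volume of the truncated cone over \<open>E\<close>.
\<close>

definition sphere_measure :: "(real ^ 'n) set \<Rightarrow> real" where
  "sphere_measure E = real CARD('n) * measure lebesgue {r *\<^sub>R x | r x. 0 < r \<and> r \<le> 1 \<and> x \<in> E}"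

definition sphere_area :: "'n::finite itself \<Rightarrow> real" where
  "sphere_area _ = sphere_measure (sphere (0 :: real ^ 'n) 1)"

definition prob_densities :: "(real ^ 'n \<Rightarrow> real) set" where
  "prob_densities = {\<rho>. \<rho> \<in> borel_measurable lebesgue \<and> (\<forall>x. 0 \<le> \<rho> x) \<and>
     integrable lebesgue \<rho> \<and> (LINT x|lebesgue. \<rho> x) = 1}"

definition mu :: "real ^ 'n \<Rightarrow> real" where
  "mu y = real CARD('n) /
     (sphere_area TYPE('n) * (1 + norm y powr (real CARD('n) / (real CARD('n) - 1))) ^ CARD('n))"

definition theta :: "'n::finite itself \<Rightarrow> real \<Rightarrow> real" where
  "theta _ R = (LINT y:ball (0 :: real ^ 'n) R|lebesgue. mu y)"

definition alpha :: "'n::finite itself \<Rightarrow> real" where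
  "alpha _ = real CARD('n) / (real CARD('n) - 1) *
     (real CARD('n) / sphere_area TYPE('n)) powr (1 / real CARD('n))"

definition beta :: "'n::finite itself \<Rightarrow> real" where
  "beta _ = (real CARD('n) / (real CARD('n) - 1)) ^ (CARD('n) - 1) *
     real CARD('n) ^ CARD('n) * sphere_area TYPE('n)"

definition J_functional :: "real \<Rightarrow> (real ^ 'n \<Rightarrow> real) \<Rightarrow> real" where
  "J_functional R \<rho> =
     alpha TYPE('n) *
       (LINT y:ball 0 R|lebesgue. \<rho> y powr ((real CARD('n) - 1) / real CARD('n))) -
     (LINT y:ball 0 R|lebesgue. norm y powr (real CARD('n) / (real CARD('n) - 1)) * \<rho> y)"

text \<open>\<open>H\<^sub>n(u, m)\<close> for a Sobolev function \<open>u\<close> on \<open>\<Omega>\<close> and a positive differentiable \<open>m\<close>.\<close>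

definition H_integrand ::
  "(real ^ 'n) set \<Rightarrow> (real ^ 'n \<Rightarrow> real) \<Rightarrow> (real ^ 'n \<Rightarrow> real) \<Rightarrow> real ^ 'n \<Rightarrow> real" where
  "H_integrand \<Omega> u m x =
     (let Du = weak_grad \<Omega> u x; Dm = grad (\<lambda>y. ln (m y)) x
      in norm (Du + Dm) ^ CARD('n) - norm Dm ^ CARD('n)
         - real CARD('n) * norm Dm ^ (CARD('n) - 2) * (Dm \<bullet> Du))"

definition I_functional :: "real \<Rightarrow> (real ^ 'n \<Rightarrow> real) \<Rightarrow> real" where
  "I_functional R u =
     1 / beta TYPE('n) * (LINT x:ball 0 R|lebesgue. H_integrand (ball 0 R) u mu x) +
     (LINT x:ball 0 R|lebesgue. u x * mu x)"

definition admissible_densities :: "real \<Rightarrow> (real ^ 'n \<Rightarrow> real) set" where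
  "admissible_densities R =
     {\<rho> \<in> prob_densities. (LINT y:ball 0 R|lebesgue. \<rho> y) = theta TYPE('n) R}"

text \<open>
  Integrability of \<open>exp u * mu\<close> is required explicitly because the Bochner integral of a
  non-integrable function is \<open>0\<close>.
\<close>

definition admissible_potentials :: "real \<Rightarrow> (real ^ 'n \<Rightarrow> real) set" where
  "admissible_potentials R =
     {u \<in> sobolev_W1_0 CARD('n) (ball 0 R).
        set_integrable lebesgue (ball 0 R) (\<lambda>x. exp (u x) * mu x) \<and>
        (LINT x:ball 0 R|lebesgue. exp (u x) * mu x) = theta TYPE('n) R}"

end

theory Submission
  imports Defs
begin

text \<open>
  Since the density satisfies a Liouville equation, \<open>- div (|\<nabla> ln mu|\<^sup>n\<^sup>-\<^sup>2 \<nabla> ln mu) = (beta / n) mu\<close>, the terms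
  of \<open>I_R(u)\<close> that are linear in \<open>u\<close> cancel, and \<open>beta I_R(u)\<close> is the \<open>n\<close>-energy of \<open>w = u + ln mu\<close> minus
  that of \<open>ln mu\<close>. So \<open>ln mu\<close> has to minimise the \<open>n\<close>-energy on the ball among all \<open>w\<close> with the same
  boundary values and the same integral of \<open>exp w\<close>. For smooth \<open>u\<close> the ball is cut into thin slices
  between level sets of \<open>w\<close>. Brunn-Minkowski bounds the total variation on a slice from below by the
  volume of the superlevel set, Young's inequality turns this into a bound on the energy, and the slope
  used in Young's inequality is the one obtained by transporting the mass of \<open>exp w\<close> above each level
  to a concentric ball of the same \<open>mu\<close>-mass; summation by parts and AM-GM give exactly the energy of
  \<open>ln mu\<close>. The general case follows by density of test functions. The statement about \<open>J_R\<close> is the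
  tangent inequality for the concave function \<open>t \<mapsto> t powr ((n - 1) / n)\<close> at \<open>mu\<close>.
\<close>

section \<open>The Brunn-Minkowski inequality\<close>

text \<open>Slices of finite height take the place of the coarea formula: no regularity of single
  level sets enters, and Brunn-Minkowski is the only isoperimetric input. After subtraction of the
  boundary value of \<open>ln mu\<close>, every superlevel set of positive height lies in the ball,
  so the inequality of the whole space applies to it without a boundary term. The discretisation
  costs a factor exp (- (n - 1) d / n) for mesh width d, which disappears as d tends to 0. The other
  obstacle is the constraint. Continuity of the integral of exp u along a sequence converging in the
  Sobolev norm belongs to the Moser-Trudinger circle of ideas; it is avoided by truncating u from
  above, which bounds the mass of the approximating test functions from below up to a factor close
  to 1. The smooth energy inequality is therefore stated with a tolerance y ^ n in the mass and an
  error \<open>energy_defect y\<close> that vanishes as y tends to 1. A lower bound on the mass is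
  the right hypothesis because more mass only raises the energy bound.\<close>

definition minkowski_sum :: "'a::euclidean_space set \<Rightarrow> 'a set \<Rightarrow> 'a set" where
  "minkowski_sum A B = (\<Union>x\<in>A. \<Union>y\<in>B. {x + y})"

lemma mem_minkowski_sum: "z \<in> minkowski_sum A B \<longleftrightarrow> (\<exists>x\<in>A. \<exists>y\<in>B. z = x + y)"
  by (auto simp: minkowski_sum_def)

lemma open_minkowski_sum: "open A \<Longrightarrow> open (minkowski_sum A B)"
  unfolding minkowski_sum_def by (rule open_sums) auto

lemma bounded_minkowski_sum: "bounded A \<Longrightarrow> bounded B \<Longrightarrow> bounded (minkowski_sum A B)"
  unfolding minkowski_sum_def by (rule bounded_subset[OF bounded_sums[of A B]]) auto

lemma minkowski_sum_mono: "A \<subseteq> A' \<Longrightarrow> B \<subseteq> B' \<Longrightarrow> minkowski_sum A B \<subseteq> minkowski_sum A' B'"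
  by (auto simp: minkowski_sum_def)

lemma minkowski_sum_commute: "minkowski_sum A B = minkowski_sum B A"
  unfolding set_eq_iff mem_minkowski_sum by (metis add.commute)

lemma fmeasurable_lborel_of_open_bounded:
  fixes A :: "'a::euclidean_space set"
  assumes "open A" "bounded A"
  shows "A \<in> fmeasurable lborel"
  by (intro fmeasurableI) (use assms emeasure_bounded_finite in auto)

lemma null_hyperplane:
  fixes i :: "'a::euclidean_space"
  assumes "i \<in> Basis"
  shows "{x. x \<bullet> i = t} \<in> null_sets lborel"
proof -
  have "{x. x \<bullet> i = t} \<in> null_sets lebesgue"
    using negligible_standard_hyperplane[OF assms] by (simp add: negligible_iff_null_sets)
  moreover have "{x::'a. x \<bullet> i = t} \<in> sets lborel" by simp
  ultimately show ?thesis by (simp add: null_sets_completion_iff)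
qed

text \<open>Hyperplanes are null sets, so the volume below a moving hyperplane depends continuously
  on its position; it runs from 0 to the full volume as the hyperplane sweeps over the bounded set,
  and the intermediate value theorem applies.\<close>

lemma mass_split:
  fixes A :: "'a::euclidean_space set"
  assumes A: "open A" "bounded A" and i: "i \<in> Basis" and l: "0 < l" "l < 1"
  obtains t where "measure lborel (A \<inter> {x. x \<bullet> i < t}) = l * measure lborel A"
proof -
  define f where "f t = measure lborel (A \<inter> {x. x \<bullet> i < t})" for t
  have fin: "A \<in> fmeasurable lborel" using A by (rule fmeasurable_lborel_of_open_bounded)
  have intA: "integrable lborel (indicator A :: _ \<Rightarrow> real)"
    using fin by (simp add: fmeasurable_def)
  have f_int: "f t = (\<integral>x. indicator (A \<inter> {x. x \<bullet> i < t}) x \<partial>lborel)" for t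
    unfolding f_def using A by simp
  have "continuous_on UNIV f"
  proof (clarsimp simp: continuous_on_sequentially comp_def)
    fix X :: "nat \<Rightarrow> real" and a assume X: "X \<longlonglongrightarrow> a"
    show "(\<lambda>n. f (X n)) \<longlonglongrightarrow> f a"
      unfolding f_int
    proof (rule integral_dominated_convergence[where w="indicator A"])
      \<comment> \<open>Off the limiting hyperplane, membership of x in the moving half-space is
        eventually constant.\<close>
      show "AE x in lborel. (\<lambda>n. indicator (A \<inter> {x. x \<bullet> i < X n}) x :: real) \<longlonglongrightarrow> indicator (A \<inter> {x. x \<bullet> i < a}) x"
        using AE_not_in[OF null_hyperplane[OF i, of a]]
      proof eventually_elim
        case (elim x)
        then have "x \<bullet> i < a \<or> a < x \<bullet> i" by auto
        then have "\<forall>\<^sub>F n in sequentially. (x \<bullet> i < X n) = (x \<bullet> i < a)"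
        proof
          assume *: "x \<bullet> i < a"
          from order_tendstoD(1)[OF X this] show ?thesis by eventually_elim (use * in auto)
        next
          assume *: "a < x \<bullet> i"
          from order_tendstoD(2)[OF X this] show ?thesis by eventually_elim (use * in auto)
        qed
        then show ?case
          by (intro tendsto_eventually) (auto elim!: eventually_mono simp: indicator_def)
      qed
      show "(\<lambda>x. indicator (A \<inter> {x. x \<bullet> i < a}) x :: real) \<in> borel_measurable lborel"
        "(\<lambda>x. indicator (A \<inter> {x. x \<bullet> i < X n}) x :: real) \<in> borel_measurable lborel" for n
        using A by (auto intro!: borel_measurable_indicator sets.Int)
    qed (use intA in \<open>auto simp: indicator_def\<close>)
  qed
  moreover obtain c where c: "\<And>x. x \<in> A \<Longrightarrow> norm x \<le> c" using A by (auto simp: bounded_iff)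
  have lo: "f (- c - 1) = 0"
  proof -
    have "A \<inter> {x. x \<bullet> i < - c - 1} = {}"
    proof (safe, simp)
      fix x assume "x \<in> A" "x \<bullet> i < - c - 1"
      then show False using c[of x] Basis_le_norm[OF i, of x] by simp
    qed
    then show ?thesis by (simp add: f_def)
  qed
  have hi: "f (c + 1) = measure lborel A"
  proof -
    have "A \<inter> {x. x \<bullet> i < c + 1} = A"
    proof safe
      fix x assume "x \<in> A"
      then show "x \<bullet> i < c + 1" using c[of x] Basis_le_norm[OF i, of x] by linarith
    qed
    then show ?thesis by (simp add: f_def)
  qed
  show ?thesis
  proof (cases "c \<ge> -1")
    case True
    have "\<exists>x\<ge>- c - 1. x \<le> c + 1 \<and> f x = l * measure lborel A"
    proof (rule IVT')
      show "f (- c - 1) \<le> l * measure lborel A" using l lo by simp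
      show "l * measure lborel A \<le> f (c + 1)" unfolding hi using l by (simp add: mult_left_le_one_le)
      show "continuous_on {- c - 1..c + 1} f" using \<open>continuous_on UNIV f\<close> continuous_on_subset by blast
    qed (use True in auto)
    then show ?thesis using that unfolding f_def by blast
  next
    \<comment> \<open>A norm bound below -1 leaves room for no point at all.\<close>
    case False
    then have "A = {}" using c order_trans[OF norm_ge_zero] by force
    then show ?thesis using that[of 0] by simp
  qed
qed

lemma measure_split_hyperplane:
  fixes A :: "'a::euclidean_space set"
  assumes A: "open A" "bounded A" and i: "i \<in> Basis"
  shows "measure lborel A = measure lborel (A \<inter> {x. x \<bullet> i < t}) + measure lborel (A \<inter> {x. t < x \<bullet> i})"
proof -
  have fin: "A \<in> fmeasurable lborel" using A by (rule fmeasurable_lborel_of_open_bounded)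
  have o: "open (A \<inter> {x. x \<bullet> i < t})" "open (A \<inter> {x. t < x \<bullet> i})"
    using A by (auto intro!: open_Int open_Collect_less continuous_intros)
  have f2: "A \<inter> {x. x \<bullet> i < t} \<in> fmeasurable lborel" "A \<inter> {x. t < x \<bullet> i} \<in> fmeasurable lborel"
    by (intro fmeasurable_lborel_of_open_bounded o; use A bounded_Int in blast)+
  have "measure lborel A = measure lborel (A - {x. x \<bullet> i = t})"
    using null_hyperplane[OF i] fin by (intro measure_Diff_null_set[symmetric]) auto
  also have "A - {x. x \<bullet> i = t} = (A \<inter> {x. x \<bullet> i < t}) \<union> (A \<inter> {x. t < x \<bullet> i})" by auto
  also have "measure lborel \<dots> = measure lborel (A \<inter> {x. x \<bullet> i < t}) + measure lborel (A \<inter> {x. t < x \<bullet> i})"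
    using f2 by (intro measure_Un2[THEN trans]) (auto intro!: arg_cong[where f="measure lborel"])
  finally show ?thesis .
qed

text \<open>The number k of boxes is the induction measure of the Hadwiger-Ohmann argument.
  Nonemptiness makes a positive count force positive volume, and disjointness provides separating
  coordinate hyperplanes.\<close>

definition box_union :: "nat \<Rightarrow> 'a::euclidean_space set \<Rightarrow> bool" where
  "box_union k A \<longleftrightarrow> (\<exists>\<A>. finite \<A> \<and> card \<A> = k \<and> disjoint \<A> \<and>
     (\<forall>X\<in>\<A>. X \<noteq> {} \<and> (\<exists>a b. X = box a b)) \<and> A = \<Union>\<A>)"

lemma box_union_open: "box_union k A \<Longrightarrow> open A"
  by (auto simp: box_union_def intro!: open_Union)

lemma box_union_bounded: "box_union k A \<Longrightarrow> bounded A"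
  by (auto simp: box_union_def intro!: bounded_Union)

lemma box_union_pos:
  fixes A :: "'a::euclidean_space set"
  assumes "box_union k A" "k > 0"
  shows "measure lborel A > 0"
proof -
  obtain \<A> where \<A>: "finite \<A>" "card \<A> = k" "\<forall>X\<in>\<A>. X \<noteq> {} \<and> (\<exists>a b. X = box a b)" "A = \<Union>\<A>"
    using assms by (auto simp: box_union_def)
  then obtain X where X: "X \<in> \<A>" using assms by (metis card_gt_0_iff equals0I)
  then have "X \<noteq> {} \<and> (\<exists>a b. X = box a b)" using \<A>(3) by simp
  then obtain a b where ab: "X = box a b" "box a b \<noteq> {}" by auto
  then have "0 < measure lborel X"
    by (auto simp: box_ne_empty measure_lborel_box_eq less_imp_le inner_diff_left intro!: prod_pos)
  also have "\<dots> \<le> measure lborel A"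
    using X \<A> ab box_union_open[OF assms(1)] box_union_bounded[OF assms(1)]
    by (intro measure_mono_fmeasurable fmeasurable_lborel_of_open_bounded) auto
  finally show ?thesis .
qed

lemma box_union_zero: "box_union 0 A \<longleftrightarrow> A = {}"
  by (auto simp: box_union_def)

text \<open>A set that meets every box in a box never splits one, so the count cannot grow; boxes
  that are missed leave the empty set, which is removed from the family.\<close>

lemma box_union_Int:
  fixes A :: "'a::euclidean_space set"
  assumes A: "box_union k A" and H: "\<And>a b. \<exists>c d. box a b \<inter> H = box c d"
  shows "\<exists>j\<le>k. box_union j (A \<inter> H)"
proof -
  obtain \<A> where \<A>: "finite \<A>" "card \<A> = k" "disjoint \<A>" "\<forall>X\<in>\<A>. X \<noteq> {} \<and> (\<exists>a b. X = box a b)" "A = \<Union>\<A>"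
    using A by (auto simp: box_union_def)
  let ?B = "(\<lambda>X. X \<inter> H) ` \<A> - {{}}"
  have "card ?B \<le> k"
    using \<A> by (metis card_image_le card_Diff1_le le_trans finite_imageI)
  moreover have "box_union (card ?B) (A \<inter> H)"
    unfolding box_union_def
  proof (intro exI[of _ ?B] conjI)
    show "disjoint ?B" using \<A>(3) by (auto simp: disjoint_def)
    show "\<forall>X\<in>?B. X \<noteq> {} \<and> (\<exists>a b. X = box a b)" using \<A>(4) H by auto
    show "A \<inter> H = \<Union>?B" using \<A>(5) by auto
  qed (use \<A> in simp_all)
  ultimately show "\<exists>j\<le>k. box_union j (A \<inter> H)" by blast
qed

lemma box_halfspace:
  fixes a b :: "'a::euclidean_space"
  assumes "i \<in> Basis"
  shows "\<exists>c d. box a b \<inter> {x. x \<bullet> i < t} = box c d" "\<exists>c d. box a b \<inter> {x. t < x \<bullet> i} = box c d"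
proof -
  have "box a b \<inter> {x. x \<bullet> i < t} = box a (\<Sum>j\<in>Basis. (if j = i then min t (b \<bullet> j) else b \<bullet> j) *\<^sub>R j)"
    using assms by (auto simp: mem_box split: if_splits)
  then show "\<exists>c d. box a b \<inter> {x. x \<bullet> i < t} = box c d" by blast
  have "box a b \<inter> {x. t < x \<bullet> i} = box (\<Sum>j\<in>Basis. (if j = i then max t (a \<bullet> j) else a \<bullet> j) *\<^sub>R j) b"
    using assms by (auto simp: mem_box split: if_splits)
  then show "\<exists>c d. box a b \<inter> {x. t < x \<bullet> i} = box c d" by blast
qed

text \<open>Two disjoint nonempty boxes have disjoint projections to some axis. A hyperplane between
  these projections leaves one of the two boxes entirely on each side, so each half loses a box and
  keeps a box: both counts drop but stay positive.\<close>

lemma box_union_separate: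
  fixes A :: "'a::euclidean_space set"
  assumes A: "box_union k A" and k: "k \<ge> 2"
  obtains i t j1 j2 where "i \<in> Basis" "0 < j1" "j1 < k" "0 < j2" "j2 < k"
    "box_union j1 (A \<inter> {x. x \<bullet> i < t})" "box_union j2 (A \<inter> {x. t < x \<bullet> i})"
proof -
  obtain \<A> where \<A>: "finite \<A>" "card \<A> = k" "disjoint \<A>" "\<forall>X\<in>\<A>. X \<noteq> {} \<and> (\<exists>a b. X = box a b)" "A = \<Union>\<A>"
    using A by (auto simp: box_union_def)
  obtain X Y where XY: "X \<in> \<A>" "Y \<in> \<A>" "X \<noteq> Y"
    using k \<A>(1,2) by (metis card_le_Suc0_iff_eq not_less_eq_eq numeral_2_eq_2)
  have "\<exists>X Y i t. X \<in> \<A> \<and> Y \<in> \<A> \<and> i \<in> Basis \<and> X \<subseteq> {x. x \<bullet> i < t} \<and> Y \<subseteq> {x. t < x \<bullet> i}"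
  proof -
    obtain a b c d where b: "X = box a b" "Y = box c d" using \<A>(4) XY by meson
    have ne: "box a b \<noteq> {}" "box c d \<noteq> {}" using \<A>(4) XY b by auto
    have "box a b \<inter> box c d = {}" using \<A>(3) XY b by (auto simp: disjoint_def)
    then obtain i where i: "i \<in> Basis" "b \<bullet> i \<le> c \<bullet> i \<or> d \<bullet> i \<le> a \<bullet> i"
      using ne unfolding disjoint_interval box_ne_empty by force
    from i(2) show ?thesis
    proof
      assume *: "b \<bullet> i \<le> c \<bullet> i"
      have "X \<subseteq> {x. x \<bullet> i < b \<bullet> i}" "Y \<subseteq> {x. b \<bullet> i < x \<bullet> i}"
        using * i(1) unfolding b by (force simp: mem_box)+
      then show ?thesis using XY i(1) by blast
    next
      assume *: "d \<bullet> i \<le> a \<bullet> i"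
      have "Y \<subseteq> {x. x \<bullet> i < d \<bullet> i}" "X \<subseteq> {x. d \<bullet> i < x \<bullet> i}"
        using * i(1) unfolding b by (force simp: mem_box)+
      then show ?thesis using XY i(1) by blast
    qed
  qed
  then obtain X Y i t where s: "X \<in> \<A>" "Y \<in> \<A>" "i \<in> Basis" "X \<subseteq> {x. x \<bullet> i < t}" "Y \<subseteq> {x. t < x \<bullet> i}"
    by blast
  \<comment> \<open>\<open>Z\<close> is the box lost by the half-space \<open>H\<close>, which gives
    the count below k; \<open>W\<close> is the box kept, which makes it positive.\<close>
  have part: "\<exists>j. 0 < j \<and> j < k \<and> box_union j (A \<inter> H)"
    if Z: "Z \<in> \<A>" "Z \<inter> H = {}" and W: "W \<in> \<A>" "W \<subseteq> H" and H: "\<And>a b. \<exists>c d. box a b \<inter> H = box c d" for Z W H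
  proof -
    have "box_union (k - 1) (\<Union>(\<A> - {Z}))"
      unfolding box_union_def using \<A> Z
      by (intro exI[of _ "\<A> - {Z}"]) (auto simp: disjoint_def)
    from box_union_Int[OF this H] obtain j where j: "j \<le> k - 1" "box_union j (\<Union>(\<A> - {Z}) \<inter> H)" by blast
    have "\<Union>(\<A> - {Z}) \<inter> H = A \<inter> H" using \<A>(5) Z by auto
    with j have "box_union j (A \<inter> H)" by simp
    moreover have "j \<noteq> 0"
    proof
      assume "j = 0"
      then have "A \<inter> H = {}" using \<open>box_union j (A \<inter> H)\<close> box_union_zero by metis
      moreover have "W \<noteq> {}" "W \<subseteq> A" using W \<A> by blast+
      ultimately show False using W by blast
    qed
    ultimately show ?thesis using j k by (intro exI[of _ j]) auto
  qed
  have "\<exists>j. 0 < j \<and> j < k \<and> box_union j (A \<inter> {x. x \<bullet> i < t})"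
    by (rule part[OF s(2) _ s(1,4) box_halfspace(1)[OF s(3)]]) (use s in auto)
  moreover have "\<exists>j. 0 < j \<and> j < k \<and> box_union j (A \<inter> {x. t < x \<bullet> i})"
    by (rule part[OF s(1) _ s(2,5) box_halfspace(2)[OF s(3)]]) (use s in auto)
  ultimately show ?thesis using that s(3) by blast
qed

text \<open>The sum contains the box whose side lengths are the sums p i + q i. AM-GM is applied to
  the ratios p i / (p i + q i) and to q i / (p i + q i); the two arithmetic means add up to
  1.\<close>

lemma brunn_minkowski_box:
  fixes a b c d :: "'a::euclidean_space"
  assumes "box a b \<noteq> {}" "box c d \<noteq> {}"
  shows "(root DIM('a) (measure lborel (box a b)) + root DIM('a) (measure lborel (box c d))) ^ DIM('a)
     \<le> measure lborel (minkowski_sum (box a b) (box c d))"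
proof -
  let ?n = "DIM('a)"
  define p where "p i = b \<bullet> i - a \<bullet> i" for i
  define q where "q i = d \<bullet> i - c \<bullet> i" for i
  have pos: "p i > 0" "q i > 0" if "i \<in> Basis" for i
    using assms that by (auto simp: p_def q_def box_ne_empty)
  have sub: "box (a + c) (b + d) \<subseteq> minkowski_sum (box a b) (box c d)"
  proof
    fix z assume z: "z \<in> box (a + c) (b + d)"
    \<comment> \<open>The relative position of z along each edge of the sum box; both summands of z
      are taken at this same relative position in their own box.\<close>
    define r where "r i = (z \<bullet> i - a \<bullet> i - c \<bullet> i) / (p i + q i)" for i
    have r: "0 < r i" "r i < 1" if "i \<in> Basis" for i
    proof -
      have "a \<bullet> i + c \<bullet> i < z \<bullet> i" "z \<bullet> i < b \<bullet> i + d \<bullet> i"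
        using z that by (auto simp: mem_box inner_add_left)
      then show "0 < r i" "r i < 1" using pos[OF that] by (auto simp: r_def p_def q_def field_simps)
    qed
    define x where "x = (\<Sum>i\<in>Basis. (a \<bullet> i + r i * p i) *\<^sub>R i)"
    have xi: "x \<bullet> i = a \<bullet> i + r i * p i" if "i \<in> Basis" for i
      using that by (simp add: x_def)
    have "x \<in> box a b"
      unfolding mem_box
    proof (intro ballI conjI)
      fix i :: 'a assume i: "i \<in> Basis"
      show "a \<bullet> i < x \<bullet> i" using xi r pos i by simp
      have "r i * p i < 1 * p i" using r pos i by (intro mult_strict_right_mono) auto
      then show "x \<bullet> i < b \<bullet> i" using xi i by (simp add: p_def)
    qed
    moreover have "z - x \<in> box c d"
      unfolding mem_box
    proof (intro ballI conjI)
      fix i :: 'a assume i: "i \<in> Basis"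
      have "r i * (p i + q i) = z \<bullet> i - a \<bullet> i - c \<bullet> i"
        using pos[OF i] by (simp add: r_def)
      then have *: "(z - x) \<bullet> i = c \<bullet> i + r i * q i" using xi[OF i] by (simp add: inner_diff_left algebra_simps)
      show "c \<bullet> i < (z - x) \<bullet> i" using * r pos i by simp
      have "r i * q i < 1 * q i" using r pos i by (intro mult_strict_right_mono) auto
      then show "(z - x) \<bullet> i < d \<bullet> i" using * i by (simp add: q_def)
    qed
    ultimately show "z \<in> minkowski_sum (box a b) (box c d)"
      unfolding mem_minkowski_sum by (intro bexI[of _ x] bexI[of _ "z - x"]) auto
  qed
  have m1: "measure lborel (box a b) = (\<Prod>i\<in>Basis. p i)"
    and m2: "measure lborel (box c d) = (\<Prod>i\<in>Basis. q i)"
    and m3: "measure lborel (box (a + c) (b + d)) = (\<Prod>i\<in>Basis. p i + q i)"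
  proof -
    have "\<forall>i\<in>Basis. a \<bullet> i \<le> b \<bullet> i" "\<forall>i\<in>Basis. c \<bullet> i \<le> d \<bullet> i" 
      using assms by (auto simp: box_ne_empty less_imp_le)
    moreover from this have "\<forall>i\<in>Basis. (a+c) \<bullet> i \<le> (b+d) \<bullet> i" by (auto simp: inner_add_left add_mono)
    ultimately show "measure lborel (box a b) = (\<Prod>i\<in>Basis. p i)"
     "measure lborel (box c d) = (\<Prod>i\<in>Basis. q i)"
     "measure lborel (box (a + c) (b + d)) = (\<Prod>i\<in>Basis. p i + q i)"
      unfolding measure_lborel_box_eq p_def q_def
      by (auto simp: inner_diff_left inner_add_left intro!: prod.cong)
  qed
  define S where "S = (\<Prod>i\<in>(Basis::'a set). p i + q i)"
  have S: "S > 0" unfolding S_def using pos by (intro prod_pos) (simp add: add_pos_pos)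
  have am: "root ?n (\<Prod>i\<in>Basis. h i) \<le> root ?n S * (\<Sum>i\<in>Basis. h i / (p i + q i) / ?n)"
    if h: "\<And>i. i \<in> Basis \<Longrightarrow> h i > 0" for h :: "'a \<Rightarrow> real"
  proof -
    have "(\<Prod>i\<in>Basis. h i / (p i + q i)) powr (1 / ?n) \<le> (\<Sum>i\<in>Basis. h i / (p i + q i) / ?n)"
      by (rule arith_geom_mean) (use h pos in \<open>auto simp: less_imp_le add_nonneg_nonneg\<close>)
    also have "(\<Prod>i\<in>Basis. h i / (p i + q i)) = (\<Prod>i\<in>Basis. h i) / S"
      by (simp add: S_def prod_dividef)
    also have "((\<Prod>i\<in>Basis. h i) / S) powr (1 / ?n) = root ?n ((\<Prod>i\<in>Basis. h i) / S)"
      using S h by (subst root_powr_inverse) (auto simp: prod_pos inverse_eq_divide less_imp_le prod_nonneg)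
    finally show ?thesis using S by (simp add: real_root_divide field_simps)
  qed
  have "root ?n (\<Prod>i\<in>Basis. p i) + root ?n (\<Prod>i\<in>Basis. q i) \<le>
     root ?n S * (\<Sum>i\<in>Basis. p i / (p i + q i) / ?n) + root ?n S * (\<Sum>i\<in>Basis. q i / (p i + q i) / ?n)"
    using pos by (intro add_mono am) auto
  also have "\<dots> = root ?n S * (\<Sum>i\<in>(Basis::'a set). 1 / ?n)"
    unfolding distrib_left[symmetric] sum.distrib[symmetric]
    using pos by (intro arg_cong[where f="\<lambda>z. root ?n S * z"] sum.cong)
      (auto simp: add_divide_distrib[symmetric] add_pos_pos less_imp_neq[THEN not_sym])
  also have "\<dots> = root ?n S" by simp
  finally have "(root ?n (\<Prod>i\<in>Basis. p i) + root ?n (\<Prod>i\<in>Basis. q i)) ^ ?n \<le> (root ?n S) ^ ?n"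
    using pos by (intro power_mono) (auto intro!: add_nonneg_nonneg real_root_ge_zero prod_nonneg simp: less_imp_le)
  also have "\<dots> = S" using S by simp
  also have "S = measure lborel (box (a + c) (b + d))" unfolding m3 S_def ..
  also have "\<dots> \<le> measure lborel (minkowski_sum (box a b) (box c d))"
    using sub by (intro measure_mono_fmeasurable fmeasurable_lborel_of_open_bounded
        open_minkowski_sum bounded_minkowski_sum) auto
  finally show ?thesis unfolding m1 m2 .
qed

text \<open>
  The Hadwiger-Ohmann argument: \<open>A\<close> is cut by a hyperplane that separates two of its boxes, and \<open>B\<close>
  by a parallel one in the same volume ratio, so that the inequality for the pieces adds up.
\<close>

lemma brunn_minkowski_box_union_step:
  fixes A B :: "'a::euclidean_space set"
  assumes A: "box_union k A" and B: "box_union l B" and k: "2 \<le> k" and l: "0 < l"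
    and IH: "\<And>j m A B. j + m < k + l \<Longrightarrow> 0 < j \<Longrightarrow> 0 < m \<Longrightarrow> box_union j A \<Longrightarrow> box_union m B \<Longrightarrow>
      (root DIM('a) (measure lborel A) + root DIM('a) (measure lborel (B :: 'a set))) ^ DIM('a)
         \<le> measure lborel (minkowski_sum A B)"
  shows "(root DIM('a) (measure lborel A) + root DIM('a) (measure lborel B)) ^ DIM('a)
     \<le> measure lborel (minkowski_sum A B)"
proof -
  let ?n = "DIM('a)"
  let ?m = "measure lborel :: 'a set \<Rightarrow> real"
  obtain i t j1 j2 where s: "i \<in> Basis" "0 < j1" "j1 < k" "0 < j2" "j2 < k"
    "box_union j1 (A \<inter> {x. x \<bullet> i < t})" "box_union j2 (A \<inter> {x. t < x \<bullet> i})"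
    using box_union_separate[OF A k] .
  let ?A1 = "A \<inter> {x. x \<bullet> i < t}" and ?A2 = "A \<inter> {x. t < x \<bullet> i}"
  have Aob: "open A" "bounded A" and Bob: "open B" "bounded B"
    using A B box_union_open box_union_bounded by blast+
  have mA: "?m A = ?m ?A1 + ?m ?A2" using measure_split_hyperplane[OF Aob s(1)] .
  have pA: "?m A > 0" "?m ?A1 > 0" "?m ?A2 > 0" using box_union_pos s A k by auto
  have pB: "?m B > 0" using box_union_pos B l by auto
  define r where "r = ?m ?A1 / ?m A"
  have r: "0 < r" "r < 1" using pA mA by (auto simp: r_def)
  have A1: "?m ?A1 = r * ?m A" using pA by (simp add: r_def)
  have A2: "?m ?A2 = (1 - r) * ?m A" using mA A1 by (simp add: algebra_simps)
  obtain u where u: "?m (B \<inter> {x. x \<bullet> i < u}) = r * ?m B" using mass_split[OF Bob s(1) r] .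
  let ?B1 = "B \<inter> {x. x \<bullet> i < u}" and ?B2 = "B \<inter> {x. u < x \<bullet> i}"
  have B2: "?m ?B2 = (1 - r) * ?m B"
    using measure_split_hyperplane[OF Bob s(1), of u] u by (simp add: algebra_simps)
  obtain m1 where m1: "m1 \<le> l" "box_union m1 ?B1"
    using box_union_Int[OF B box_halfspace(1)[OF s(1)]] by blast
  obtain m2 where m2: "m2 \<le> l" "box_union m2 ?B2"
    using box_union_Int[OF B box_halfspace(2)[OF s(1)]] by blast
  have "m1 \<noteq> 0"
  proof
    assume "m1 = 0"
    then have "?B1 = {}" using m1 box_union_zero by metis
    then show False using u r pB by simp
  qed
  have "m2 \<noteq> 0"
  proof
    assume "m2 = 0"
    then have "?B2 = {}" using m2 box_union_zero by metis
    then show False using B2 r pB by simp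
  qed
  define C where "C = (root ?n (?m A) + root ?n (?m B)) ^ ?n"
  \<comment> \<open>Both volumes carry the same factor z, and the n-th power of the sum of roots is
    homogeneous of degree 1 in the volumes. The two halves therefore contribute r and 1 - r times
    the full bound.\<close>
  have sc: "(root ?n (z * ?m A) + root ?n (z * ?m B)) ^ ?n = z * C" if "z > 0" for z
    using that by (simp add: C_def real_root_mult distrib_left[symmetric] power_mult_distrib)
  \<comment> \<open>The decrease of the induction measure comes from \<open>A\<close> alone:
    \<open>j1 < k\<close>, while \<open>m1 \<le> l\<close> may be an equality.\<close>
  have i1: "r * C \<le> ?m (minkowski_sum ?A1 ?B1)"
    using IH[OF _ s(2) _ s(6) m1(2)] s(3) m1(1) \<open>m1 \<noteq> 0\<close> sc[OF r(1)] by (simp add: A1 u)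
  have i2: "(1 - r) * C \<le> ?m (minkowski_sum ?A2 ?B2)"
    using IH[OF _ s(4) _ s(7) m2(2)] s(5) m2(1) \<open>m2 \<noteq> 0\<close> sc[of "1 - r"] r by (simp add: A2 B2)
  let ?S = "minkowski_sum A B"
  have Sob: "open ?S" "bounded ?S" using Aob Bob by (auto intro: open_minkowski_sum bounded_minkowski_sum)
  have "C = r * C + (1 - r) * C" by (simp add: algebra_simps)
  also have "\<dots> \<le> ?m (minkowski_sum ?A1 ?B1) + ?m (minkowski_sum ?A2 ?B2)" by (intro add_mono i1 i2)
  \<comment> \<open>The two partial sums lie strictly on opposite sides of the hyperplane at height
    t + u, so their volumes may be added inside the full sum.\<close>
  also have "\<dots> \<le> ?m (?S \<inter> {x. x \<bullet> i < t + u}) + ?m (?S \<inter> {x. t + u < x \<bullet> i})"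
  proof (intro add_mono measure_mono_fmeasurable fmeasurable_lborel_of_open_bounded)
    show "minkowski_sum ?A1 ?B1 \<subseteq> ?S \<inter> {x. x \<bullet> i < t + u}"
      "minkowski_sum ?A2 ?B2 \<subseteq> ?S \<inter> {x. t + u < x \<bullet> i}"
      by (auto simp: minkowski_sum_def inner_add_left add_strict_mono)
    show "minkowski_sum ?A1 ?B1 \<in> sets lborel" "minkowski_sum ?A2 ?B2 \<in> sets lborel"
      using s(6,7) box_union_open open_minkowski_sum by (auto intro!: borel_open)
  qed (use Sob bounded_Int in \<open>auto intro!: open_Int open_Collect_less continuous_intros\<close>)
  also have "\<dots> = ?m ?S" using measure_split_hyperplane[OF Sob s(1)] by simp
  finally show ?thesis unfolding C_def .
qed

text \<open>Induction on the total number of boxes: whichever set has at least two boxes is cut, and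
  commutativity of the sum lets one step lemma serve both roles.\<close>

lemma brunn_minkowski_box_union:
  fixes A B :: "'a::euclidean_space set"
  assumes "box_union k A" "box_union l B" "0 < k" "0 < l"
  shows "(root DIM('a) (measure lborel A) + root DIM('a) (measure lborel B)) ^ DIM('a)
     \<le> measure lborel (minkowski_sum A B)"
  using assms
proof (induction "k + l" arbitrary: k l A B rule: less_induct)
  case less
  consider "k = 1" "l = 1" | "k \<ge> 2" | "l \<ge> 2" using less.prems by linarith
  then show ?case
  proof cases
    case 1
    then obtain \<A> \<B> where "card \<A> = 1" "\<forall>X\<in>\<A>. X \<noteq> {} \<and> (\<exists>a b. X = box a b)" "A = \<Union>\<A>"
      "card \<B> = 1" "\<forall>X\<in>\<B>. X \<noteq> {} \<and> (\<exists>a b. X = box a b)" "B = \<Union>\<B>"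
      using less.prems by (auto simp: box_union_def)
    then obtain X Y where XY: "\<A> = {X}" "\<B> = {Y}"
      by (metis card_1_singletonE)
    then obtain a b c d where "X = box a b" "Y = box c d" "X \<noteq> {}" "Y \<noteq> {}" "A = X" "B = Y"
      using \<open>\<forall>X\<in>\<A>. _ X\<close> \<open>\<forall>X\<in>\<B>. _ X\<close> \<open>A = _\<close> \<open>B = _\<close> by auto
    then show ?thesis using brunn_minkowski_box by blast
  next
    case 2
    show ?thesis
      by (rule brunn_minkowski_box_union_step[OF less.prems(1,2) 2 less.prems(4)])
        (use less.hyps in blast)
  next
    case 3
    have "(root DIM('a) (measure lborel B) + root DIM('a) (measure lborel A)) ^ DIM('a)
     \<le> measure lborel (minkowski_sum B A)"
      by (rule brunn_minkowski_box_union_step[OF less.prems(2,1) 3 less.prems(3)])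
        (use less.hyps in \<open>metis add.commute\<close>)
    then show ?thesis by (simp add: minkowski_sum_commute add.commute)
  qed
qed

text \<open>An open set is a countable union of cells with disjoint interiors. Passing to the
  interiors loses a null set only, and finitely many of them exhaust the volume up to e.\<close>

lemma box_union_inner_approx:
  fixes A :: "'a::euclidean_space set"
  assumes A: "open A" "bounded A" and e: "e > 0"
  obtains k A' where "box_union k A'" "A' \<subseteq> A" "measure lborel A - e < measure lborel A'"
proof -
  show ?thesis
  proof (cases "A = {}")
    case True
    then show ?thesis using that[of 0 "{}"] e by (simp add: box_union_zero)
  next
    case nonempty: False
    obtain a where "A \<subseteq> box (-a) a" using bounded_subset_box_symmetric[OF A(2)] by blast
    then have ab: "A \<subseteq> cbox (-a) a" "box (-a) a \<noteq> {}" using nonempty box_subset_cbox by blast+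
    \<comment> \<open>With this gauge, a cell whose tag lies in \<open>A\<close> is forced to be a
      subset of \<open>A\<close>.\<close>
    define g where "g x = (if x \<in> A then A else ball x 1)" for x
    have "gauge g" using A by (auto simp: gauge_def g_def)
    obtain \<D> where D: "countable \<D>"
      "\<And>K. K \<in> \<D> \<Longrightarrow> interior K \<noteq> {} \<and> (\<exists>c d. K = cbox c d)"
      "pairwise (\<lambda>A B. interior A \<inter> interior B = {}) \<D>"
      "\<And>K. K \<in> \<D> \<Longrightarrow> \<exists>x \<in> A \<inter> K. K \<subseteq> g x" "A \<subseteq> \<Union>\<D>"
      by (rule covering_lemma[OF ab \<open>gauge g\<close>], rule that) (assumption | fast)+
    have sub: "K \<subseteq> A" if "K \<in> \<D>" for K using D(4)[OF that] by (auto simp: g_def)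
    have un: "A = \<Union>\<D>" using sub D(5) by auto
    define \<E> where "\<E> = interior ` \<D>"
    have E: "countable \<E>" "disjoint \<E>" "\<And>X. X \<in> \<E> \<Longrightarrow> X \<noteq> {} \<and> (\<exists>a b. X = box a b)" "\<Union>\<E> \<subseteq> A"
    proof -
      show "disjoint \<E>"
      proof (rule disjointI)
        fix X Y assume "X \<in> \<E>" "Y \<in> \<E>" "X \<noteq> Y"
        then obtain K L where KL: "K \<in> \<D>" "L \<in> \<D>" "X = interior K" "Y = interior L" "K \<noteq> L"
          unfolding \<E>_def by blast
        show "X \<inter> Y = {}" using pairwiseD[OF D(3) KL(1,2,5)] KL by simp
      qed
      show "X \<noteq> {} \<and> (\<exists>a b. X = box a b)" if "X \<in> \<E>" for X
        using that D(2) interior_cbox unfolding \<E>_def by (metis (no_types, lifting) imageE)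
      show "\<Union>\<E> \<subseteq> A" using sub interior_subset unfolding \<E>_def by blast
    qed (use D in \<open>auto simp: \<E>_def\<close>)
    have nul: "A - \<Union>\<E> \<in> null_sets lborel"
    proof -
      have "A - \<Union>\<E> \<subseteq> (\<Union>K\<in>\<D>. K - interior K)" unfolding un \<E>_def by blast
      moreover have "(\<Union>K\<in>\<D>. K - interior K) \<in> null_sets lborel"
      proof (rule null_sets_UN'[OF D(1)])
        fix K assume "K \<in> \<D>"
        then obtain c d where K: "K = cbox c d" "interior K \<noteq> {}" using D(2) by blast
        then have ne: "box c d \<noteq> {}" by (simp add: interior_cbox)
        have "emeasure lborel (cbox c d - box c d) = emeasure lborel (cbox c d) - emeasure lborel (box c d)"
          by (rule emeasure_Diff) (auto simp: box_subset_cbox emeasure_lborel_box_eq prod_nonneg inner_diff_left)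
        also have "\<dots> = 0" using ne box_ne_empty[of c d] by (auto simp: emeasure_lborel_box_eq emeasure_lborel_cbox_eq)
        finally show "K - interior K \<in> null_sets lborel" unfolding K by (simp add: interior_cbox null_sets_def)
      qed
      moreover have "open (\<Union>\<E>)" unfolding \<E>_def by (intro open_Union) auto
      then have "A - \<Union>\<E> \<in> sets lborel" using A by (auto intro!: sets.Diff borel_open)
      ultimately show ?thesis using null_sets_subset by blast
    qed
    have D_ne: "\<D> \<noteq> {}" using un nonempty by auto
    define h where "h = from_nat_into \<E>"
    have h: "range h = \<E>" unfolding h_def using D_ne E(1) by (intro range_from_nat_into) (auto simp: \<E>_def)
    define F where "F k = \<Union>(h ` {..<k})" for k
    have Fo: "open (F k)" for k
      unfolding F_def
    proof (intro open_Union ballI)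
      fix X assume "X \<in> h ` {..<k}"
      then have "X \<in> \<E>" using h by blast
      then show "open X" using E(3) open_box by blast
    qed
    have FU: "(\<Union>k. F k) = \<Union>\<E>" unfolding F_def h[symmetric] by blast
    have FA: "F k \<subseteq> A" for k using FU E(4) by blast
    have mA: "measure lborel A = measure lborel (\<Union>\<E>)"
    proof -
      have "\<Union>\<E> = A - (A - \<Union>\<E>)" using E(4) by blast
      moreover have "measure lborel (A - (A - \<Union>\<E>)) = measure lborel A"
        by (rule measure_Diff_null_set[OF _ nul]) (use A in auto)
      ultimately show ?thesis by simp
    qed
    have "(\<lambda>k. measure lborel (F k)) \<longlonglongrightarrow> measure lborel (\<Union>k. F k)"
    proof (rule Lim_measure_incseq)
      show "range F \<subseteq> sets lborel" using Fo by auto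
      show "incseq F" unfolding F_def incseq_def by (intro allI impI Union_mono image_mono) auto
      have "emeasure lborel (\<Union>k. F k) \<le> emeasure lborel A" using FU E(4) A by (intro emeasure_mono) auto
      also have "\<dots> < \<infinity>" using emeasure_bounded_finite A by blast
      finally show "emeasure lborel (\<Union>k. F k) \<noteq> \<infinity>" by simp
    qed
    then have "(\<lambda>k. measure lborel (F k)) \<longlonglongrightarrow> measure lborel A" using FU mA by simp
    from order_tendstoD(1)[OF this, of "measure lborel A - e"] e obtain k
      where k: "measure lborel A - e < measure lborel (F k)"
      by (auto simp: eventually_sequentially)
    have "box_union (card (h ` {..<k})) (F k)"
      unfolding box_union_def
    proof (intro exI[of _ "h ` {..<k}"] conjI)
      show "disjoint (h ` {..<k})" by (rule pairwise_subset[OF E(2)]) (use h in blast)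
      show "\<forall>X\<in>h ` {..<k}. X \<noteq> {} \<and> (\<exists>a b. X = box a b)" using E(3) h by blast
    qed (auto simp: F_def)
    then show ?thesis using that k FA by blast
  qed
qed

text \<open>Both sets are approximated from inside by unions of boxes up to volume e; the sum of the
  approximants stays inside the sum, and e tends to 0.\<close>

theorem brunn_minkowski_open:
  fixes A B :: "'a::euclidean_space set"
  assumes A: "open A" "bounded A" "A \<noteq> {}" and B: "open B" "bounded B" "B \<noteq> {}"
  shows "(root DIM('a) (measure lborel A) + root DIM('a) (measure lborel B)) ^ DIM('a)
     \<le> measure lborel (minkowski_sum A B)"
proof -
  let ?n = "DIM('a)"
  let ?m = "measure lborel :: 'a set \<Rightarrow> real"
  \<comment> \<open>Positive volumes leave room for small e, for which the approximating unions
    contain at least one box.\<close>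
  have pos: "?m S > 0" if "open S" "bounded S" "S \<noteq> {}" for S
  proof -
    have "\<not> negligible S" using that open_not_negligible by blast
    then have "S \<notin> null_sets lborel" using null_sets_completionI by (auto simp: negligible_iff_null_sets)
    then show ?thesis using fmeasurable_lborel_of_open_bounded[OF that(1,2)] that(1)
      by (auto simp: measure_def enn2real_positive_iff null_sets_def fmeasurable_def zero_less_iff_neq_zero)
  qed
  have ev: "(root ?n (?m A - e) + root ?n (?m B - e)) ^ ?n \<le> ?m (minkowski_sum A B)"
    if e: "0 < e" "e < ?m A" "e < ?m B" for e
  proof -
    obtain k A' where A': "box_union k A'" "A' \<subseteq> A" "?m A - e < ?m A'"
      using box_union_inner_approx[OF A(1,2) e(1)] .
    obtain l B' where B': "box_union l B'" "B' \<subseteq> B" "?m B - e < ?m B'"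
      using box_union_inner_approx[OF B(1,2) e(1)] .
    have "k \<noteq> 0"
    proof
      assume "k = 0"
      then have "A' = {}" using A'(1) box_union_zero by metis
      then show False using A'(3) e by simp
    qed
    have "l \<noteq> 0"
    proof
      assume "l = 0"
      then have "B' = {}" using B'(1) box_union_zero by metis
      then show False using B'(3) e by simp
    qed
    have "(root ?n (?m A - e) + root ?n (?m B - e)) ^ ?n \<le> (root ?n (?m A') + root ?n (?m B')) ^ ?n"
      using A' B' e by (intro power_mono add_mono) auto
    also have "\<dots> \<le> ?m (minkowski_sum A' B')"
      using brunn_minkowski_box_union[OF A'(1) B'(1)] \<open>k \<noteq> 0\<close> \<open>l \<noteq> 0\<close> by simp
    also have "\<dots> \<le> ?m (minkowski_sum A B)"
      using A B A' B' box_union_open[OF A'(1)]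
      by (intro measure_mono_fmeasurable minkowski_sum_mono fmeasurable_lborel_of_open_bounded)
        (auto intro!: open_minkowski_sum bounded_minkowski_sum borel_open)
    finally show ?thesis .
  qed
  have "((\<lambda>e. (root ?n (?m A - e) + root ?n (?m B - e)) ^ ?n) \<longlongrightarrow>
      (root ?n (?m A - 0) + root ?n (?m B - 0)) ^ ?n) (at_right 0)"
    by (intro tendsto_intros)
  moreover have "\<forall>\<^sub>F e in at_right 0. (root ?n (?m A - e) + root ?n (?m B - e)) ^ ?n \<le> ?m (minkowski_sum A B)"
    unfolding eventually_at_right_field
    using ev pos[OF A] pos[OF B] by (intro exI[of _ "min (?m A) (?m B)"]) auto
  ultimately have "(root ?n (?m A - 0) + root ?n (?m B - 0)) ^ ?n \<le> ?m (minkowski_sum A B)"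
    by (rule tendsto_upperbound) simp
  then show ?thesis by simp
qed


section \<open>The isoperimetric inequality for slices between level sets\<close>

lemma power_add_ge:
  fixes x y :: real
  assumes "0 \<le> x" "0 \<le> y"
  shows "x ^ Suc m + real (Suc m) * x ^ m * y \<le> (x + y) ^ Suc m"
proof (induction m)
  case (Suc m)
  have "x ^ Suc (Suc m) + real (Suc (Suc m)) * x ^ Suc m * y
      \<le> x ^ Suc (Suc m) + real (Suc (Suc m)) * x ^ Suc m * y + real (Suc m) * x ^ m * y\<^sup>2"
    using assms by simp
  also have "\<dots> = (x + y) * (x ^ Suc m + real (Suc m) * x ^ m * y)"
    by (simp add: algebra_simps power2_eq_square)
  also have "\<dots> \<le> (x + y) * (x + y) ^ Suc m"
    using Suc.IH assms by (intro mult_left_mono) auto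
  finally show ?case by simp
qed simp

text \<open>The constant and linear terms in e of the Brunn-Minkowski bound for a ball of radius e.
  The coefficient of e is the perimeter of the ball with the volume of \<open>A\<close>, so this is
  the isoperimetric inequality in the form of Minkowski content.\<close>

lemma measure_minkowski_sum_ball:
  fixes A :: "'a::euclidean_space set"
  assumes A: "open A" "bounded A" "A \<noteq> {}" and e: "e > 0"
  shows "measure lborel A + real DIM('a) * root DIM('a) (measure lborel (ball (0::'a) 1)) *
      root DIM('a) (measure lborel A) ^ (DIM('a) - 1) * e \<le> measure lborel (minkowski_sum A (ball 0 e))"
proof -
  let ?n = "DIM('a)"
  obtain m where m: "?n = Suc m" by (metis DIM_positive gr0_implies_Suc)
  have b: "measure lborel (ball (0::'a) e) = e ^ ?n * measure lborel (ball (0::'a) 1)"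
    using e by (simp add: content_ball)
  have "root ?n (measure lborel (ball (0::'a) e)) = e * root ?n (measure lborel (ball (0::'a) 1))"
    unfolding b using e by (simp add: real_root_mult real_root_power_cancel)
  then have "(root ?n (measure lborel A) + e * root ?n (measure lborel (ball (0::'a) 1))) ^ ?n
      \<le> measure lborel (minkowski_sum A (ball 0 e))"
    using brunn_minkowski_open[OF A, of "ball 0 e"] e by simp
  moreover have "root ?n (measure lborel A) ^ ?n = measure lborel A" by simp
  ultimately show ?thesis
    using power_add_ge[of "root ?n (measure lborel A)" "e * root ?n (measure lborel (ball (0::'a) 1))" m] e
    by (simp add: m mult_ac)
qed

section \<open>Integration over superlevel sets\<close>

lemma layer_cake:
  fixes f :: "'a::euclidean_space \<Rightarrow> real"
  assumes [measurable]: "f \<in> borel_measurable borel"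
    and f: "\<And>x. f x \<le> M"
  shows "(\<integral>\<^sup>+ x. ennreal (f x) \<partial>lborel)
     = (\<integral>\<^sup>+ s. emeasure lborel {x. s < f x} * indicator {0..<M} s \<partial>lborel)"
proof -
  have "(\<integral>\<^sup>+ x. ennreal (f x) \<partial>lborel) = (\<integral>\<^sup>+ x. (\<integral>\<^sup>+ s. indicator {0..<f x} s \<partial>lborel) \<partial>lborel)"
  proof (intro nn_integral_cong)
    fix x show "ennreal (f x) = (\<integral>\<^sup>+ s. indicator {0..<f x} s \<partial>lborel)"
      by (cases "0 \<le> f x") (auto simp: ennreal_neg)
  qed
  also have "\<dots> = (\<integral>\<^sup>+ x. (\<integral>\<^sup>+ s. indicator {z \<in> space (lborel \<Otimes>\<^sub>M lborel). 0 \<le> snd z \<and> snd z < f (fst z)} (x, s) \<partial>lborel) \<partial>lborel)"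
    by (intro nn_integral_cong) (auto simp: indicator_def space_pair_measure)
  also have "\<dots> = (\<integral>\<^sup>+ s. (\<integral>\<^sup>+ x. indicator {z \<in> space (lborel \<Otimes>\<^sub>M lborel). 0 \<le> snd z \<and> snd z < f (fst z)} (x, s) \<partial>lborel) \<partial>lborel)"
    by (rule lborel_pair.Fubini[symmetric]) measurable
  also have "\<dots> = (\<integral>\<^sup>+ s. emeasure lborel {x. s < f x} * indicator {0..<M} s \<partial>lborel)"
  proof (intro nn_integral_cong)
    fix s :: real
    have "(\<integral>\<^sup>+ x. indicator {z \<in> space (lborel \<Otimes>\<^sub>M lborel). 0 \<le> snd z \<and> snd z < f (fst z)} (x, s) \<partial>lborel)
       = (\<integral>\<^sup>+ x. indicator {x. s < f x} x * indicator {0..<M} s \<partial>lborel)"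
    proof (intro nn_integral_cong)
      fix x
      have "s < f x \<Longrightarrow> s < M" using f[of x] by linarith
      then show "indicator {z \<in> space (lborel \<Otimes>\<^sub>M lborel). 0 \<le> snd z \<and> snd z < f (fst z)} (x, s)
          = (indicator {x. s < f x} x * indicator {0..<M} s :: ennreal)"
        by (auto simp: indicator_def space_pair_measure)
    qed
    then show "(\<integral>\<^sup>+ x. indicator {z \<in> space (lborel \<Otimes>\<^sub>M lborel). 0 \<le> snd z \<and> snd z < f (fst z)} (x, s) \<partial>lborel)
       = emeasure lborel {x. s < f x} * indicator {0..<M} s"
      by (simp add: nn_integral_multc)
  qed
  finally show ?thesis .
qed

text \<open>Since both functions stay below \<open>M\<close>, only heights in [0, M) matter, and a
  uniform volume gap d over these heights integrates to d times \<open>M\<close>.\<close>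

lemma layer_cake_gap:
  fixes f g :: "'a::euclidean_space \<Rightarrow> real"
  assumes [measurable]: "f \<in> borel_measurable borel" "g \<in> borel_measurable borel"
    and f: "\<And>x. f x \<le> M" and g: "\<And>x. g x \<le> M" and M: "0 \<le> M"
    and gap: "\<And>s. 0 \<le> s \<Longrightarrow> s < M \<Longrightarrow> emeasure lborel {x. s < f x} + ennreal d \<le> emeasure lborel {x. s < g x}"
  shows "(\<integral>\<^sup>+ x. ennreal (f x) \<partial>lborel) + ennreal d * ennreal M \<le> (\<integral>\<^sup>+ x. ennreal (g x) \<partial>lborel)"
proof -
  have [measurable]: "(\<lambda>s. emeasure lborel {x. s < f x}) \<in> borel_measurable borel"
  proof -
    have "{z \<in> space (borel \<Otimes>\<^sub>M lborel). fst z < f (snd z)} \<in> sets (borel \<Otimes>\<^sub>M lborel)"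
      by measurable
    from lborel.measurable_emeasure_Pair[OF this] show ?thesis
      by (simp add: vimage_def space_pair_measure)
  qed
  have "(\<integral>\<^sup>+ x. ennreal (f x) \<partial>lborel) + ennreal d * ennreal M
     = (\<integral>\<^sup>+ s. emeasure lborel {x. s < f x} * indicator {0..<M} s \<partial>lborel)
       + (\<integral>\<^sup>+ s. ennreal d * indicator {0..<M} s \<partial>lborel)"
    using M by (simp add: layer_cake[OF assms(1) f] nn_integral_cmult_indicator)
  also have "\<dots> = (\<integral>\<^sup>+ s. emeasure lborel {x. s < f x} * indicator {0..<M} s + ennreal d * indicator {0..<M} s \<partial>lborel)"
    by (intro nn_integral_add[symmetric]) auto
  also have "\<dots> \<le> (\<integral>\<^sup>+ s. emeasure lborel {x. s < g x} * indicator {0..<M} s \<partial>lborel)"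
    using gap by (intro nn_integral_mono) (auto simp: indicator_def)
  also have "\<dots> = (\<integral>\<^sup>+ x. ennreal (g x) \<partial>lborel)" by (rule layer_cake[OF assms(2) g, symmetric])
  finally show ?thesis .
qed

text \<open>
  Replacing the truncation \<open>f\<close> of \<open>v\<close> to \<open>[a, b]\<close> by its supremum over balls of radius \<open>e\<close> fattens
  every superlevel set by a ball, so Brunn-Minkowski bounds the growth of the integral from below; to
  first order in \<open>e\<close> this growth is \<open>e\<close> times the integral of the norm of the gradient.
\<close>

theorem slice_isoperimetric:
  fixes v :: "'a::euclidean_space \<Rightarrow> real" and G :: "'a \<Rightarrow> 'a"
  assumes n: "DIM('a) \<ge> 2" and ab: "a < b"
    and der: "\<And>x. (v has_derivative (\<lambda>h. G x \<bullet> h)) (at x)"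
    and Gcont: "continuous_on UNIV G" and GL: "\<And>x. norm (G x) \<le> L"
    and bdd: "bounded {x. a \<le> v x}"
  shows "real DIM('a) * root DIM('a) (measure lborel (ball (0::'a) 1)) * (b - a) *
      root DIM('a) (measure lborel {x. b \<le> v x}) ^ (DIM('a) - 1)
     \<le> (\<integral>x. norm (G x) * indicator {x. a \<le> v x \<and> v x < b} x \<partial>lborel)"
proof (cases "{x. b \<le> v x} = {}")
  case True
  then have "root DIM('a) (measure lborel {x. b \<le> v x}) ^ (DIM('a) - 1) = 0"
    using n by (simp only: measure_empty real_root_zero) (simp add: power_0_left)
  then show ?thesis by (simp only: mult_zero_right) (simp add: integral_nonneg_AE)
next
  case nonempty: False
  let ?n = "DIM('a)"
  have L0: "0 \<le> L" using GL[of 0] norm_ge_zero order_trans by blast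
  have vcont: "continuous_on UNIV v"
    using der by (auto intro!: continuous_at_imp_continuous_on has_derivative_continuous)
  have vlip: "\<bar>v y - v x\<bar> \<le> L * norm (y - x)" for x y
  proof -
    have "onorm (\<lambda>h. G z \<bullet> h) \<le> L" for z
    proof (rule onorm_bound[OF L0])
      fix h
      have "\<bar>G z \<bullet> h\<bar> \<le> norm (G z) * norm h" by (rule Cauchy_Schwarz_ineq2)
      also have "\<dots> \<le> L * norm h" using GL by (intro mult_right_mono) auto
      finally show "norm (G z \<bullet> h) \<le> L * norm h" by simp
    qed
    then have "norm (v y - v x) \<le> L * norm (y - x)"
      using der by (intro differentiable_bound[of UNIV v "\<lambda>x h. G x \<bullet> h"]) auto
    then show ?thesis by simp
  qed
  define f where "f x = min (max (v x) a) b - a" for x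
  have fcont: "continuous_on UNIV f" unfolding f_def by (intro continuous_intros vcont)
  have f01: "0 \<le> f x" "f x \<le> b - a" for x using ab by (auto simp: f_def)
  have flip: "f y \<le> f x + L * norm (y - x)" for x y
    using vlip[of y x] L0 by (auto simp: f_def min_def max_def split: if_splits)
  have fgt: "s < f x \<longleftrightarrow> a + s < v x" if "0 \<le> s" "s < b - a" for s x
    using that ab by (auto simp: f_def min_def max_def)
  obtain r where r: "\<And>x. a \<le> v x \<Longrightarrow> norm x < r" 
  proof -
    obtain s where s: "\<forall>x\<in>{x. a \<le> v x}. norm x \<le> s" using bdd unfolding bounded_iff by blast
    show ?thesis by (rule that[of "s + 1"]) (use s in fastforce)
  qed
  have f0: "f x = 0" if "r \<le> norm x" for x
    using r[of x] that ab by (fastforce simp: f_def min_def max_def)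
  define fe where "fe e x = (SUP y\<in>ball x e. f y)" for e x
  have bddf: "bdd_above (f ` S)" for S using f01(2) by (auto intro!: bdd_aboveI)
  have fe_gt: "s < fe e x \<longleftrightarrow> (\<exists>y\<in>ball x e. s < f y)" if "e > 0" for s e x
    unfolding fe_def using that bddf by (intro less_cSUP_iff) auto
  have fe_le: "fe e x \<le> c" if "e > 0" "\<And>y. dist x y < e \<Longrightarrow> f y \<le> c" for e x c
    unfolding fe_def using that by (intro cSUP_least) auto
  have fe_ge: "f x \<le> fe e x" if "e > 0" for e x
    unfolding fe_def using that bddf by (intro cSUP_upper) auto
  have fe_set: "{x. s < fe e x} = minkowski_sum {x. s < f x} (ball 0 e)" if epos: "e > 0" for s e
  proof (intro set_eqI iffI)
    fix x assume "x \<in> {x. s < fe e x}"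
    then obtain y where "y \<in> ball x e" "s < f y" using fe_gt[OF epos] by auto
    then show "x \<in> minkowski_sum {x. s < f x} (ball 0 e)"
      unfolding mem_minkowski_sum
      by (intro bexI[where P="\<lambda>y. \<exists>z\<in>_. x = y + z" and x=y] bexI[where P="\<lambda>z. x = y + z" and x="x - y"])
        (auto simp: dist_norm norm_minus_commute)
  next
    fix x assume "x \<in> minkowski_sum {x. s < f x} (ball 0 e)"
    then obtain y z where "s < f y" "norm z < e" "x = y + z" by (auto simp: mem_minkowski_sum)
    then show "x \<in> {x. s < fe e x}" using fe_gt[OF epos] by (auto simp: dist_norm intro!: bexI[of _ y])
  qed
  have open_f: "open {x. s < f x}" for s using fcont by (intro open_Collect_less continuous_intros)
  have [measurable]: "f \<in> borel_measurable borel" using fcont by (rule borel_measurable_continuous_onI)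
  have [measurable]: "v \<in> borel_measurable borel" using vcont by (rule borel_measurable_continuous_onI)
  have [measurable]: "G \<in> borel_measurable borel" using Gcont by (rule borel_measurable_continuous_onI)
  have fem: "fe e \<in> borel_measurable borel" if "e > 0" for e
    unfolding borel_measurable_iff_greater
    using fe_set[OF that] open_minkowski_sum[OF open_f] by simp
  have fe01: "0 \<le> fe e x" "fe e x \<le> b - a" if "e > 0" for e x
    using fe_ge[OF that, of x] f01[of x] fe_le[OF that, of x "b - a"] f01(2) by auto
  have fe0: "fe e x = 0" if "e > 0" "r + e \<le> norm x" for e x
  proof -
    have "f y \<le> 0" if "dist x y < e" for y
    proof -
      have "norm x \<le> norm y + dist x y" by (metis dist_commute dist_norm norm_triangle_sub)
      then have "r \<le> norm y" using that \<open>r + e \<le> norm x\<close> by linarith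
      then show ?thesis using f0 by simp
    qed
    then have "fe e x \<le> 0" using fe_le that by blast
    then show ?thesis using fe01[OF that(1), of x] by simp
  qed
  define rb where "rb = root ?n (measure lborel {x. b \<le> v x})"
  define c where "c = real ?n * root ?n (measure lborel (ball (0::'a) 1)) * rb ^ (?n - 1)"
  have rb0: "0 \<le> rb" and c0: "0 \<le> c" by (auto simp: rb_def c_def)
  have fin: "emeasure lborel {x. s < f x} < \<infinity>" "bounded {x. s < f x}" if "0 \<le> s" for s
  proof -
    have "norm x < r" if "s < f x" for x using f0[of x] that \<open>0 \<le> s\<close> by (cases "r \<le> norm x") auto
    then have "{x. s < f x} \<subseteq> ball 0 r" by auto
    then show "bounded {x. s < f x}" using bounded_ball bounded_subset by blast
    then show "emeasure lborel {x. s < f x} < \<infinity>" by (rule emeasure_bounded_finite)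
  qed
  \<comment> \<open>At every height s below b - a the superlevel set contains {x. b \<le> v x}, so
    its growth is bounded below by the rate \<open>c\<close> computed from that smallest
    set.\<close>
  have gap: "emeasure lborel {x. s < f x} + ennreal (c * e) \<le> emeasure lborel {x. s < fe e x}"
    if e: "e > 0" and s: "0 \<le> s" "s < b - a" for e s
  proof -
    let ?A = "{x. s < f x}"
    have sub: "{x. b \<le> v x} \<subseteq> ?A"
    proof
      fix x assume "x \<in> {x. b \<le> v x}"
      then have "a + s < v x" using s by simp
      then show "x \<in> ?A" using fgt[OF s, of x] by simp
    qed
    then have ne: "?A \<noteq> {}" using nonempty by blast
    have "measure lborel {x. b \<le> v x} \<le> measure lborel ?A"
      using sub open_f fin[OF s(1)] by (intro measure_mono_fmeasurable fmeasurableI) auto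
    then have "rb \<le> root ?n (measure lborel ?A)" unfolding rb_def by simp
    then have "c * e \<le> real ?n * root ?n (measure lborel (ball (0::'a) 1)) * root ?n (measure lborel ?A) ^ (?n - 1) * e"
      unfolding c_def using e rb0 by (intro mult_right_mono mult_left_mono power_mono) auto
    then have "measure lborel ?A + c * e \<le> measure lborel (minkowski_sum ?A (ball 0 e))"
      using measure_minkowski_sum_ball[OF open_f fin(2)[OF s(1)] ne e] by linarith
    moreover have "emeasure lborel ?A = ennreal (measure lborel ?A)"
      using fin[OF s(1)] by (simp add: emeasure_eq_ennreal_measure less_top)
    moreover have "emeasure lborel (minkowski_sum ?A (ball 0 e)) = ennreal (measure lborel (minkowski_sum ?A (ball 0 e)))"
      using emeasure_bounded_finite[OF bounded_minkowski_sum[OF fin(2)[OF s(1)] bounded_ball[of 0 e]]]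
      by (intro emeasure_eq_ennreal_measure) auto
    ultimately show ?thesis unfolding fe_set[OF e] using c0 e by (simp add: ennreal_plus[symmetric] del: ennreal_plus)
  qed
  have int_f: "integrable lborel f"
    by (rule integrableI_bounded_set[where A="ball 0 r" and B="b - a"])
      (use f01 f0 emeasure_bounded_finite[OF bounded_ball] in auto)
  have int_fe: "integrable lborel (fe e)" if "e > 0" for e
    by (rule integrableI_bounded_set[where A="ball 0 (r + e)" and B="b - a"])
      (use that fem fe01 fe0 emeasure_bounded_finite[OF bounded_ball] in auto)
  have growth: "c * (b - a) \<le> (\<integral>x. (fe e x - f x) / e \<partial>lborel)" if e: "e > 0" for e
  proof -
    have "(\<integral>\<^sup>+ x. ennreal (f x) \<partial>lborel) + ennreal (c * e) * ennreal (b - a) \<le> (\<integral>\<^sup>+ x. ennreal (fe e x) \<partial>lborel)"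
      by (rule layer_cake_gap) (use fem[OF e] f01 fe01[OF e] gap[OF e] ab in auto)
    then have "ennreal ((\<integral>x. f x \<partial>lborel) + (c * e) * (b - a)) \<le> ennreal (\<integral>x. fe e x \<partial>lborel)"
      using int_f int_fe[OF e] f01 fe01[OF e] c0 e ab
      by (simp add: nn_integral_eq_integral ennreal_mult[symmetric] integral_nonneg_AE del: ennreal_plus flip: ennreal_plus)
    then have "(\<integral>x. f x \<partial>lborel) + (c * e) * (b - a) \<le> (\<integral>x. fe e x \<partial>lborel)"
      using fe01[OF e] by (subst (asm) ennreal_le_iff) (auto intro!: integral_nonneg_AE)
    then have "c * e * (b - a) \<le> (\<integral>x. fe e x - f x \<partial>lborel)"
      using int_f int_fe[OF e] by (simp add: Bochner_Integration.integral_diff)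
    then show ?thesis using e by (simp add: field_simps)
  qed
  define h where "h x = norm (G x) * indicator {x. a \<le> v x \<and> v x < b} x" for x
  have h0: "0 \<le> h x" "h x \<le> L" for x using GL L0 by (auto simp: h_def indicator_def)
  define e where "e k = 1 / real (Suc k)" for k
  have e: "e k > 0" "e k \<le> 1" for k by (auto simp: e_def)
  have e_lim: "e \<longlonglongrightarrow> 0" unfolding e_def by (rule LIMSEQ_Suc[OF lim_1_over_n])
  \<comment> \<open>An upper bound for the difference quotients is enough for the limit below.
    Nothing grows on the plateaus: f is locally 0 where v is below a, and already maximal where v is
    at least b. In between, the derivative of v governs f.\<close>
  have upper: "\<forall>\<^sub>F k in sequentially. (fe (e k) x - f x) / e k \<le> h x + \<eta>" if \<eta>: "\<eta> > 0" for x \<eta>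
  proof -
    have key: "\<exists>d>0. \<forall>y. dist x y < d \<longrightarrow> f y - f x \<le> (h x + \<eta>) * norm (y - x)"
    proof -
      consider "v x < a" | "b \<le> v x" | "a \<le> v x" "v x < b" by linarith
      then show ?thesis
      proof cases
        case 1
        have "\<forall>\<^sub>F y in nhds x. v y < a"
          using vcont 1 by (intro order_tendstoD(2)[of v "v x"])
            (auto simp: continuous_on_eq_continuous_at isCont_def tendsto_at_iff_tendsto_nhds)
        then obtain d where "d > 0" "\<And>y. dist y x < d \<Longrightarrow> v y < a"
          by (auto simp: eventually_nhds_metric)
        moreover have "f z = 0" if "v z < a" for z using that ab by (simp add: f_def)
        ultimately show ?thesis using 1 h0[of x] \<eta>
          by (intro exI[of _ d]) (simp add: dist_commute)
      next
        case 2
        then have "f x = b - a" using ab by (simp add: f_def)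
        have "f y - f x \<le> (h x + \<eta>) * norm (y - x)" for y
        proof -
          have "f y - f x \<le> 0" using f01(2)[of y] \<open>f x = b - a\<close> by simp
          also have "0 \<le> (h x + \<eta>) * norm (y - x)" using h0[of x] \<eta> by simp
          finally show ?thesis .
        qed
        then show ?thesis by (intro exI[of _ 1]) simp
      next
        case 3
        have "\<forall>e>0. \<exists>d>0. \<forall>y. norm (y - x) < d \<longrightarrow> norm (v y - v x - G x \<bullet> (y - x)) \<le> e * norm (y - x)"
          using der[of x] by (simp add: has_derivative_at_alt)
        then obtain d where d: "d > 0"
          "\<And>y. norm (y - x) < d \<Longrightarrow> norm (v y - v x - G x \<bullet> (y - x)) \<le> \<eta> * norm (y - x)"
          using \<eta> by blast
        have "f y - f x \<le> (h x + \<eta>) * norm (y - x)" if "dist x y < d" for y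
        proof -
          have "norm (v y - v x - G x \<bullet> (y - x)) \<le> \<eta> * norm (y - x)"
            using that by (intro d(2)) (simp add: dist_norm norm_minus_commute)
          then have "v y - v x \<le> norm (G x) * norm (y - x) + \<eta> * norm (y - x)"
            using norm_cauchy_schwarz[of "G x" "y - x"] by (simp add: abs_le_iff)
          moreover have "0 \<le> norm (G x) * norm (y - x) + \<eta> * norm (y - x)" using \<eta> by simp
          moreover have "f y - f x \<le> max (v y - v x) 0" using 3 ab by (auto simp: f_def min_def max_def)
          moreover have "h x = norm (G x)" using 3 by (simp add: h_def)
          ultimately show ?thesis by (simp add: algebra_simps)
        qed
        then show ?thesis using d(1) by blast
      qed
    qed
    then obtain d where d: "d > 0" "\<And>y. dist x y < d \<Longrightarrow> f y - f x \<le> (h x + \<eta>) * norm (y - x)" by blast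
    have "\<forall>\<^sub>F k in sequentially. e k < d" using order_tendstoD(2)[OF e_lim d(1)] .
    then show ?thesis
    proof eventually_elim
      case (elim k)
      have "fe (e k) x \<le> f x + (h x + \<eta>) * e k"
      proof (rule fe_le[OF e(1)])
        fix y assume y: "dist x y < e k"
        have "f y - f x \<le> (h x + \<eta>) * norm (y - x)" using y elim d(2) by auto
        also have "\<dots> \<le> (h x + \<eta>) * e k"
          using y h0[of x] \<eta> by (intro mult_left_mono) (auto simp: dist_norm norm_minus_commute)
        finally show "f y \<le> f x + (h x + \<eta>) * e k" by simp
      qed
      then show ?case using e(1)[of k] by (simp add: field_simps)
    qed
  qed
  define w where "w x = L * indicator (ball (0::'a) (r + 1)) x" for x
  \<comment> \<open>The maximum with h supplies the missing lower bound, so the sequence converges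
    to h and dominated convergence applies; it only increases the integrals that are to be bounded
    from below.\<close>
  define H where "H k x = max ((fe (e k) x - f x) / e k) (h x)" for k x
  have hw: "h x \<le> w x" for x
    using r[of x] h0(2)[of x] L0 by (auto simp: h_def w_def indicator_def)
  have int_w: "integrable lborel w"
    unfolding w_def using emeasure_bounded_finite[OF bounded_ball[of "0::'a" "r + 1"]] by (intro integrable_mult_right) simp
  \<comment> \<open>Inside the ball of radius r + 1 the Lipschitz bound controls the quotient;
    outside, f and its suprema over balls of radius at most 1 vanish.\<close>
  have gw: "(fe (e k) x - f x) / e k \<le> w x" for k x
  proof (cases "x \<in> ball 0 (r + 1)")
    case True
    have "fe (e k) x \<le> f x + L * e k"
    proof (rule fe_le[OF e(1)])
      fix y assume y: "dist x y < e k"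
      have "f y \<le> f x + L * norm (y - x)" by (rule flip)
      also have "L * norm (y - x) \<le> L * e k"
        using y L0 by (intro mult_left_mono) (auto simp: dist_norm norm_minus_commute)
      finally show "f y \<le> f x + L * e k" by simp
    qed
    then show ?thesis using True e(1)[of k] by (simp add: w_def field_simps)
  next
    case False
    then have "fe (e k) x = 0" using e[of k] by (intro fe0) auto
    moreover have "0 \<le> w x" using L0 by (simp add: w_def)
    moreover have "0 \<le> f x / e k" using f01(1)[of x] e(1)[of k] by simp
    ultimately show ?thesis by simp
  qed
  have Hb: "norm (H k x) \<le> w x" for k x
    using gw[of k x] hw[of x] h0(1)[of x] by (simp add: H_def)
  have [measurable]: "h \<in> borel_measurable borel" unfolding h_def by measurable
  have Hmeas: "H k \<in> borel_measurable borel" for k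
    unfolding H_def using fem[OF e(1)[of k]] by measurable
  have "(\<lambda>k. \<integral>x. H k x \<partial>lborel) \<longlonglongrightarrow> (\<integral>x. h x \<partial>lborel)"
  proof (rule integral_dominated_convergence[where w=w])
    show "AE x in lborel. (\<lambda>k. H k x) \<longlonglongrightarrow> h x"
    proof (intro AE_I2 order_tendstoI)
      fix x z assume "z < h x"
      then show "\<forall>\<^sub>F k in sequentially. z < H k x" by (intro always_eventually) (auto simp: H_def)
    next
      fix x z assume z: "h x < z"
      have "\<forall>\<^sub>F k in sequentially. (fe (e k) x - f x) / e k \<le> h x + (z - h x) / 2"
        using z by (intro upper) simp
      then show "\<forall>\<^sub>F k in sequentially. H k x < z"
      proof eventually_elim
        case (elim k)
        have "h x + (z - h x) / 2 < z" using z by (simp add: field_simps)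
        then show ?case using elim z unfolding H_def by linarith
      qed
    qed
    show "AE x in lborel. norm (H k x) \<le> w x" for k
      using Hb by (intro AE_I2) auto
  qed (use Hmeas int_w in auto)
  moreover have "c * (b - a) \<le> (\<integral>x. H k x \<partial>lborel)" for k
  proof -
    have "c * (b - a) \<le> (\<integral>x. (fe (e k) x - f x) / e k \<partial>lborel)" by (rule growth[OF e(1)])
    also have "\<dots> \<le> (\<integral>x. H k x \<partial>lborel)"
    proof (rule integral_mono)
      show "integrable lborel (H k)"
        using Hmeas Hb by (intro Bochner_Integration.integrable_bound[OF int_w] AE_I2)
          (auto intro: order_trans[OF _ abs_ge_self])
    qed (use int_f int_fe[OF e(1)] in \<open>auto simp: H_def\<close>)
    finally show ?thesis .
  qed
  ultimately have "c * (b - a) \<le> (\<integral>x. h x \<partial>lborel)"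
    by (intro LIMSEQ_le_const) auto
  then show ?thesis by (simp add: c_def rb_def h_def[abs_def] mult_ac)
qed


section \<open>The radial profile\<close>

text \<open>Bernoulli's inequality for y / x, multiplied by x ^ n. Equality holds for y = x, so a
  slope x equal to the true gradient length loses nothing.\<close>

lemma young_power:
  fixes x y :: real
  assumes "0 \<le> x" "0 \<le> y" "1 \<le> n"
  shows "real n * x ^ (n - 1) * y \<le> y ^ n + (real n - 1) * x ^ n"
proof (cases "x = 0")
  case True
  with assms show ?thesis by (cases "n = 1") (auto simp: power_0_left)
next
  case False
  with assms have x: "x > 0" by simp
  have "1 + real n * (y / x - 1) \<le> (1 + (y / x - 1)) ^ n"
    using x assms by (intro Bernoulli_inequality) (auto simp: field_simps)
  then have "(1 + real n * (y / x - 1)) * x ^ n \<le> (y / x) ^ n * x ^ n"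
    using x by (intro mult_right_mono) auto
  moreover have "(y / x) ^ n * x ^ n = y ^ n" using x by (simp add: power_divide)
  moreover have "x ^ n = x * x ^ (n - 1)" using assms by (cases n) auto
  then have "(1 + real n * (y / x - 1)) * x ^ n = x ^ n + real n * x ^ (n - 1) * y - real n * x ^ n"
    using x by (simp add: field_simps)
  ultimately show ?thesis by (simp add: algebra_simps)
qed

text \<open>
  \<open>M t\<close> is, up to the factor \<open>vol B\<^sub>1\<close>, the mass that the extremal \<open>mu / mu(R)\<close> gives to the
  ball of radius \<open>t\<close>, and \<open>q ^ n * Q R\<close> is the energy of the extremal up to the same factor.
\<close>

locale radial_profile =
  fixes n :: nat and R :: real
  assumes n: "2 \<le> n" and R: "0 < R"
begin

definition p :: real where "p = real n / (real n - 1)"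
definition D :: "real \<Rightarrow> real" where "D t = 1 + t powr p"
text \<open>\<open>g t ^ n\<close> is the ratio of the density at radius t to its boundary value, so
  \<open>g\<close> is exp of one n-th of the height of the extremal above its boundary
  value.\<close>

definition g :: "real \<Rightarrow> real" where "g t = D R / D t"
definition M :: "real \<Rightarrow> real" where "M t = D R ^ n * t ^ n / D t ^ (n - 1)"
definition Q :: "real \<Rightarrow> real" where
  "Q t = integral {0..t} (\<lambda>t. real n * t ^ (n - 1) * t powr p * g t ^ n)"
text \<open>Chosen so that the gradient of \<open>ln mu\<close> has length \<open>q\<close> times t
  powr (p - 1) times \<open>g t\<close> at radius t.\<close>

definition q :: real where "q = real n * p / D R"
text \<open>The antiderivative of n t ^ (n - 1) * g t ^ (n - 1) that vanishes at 0, integrated by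
  parts so that the energy \<open>Q\<close> becomes visible.\<close>

definition N :: "real \<Rightarrow> real" where
  "N t = t ^ n * g t ^ (n - 1) + (real n - 1) / (real n)\<^sup>2 * q * Q t"

lemma p: "1 < p" "p \<le> 2" "(real n - 1) * p = real n"
  using n by (auto simp: p_def field_simps)

lemma power_unfold: "x ^ n = x * x ^ (n - 1)" "x ^ (n - 1) = x * x ^ (n - 2)" for x :: real
  using n by (metis One_nat_def Suc_diff_le Suc_pred' diff_Suc_Suc less_le_trans numeral_2_eq_2
      pos2 power_Suc zero_less_diff lessI)+

lemma D_ge_1: "1 \<le> D t" and D_pos: "0 < D t"
  by (auto simp: D_def add_pos_nonneg)

lemma g_pos: "0 < g t" and q_pos: "0 < q"
  using D_pos p n by (auto simp: g_def q_def)

lemma continuous_D: "continuous_on {0..} D"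
  unfolding D_def using p by (intro continuous_on_add continuous_on_const continuous_on_powr' continuous_on_id) auto

lemma D_neq_0 [simp]: "D t \<noteq> 0" using D_pos[of t] by simp

lemma continuous_g: "continuous_on {0..} g" and continuous_M: "continuous_on {0..} M"
  unfolding g_def M_def by (intro continuous_intros continuous_D; simp)+

lemma continuous_Q_integrand: "continuous_on {0..} (\<lambda>t. real n * t ^ (n - 1) * t powr p * g t ^ n)"
  using p by (intro continuous_on_mult continuous_on_power continuous_on_const continuous_on_powr' continuous_on_id continuous_g) auto

section \<open>Derivatives of the profile functions\<close>

lemma DERIV_D: "0 < t \<Longrightarrow> (D has_real_derivative p * t powr (p - 1)) (at t)"
  unfolding D_def[abs_def] by (auto intro!: derivative_eq_intros)

lemma power_powr: "0 < t \<Longrightarrow> t * t powr (p - 1) = t powr p"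
  by (simp add: powr_diff)

lemma DERIV_g: "0 < t \<Longrightarrow> (g has_real_derivative - (g t)\<^sup>2 * p * t powr (p - 1) / D R) (at t)"
  unfolding g_def[abs_def]
  by (auto intro!: derivative_eq_intros DERIV_D simp: power2_eq_square field_simps)

lemma M_eq: "M t = D R * (t ^ n * g t ^ (n - 1))"
  unfolding M_def g_def by (simp add: power_divide power_unfold(1)[of "D R"])

text \<open>Shared by \<open>M\<close>, which is \<open>D R\<close> times this product, and by
  \<open>N\<close>, where the added multiple of \<open>Q\<close> cancels the second term.\<close>

lemma DERIV_tg: "0 < t \<Longrightarrow> ((\<lambda>t. t ^ n * g t ^ (n - 1)) has_real_derivative
   real n * t ^ (n - 1) * g t ^ (n - 1) - real (n - 1) * p / D R * t ^ (n - 1) * t powr p * g t ^ n) (at t)"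
proof -
  assume t: "0 < t"
  have "((\<lambda>t. t ^ n * g t ^ (n - 1)) has_real_derivative
     (real n * t ^ (n - Suc 0)) * g t ^ (n - 1)
     + (real (n - 1) * ((- (g t)\<^sup>2 * p * t powr (p - 1) / D R) * g t ^ (n - 1 - Suc 0))) * t ^ n) (at t)"
    by (intro DERIV_mult DERIV_pow DERIV_power DERIV_g t)
  moreover have "(real n * t ^ (n - Suc 0)) * g t ^ (n - 1)
     + (real (n - 1) * ((- (g t)\<^sup>2 * p * t powr (p - 1) / D R) * g t ^ (n - 1 - Suc 0))) * t ^ n
    = real n * t ^ (n - 1) * g t ^ (n - 1) - real (n - 1) * p / D R * t ^ (n - 1) * t powr p * g t ^ n"
  proof -
    have "n - 1 - Suc 0 = n - 2" by simp
    moreover have "t ^ n = t * t ^ (n - 1)" "g t ^ n = (g t)\<^sup>2 * g t ^ (n - 2)"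
      using power_unfold[of t] power_unfold[of "g t"] by (simp_all add: power2_eq_square)
    ultimately show ?thesis unfolding power_powr[OF t, symmetric] by (simp add: mult_ac)
  qed
  ultimately show ?thesis by (rule DERIV_cong)
qed

lemma DERIV_M: "0 < t \<Longrightarrow> (M has_real_derivative real n * t ^ (n - 1) * g t ^ n) (at t)"
proof -
  assume t: "0 < t"
  obtain m where m: "n = Suc m" using n by (cases n) auto
  have "((\<lambda>t. D R * (t ^ n * g t ^ (n - 1))) has_real_derivative
    D R * (real n * t ^ (n - 1) * g t ^ (n - 1) - real (n - 1) * p / D R * t ^ (n - 1) * t powr p * g t ^ n)) (at t)"
    by (rule DERIV_cmult[OF DERIV_tg[OF t]])
  moreover have "D R * (real n * t ^ (n - 1) * g t ^ (n - 1) - real (n - 1) * p / D R * t ^ (n - 1) * t powr p * g t ^ n)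
    = t ^ (n - 1) * g t ^ (n - 1) * (real n * D R - real (n - 1) * p * t powr p * g t)"
    by (simp add: power_unfold(1)[of "g t"] field_simps)
  \<comment> \<open>This relation between p and n lets D t = 1 + t powr p collapse the bracket to a
    multiple of \<open>g t\<close>; it is the reason why the mass of a ball has a closed
    form.\<close>
  also have "real (n - 1) * p = real n" using p n by (simp add: of_nat_diff)
  also have "real n * D R - real n * t powr p * g t = real n * g t"
  proof -
    have "D R = g t * (1 + t powr p)" using D_neq_0[of t] by (simp add: g_def D_def)
    then show ?thesis by (simp add: algebra_simps)
  qed
  also have "t ^ (n - 1) * g t ^ (n - 1) * (real n * g t) = real n * t ^ (n - 1) * g t ^ n"
    by (simp add: power_unfold(1)[of "g t"])
  finally show ?thesis unfolding M_eq[abs_def] .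
qed

lemma DERIV_Q: "0 < t \<Longrightarrow> (Q has_real_derivative real n * t ^ (n - 1) * t powr p * g t ^ n) (at t)"
proof -
  assume t: "0 < t"
  have "(Q has_real_derivative real n * t ^ (n - 1) * t powr p * g t ^ n) (at t within {0..t + 1})"
    unfolding Q_def[abs_def]
    by (rule integral_has_real_derivative[OF continuous_on_subset[OF continuous_Q_integrand]]) (use t in auto)
  moreover have "at t within {0..t + 1} = at t" using t by (intro at_within_interior) auto
  ultimately show ?thesis by simp
qed

lemma continuous_Q: "continuous_on {0..b} Q"
  unfolding Q_def[abs_def]
  by (intro indefinite_integral_continuous_1 integrable_continuous_real continuous_on_subset[OF continuous_Q_integrand]) auto

lemma DERIV_N: "0 < t \<Longrightarrow> (N has_real_derivative real n * t ^ (n - 1) * g t ^ (n - 1)) (at t)"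
proof -
  assume t: "0 < t"
  have "(N has_real_derivative
     (real n * t ^ (n - 1) * g t ^ (n - 1) - real (n - 1) * p / D R * t ^ (n - 1) * t powr p * g t ^ n)
     + (real n - 1) / (real n)\<^sup>2 * q * (real n * t ^ (n - 1) * t powr p * g t ^ n)) (at t)"
    unfolding N_def[abs_def] by (intro DERIV_add DERIV_tg DERIV_cmult DERIV_Q t)
  moreover have "(real n - 1) / (real n)\<^sup>2 * q * (real n * t ^ (n - 1) * t powr p * g t ^ n)
     = real (n - 1) * p / D R * t ^ (n - 1) * t powr p * g t ^ n"
    using n by (simp add: q_def power2_eq_square of_nat_diff)
  ultimately show ?thesis by simp
qed

lemma continuous_N: "continuous_on {0..b} N"
  unfolding N_def[abs_def]
  by (intro continuous_intros continuous_Q continuous_on_subset[OF continuous_g]) auto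

lemma M_0: "M 0 = 0" and N_0: "N 0 = 0" and Q_0: "Q 0 = 0"
  using n by (auto simp: M_def N_def Q_def)

lemma M_R: "M R = D R * R ^ n" and N_R: "N R = R ^ n + (real n - 1) / (real n)\<^sup>2 * q * Q R"
  by (auto simp: M_eq N_def g_def)

lemma M_strict_mono:
  assumes "0 \<le> s" "s < t"
  shows "M s < M t"
proof (rule DERIV_pos_imp_increasing_open[OF assms(2)])
  fix x assume "s < x" "x < t"
  then have "0 < x" using assms by simp
  then show "\<exists>y. DERIV M x :> y \<and> 0 < y"
    using DERIV_M[of x] g_pos[of x] n by (intro exI[of _ "real n * x ^ (n - 1) * g x ^ n"]) auto
next
  show "continuous_on {s..t} M" using assms by (intro continuous_on_subset[OF continuous_M]) auto
qed

text \<open>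
  The profile transports the level sets of a function to concentric balls: \<open>t\<close> and \<open>r\<close> are the
  radii of the image and of the level set, and at level \<open>n * ln B\<close> equal masses are removed from both.
\<close>

lemma transport_step:
  assumes T: "0 \<le> T'" "T' \<le> T" and r: "0 \<le> r'" "0 \<le> r" and B: "0 < B"
    and mass: "M T - M T' = B ^ n * (r ^ n - r' ^ n)"
  shows "(N T - N T') / B ^ (n - 1) \<le> T * r ^ (n - 1) - T' * r' ^ (n - 1)"
proof -
  obtain m where m: "n = Suc m" using n by (cases n) auto
  \<comment> \<open>The n-th root \<open>rr t\<close> of \<open>z t\<close> is the radius at which
    equal masses have been removed when the upper image radius is t; it runs from r' to r as t runs
    from T' to T.\<close>
  define z where "z t = r' ^ n + (M t - M T') / B ^ n" for t
  define rr where "rr t = root n (z t)" for t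
  have zpos: "0 < z t" if "T' < t" for t
    using M_strict_mono[OF T(1) that] r B by (auto simp: z_def intro!: add_nonneg_pos divide_pos_pos)
  have rr': "rr T' = r'" using r n by (simp add: rr_def z_def real_root_power_cancel)
  have "z T = r ^ n" unfolding z_def mass using B by simp
  then have rrT: "rr T = r" using r n by (simp add: rr_def real_root_power_cancel)
  define f where "f t = t * rr t ^ (n - 1) - N t / B ^ (n - 1)" for t
  have "f T' \<le> f T"
  \<comment> \<open>Only the open interval is differentiated: at T' the root has no derivative when
    r' = 0.\<close>
  proof (rule DERIV_nonneg_imp_increasing_open[OF T(2)])
    fix t assume t: "T' < t" "t < T"
    then have t0: "0 < t" using T by simp
    define s where "s = rr t"
    have s: "0 < s" "s ^ n = z t" using zpos[OF t(1)] n by (auto simp: s_def rr_def)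
    have dz: "(z has_real_derivative real n * t ^ (n - 1) * g t ^ n / B ^ n) (at t)"
      unfolding z_def[abs_def] using B by (auto intro!: derivative_eq_intros DERIV_M t0)
    have "(rr has_real_derivative inverse (real n * root n (z t) ^ (n - Suc 0)) * (real n * t ^ (n - 1) * g t ^ n / B ^ n)) (at t)"
      unfolding rr_def[abs_def] using zpos[OF t(1)] n
      by (intro DERIV_chain2[OF DERIV_real_root dz]) auto
    then have drr: "(rr has_real_derivative t ^ (n - 1) * g t ^ n / (B ^ n * s ^ (n - 1))) (at t)"
      using n by (simp add: s_def rr_def[symmetric] field_simps)
    have d: "(f has_real_derivative s ^ (n - 1)
         + t * (real (n - 1) * s ^ (n - 2) * (t ^ (n - 1) * g t ^ n / (B ^ n * s ^ (n - 1))))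
         - (real n * t ^ (n - 1) * g t ^ (n - 1)) / B ^ (n - 1)) (at t)"
    proof -
      have "(f has_real_derivative (1 * rr t ^ (n - 1) + (real (n - 1) * ((t ^ (n - 1) * g t ^ n / (B ^ n * s ^ (n - 1)))
          * rr t ^ (n - 1 - Suc 0))) * t) - (real n * t ^ (n - 1) * g t ^ (n - 1)) / B ^ (n - 1)) (at t)"
        unfolding f_def[abs_def]
        by (intro DERIV_diff DERIV_mult DERIV_ident DERIV_power drr DERIV_cdivide DERIV_N t0)
      moreover have "n - 1 - Suc 0 = n - 2" by simp
      ultimately show ?thesis by (simp add: s_def mult_ac)
    qed
    \<comment> \<open>After multiplication by s the derivative of f is exactly the deficit in
      Young's inequality for x and s. It vanishes when B s = t g t, as happens for the extremal
      itself, where s = t and B = \<open>g t\<close>.\<close>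
    define x where "x = t * g t / B"
    have x: "0 < x" using t0 B g_pos by (auto simp: x_def)
    obtain l where l: "n = Suc (Suc l)" using n by (metis add_2_eq_Suc le_Suc_ex)
    have "s * (s ^ (n - 1)
         + t * (real (n - 1) * s ^ (n - 2) * (t ^ (n - 1) * g t ^ n / (B ^ n * s ^ (n - 1))))
         - (real n * t ^ (n - 1) * g t ^ (n - 1)) / B ^ (n - 1))
       = s ^ n + (real n - 1) * x ^ n - real n * x ^ (n - 1) * s"
      using s(1) B by (simp add: x_def l field_simps)
    also have "\<dots> \<ge> 0" using young_power[of x s n] x s n by simp
    finally have "0 \<le> s ^ (n - 1)
         + t * (real (n - 1) * s ^ (n - 2) * (t ^ (n - 1) * g t ^ n / (B ^ n * s ^ (n - 1))))
         - (real n * t ^ (n - 1) * g t ^ (n - 1)) / B ^ (n - 1)"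
      using s(1) by (simp add: zero_le_mult_iff)
    with d show "\<exists>y. DERIV f t :> y \<and> 0 \<le> y" by blast
  next
    show "continuous_on {T'..T} f"
      unfolding f_def rr_def z_def using T B
      by (intro continuous_intros continuous_on_subset[OF continuous_N[of T]] continuous_on_subset[OF continuous_M]) auto
  qed
  then show ?thesis unfolding f_def rr' rrT by (simp add: diff_divide_distrib)
qed

text \<open>The derivatives of \<open>Q\<close> and \<open>M\<close> have ratio t powr p, which is
  at least its value at the lower endpoint.\<close>

lemma Q_step:
  assumes "0 \<le> T'" "T' \<le> T"
  shows "T' powr p * (M T - M T') \<le> Q T - Q T'"
proof -
  define f where "f t = Q t - T' powr p * M t" for t
  have "f T' \<le> f T"
  proof (rule DERIV_nonneg_imp_increasing_open[OF assms(2)])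
    fix t assume t: "T' < t" "t < T"
    then have t0: "0 < t" using assms by simp
    have "(f has_real_derivative real n * t ^ (n - 1) * t powr p * g t ^ n - T' powr p * (real n * t ^ (n - 1) * g t ^ n)) (at t)"
      unfolding f_def[abs_def] by (intro DERIV_diff DERIV_cmult DERIV_Q DERIV_M t0)
    moreover have "T' powr p \<le> t powr p" using t assms p by (intro powr_mono2) auto
    then have "T' powr p * (real n * t ^ (n - 1) * g t ^ n) \<le> t powr p * (real n * t ^ (n - 1) * g t ^ n)"
      using t0 g_pos[of t] by (intro mult_right_mono) auto
    ultimately show "\<exists>y. DERIV f t :> y \<and> 0 \<le> y" by (auto simp: mult_ac intro!: exI)
  next
    show "continuous_on {T'..T} f"
      unfolding f_def using assms
      by (intro continuous_intros continuous_on_subset[OF continuous_Q[of T]] continuous_on_subset[OF continuous_M]) auto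
  qed
  then show ?thesis by (simp add: f_def algebra_simps)
qed

text \<open>Because p = n / (n - 1), one root produces both the weight t in the gain term of Young's
  inequality and the weight t powr p in its cost term.\<close>

lemma root_power_eq_powr:
  assumes "0 \<le> t"
  shows "root (n - 1) t ^ (n - 1) = t" "root (n - 1) t ^ n = t powr p"
proof -
  show 1: "root (n - 1) t ^ (n - 1) = t" using assms n by (intro real_root_pow_pos2) auto
  show "root (n - 1) t ^ n = t powr p"
  proof (cases "t = 0")
    case True
    then show ?thesis using n by simp
  next
    case False
    then have t: "0 < t" using assms by simp
    have "root (n - 1) t = t powr (1 / (real n - 1))"
      using t n by (simp add: root_powr_inverse of_nat_diff inverse_eq_divide)
    then have "root (n - 1) t ^ n = t powr (real n * (1 / (real n - 1)))"
      using t by (simp only: powr_power)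
    then show ?thesis by (simp add: p_def)
  qed
qed

text \<open>The one-dimensional core of the energy estimate. \<open>r i\<close> stands for the
  radius of the ball with the volume of the i-th level set, and \<open>B i ^ n\<close> for exp of
  the height i * d, scaled by y ^ n to normalise the mass. The sum on the right is what Young's
  inequality with slopes \<open>a i\<close> yields over all slices, per unit of unit-ball
  volume.\<close>

theorem discrete_energy_bound:
  assumes r: "r 0 = R" "r K = 0" "\<And>i. i < K \<Longrightarrow> r (Suc i) \<le> r i" "\<And>i. i \<le> K \<Longrightarrow> 0 \<le> r i"
    and d: "0 < d" and y: "0 < y"
    and B: "\<And>i. B i = y * exp (real i * d / real n)"
    and mass: "(\<Sum>i<K. B (Suc i) ^ n * (r i ^ n - r (Suc i) ^ n)) = M R"
  obtains a where "\<And>i. 0 \<le> a i"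
    "real n ^ 3 / (real n - 1) * q ^ (n - 1) * (exp (- (real n - 1) * d / real n) * N R - y ^ (n - 1) * R ^ n)
       - (real n - 1) * q ^ n * Q R
     \<le> (\<Sum>i<K. (real n)\<^sup>2 * a i ^ (n - 1) * d * r (Suc i) ^ (n - 1)
           - (real n - 1) * a i ^ n * (r i ^ n - r (Suc i) ^ n))"
proof -
  have Bpos: "0 < B i" for i using B y by simp
  have rr: "0 \<le> r i ^ n - r (Suc i) ^ n" if "i < K" for i
    using r(3,4) that by (simp add: power_mono)
  \<comment> \<open>The normalised mass above level i. The radius \<open>T i\<close> found below is
    that of the concentric ball to which the extremal gives the same mass.\<close>
  define m where "m i = (\<Sum>j\<in>{i..<K}. B (Suc j) ^ n * (r j ^ n - r (Suc j) ^ n))" for i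
  have m_Suc: "m i = B (Suc i) ^ n * (r i ^ n - r (Suc i) ^ n) + m (Suc i)" if "i < K" for i
    unfolding m_def using that by (simp add: sum.atLeast_Suc_lessThan)
  have m0: "m 0 = M R" using mass by (simp add: m_def atLeast0LessThan)
  have mK: "m K = 0" by (simp add: m_def)
  have m_nonneg: "0 \<le> m i" for i
    unfolding m_def using Bpos rr by (intro sum_nonneg mult_nonneg_nonneg) (auto simp: less_imp_le)
  have m_le: "m i \<le> M R" for i
    unfolding m_def mass[symmetric] using Bpos rr
    by (intro sum_mono2 mult_nonneg_nonneg) (auto simp: less_imp_le)
  have "\<exists>t. 0 \<le> t \<and> t \<le> R \<and> M t = m i" for i
    using IVT'[of M 0 "m i" R] m_nonneg[of i] m_le[of i] R M_0
      continuous_on_subset[OF continuous_M, of "{0..R}"] by auto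
  then obtain T where T: "\<And>i. 0 \<le> T i" "\<And>i. T i \<le> R" "\<And>i. M (T i) = m i" by metis
  have inj: "s = t" if "0 \<le> s" "0 \<le> t" "M s = M t" for s t
    using M_strict_mono[of s t] M_strict_mono[of t s] that by (cases s t rule: linorder_cases) auto
  have T0: "T 0 = R" using inj[of "T 0" R] T m0 R by simp
  have TK: "T K = 0" using inj[of "T K" 0] T mK M_0 by simp
  have T_dec: "T (Suc i) \<le> T i" if "i < K" for i
  proof (rule ccontr)
    assume "\<not> T (Suc i) \<le> T i"
    then have "M (T i) < M (T (Suc i))" using T by (intro M_strict_mono) auto
    moreover have "0 \<le> B (Suc i) ^ n * (r i ^ n - r (Suc i) ^ n)" using rr that Bpos[of "Suc i"] by simp
    ultimately show False using m_Suc[OF that] T(3) by simp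
  qed
  \<comment> \<open>The ratio of consecutive weights \<open>E i\<close>.\<close>
  define \<eta> where "\<eta> = exp (- (real n - 1) * d / real n)"
  define P where "P i = T i * r i ^ (n - 1)" for i
  define E where "E i = B i ^ (n - 1)" for i
  have Epos: "0 < E i" for i using Bpos by (simp add: E_def)
  have E\<eta>: "E i = \<eta> * E (Suc i)" for i
  proof -
    have "B i = exp (- d / real n) * B (Suc i)"
      unfolding B using n by (simp add: exp_add[symmetric] add_divide_distrib distrib_right)
    moreover have "exp (- d / real n) ^ (n - 1) = \<eta>"
    proof -
      have "real (n - 1) * (- d / real n) = - (real n - 1) * d / real n"
        using n by (simp add: of_nat_diff field_simps)
      then show ?thesis unfolding \<eta>_def by (simp only: exp_of_nat_mult[symmetric])
    qed
    ultimately show ?thesis by (simp add: E_def power_mult_distrib)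
  qed
  \<comment> \<open>The tangent inequality for exp replaces the slice height d by a difference of
    weights, which prepares the summation by parts.\<close>
  have Ed: "real n / (real n - 1) * (E (Suc i) - E i) \<le> d * E (Suc i)" for i
  proof -
    have "1 - (real n - 1) * d / real n \<le> \<eta>"
      unfolding \<eta>_def using exp_ge_add_one_self[of "- (real n - 1) * d / real n"] by (simp add: algebra_simps diff_divide_distrib)
    then have "(1 - \<eta>) * E (Suc i) \<le> ((real n - 1) * d / real n) * E (Suc i)"
      using Epos[of "Suc i"] by (intro mult_right_mono) auto
    then have "E (Suc i) - E i \<le> (real n - 1) * d / real n * E (Suc i)"
      using E\<eta>[of i] by (simp add: algebra_simps)
    then have "real n / (real n - 1) * (E (Suc i) - E i) \<le> real n / (real n - 1) * ((real n - 1) * d / real n * E (Suc i))"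
      using n by (intro mult_left_mono) auto
    then show ?thesis using n by simp
  qed
  \<comment> \<open>Transport works with the upper weight \<open>B (Suc i)\<close>, whereas the
    summation by parts needs the lower weight \<open>E i\<close>; the change costs the factor
    \<eta>.\<close>
  have step: "E i * (P i - P (Suc i)) \<ge> \<eta> * (N (T i) - N (T (Suc i)))" if "i < K" for i
  proof -
    have "M (T i) - M (T (Suc i)) = B (Suc i) ^ n * (r i ^ n - r (Suc i) ^ n)"
      using m_Suc[OF that] T(3) by simp
    then have "(N (T i) - N (T (Suc i))) / B (Suc i) ^ (n - 1) \<le> P i - P (Suc i)"
      unfolding P_def using T(1) T_dec[OF that] r(4) that Bpos by (intro transport_step) auto
    then have "E i * ((N (T i) - N (T (Suc i))) / E (Suc i)) \<le> E i * (P i - P (Suc i))"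
      using Epos by (intro mult_left_mono) (auto simp: E_def less_imp_le)
    moreover have "E i * ((N (T i) - N (T (Suc i))) / E (Suc i)) = \<eta> * (N (T i) - N (T (Suc i)))"
      using E\<eta>[of i] Epos[of "Suc i"] by simp
    ultimately show ?thesis by simp
  qed
  have tele1: "(\<Sum>i<K. E (Suc i) * P (Suc i) - E i * P i) = E K * P K - E 0 * P 0"
    by (rule sum_lessThan_telescope)
  have tele2: "(\<Sum>i<K. f (T i) - f (T (Suc i))) = f R - f 0" for f :: "real \<Rightarrow> real"
    using sum_lessThan_telescope'[of "\<lambda>i. f (T i)" K] T0 TK by simp
  \<comment> \<open>The boundary term at the top vanishes together with the radii; the one at the
    bottom is the source of the term with y in the bound.\<close>
  have PK: "P K = 0" and P0: "E 0 * P 0 = y ^ (n - 1) * R ^ n"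
  proof -
    obtain k where "n = Suc k" using n by (cases n) auto
    then show "P K = 0" "E 0 * P 0 = y ^ (n - 1) * R ^ n"
      using TK T0 r by (auto simp: P_def E_def B)
  qed
  have "\<eta> * N R - y ^ (n - 1) * R ^ n
      = (\<Sum>i<K. E (Suc i) * P (Suc i) - E i * P i) + \<eta> * (\<Sum>i<K. N (T i) - N (T (Suc i)))"
    unfolding tele1 tele2 PK P0 N_0 by simp
  also have "\<dots> = (\<Sum>i<K. (E (Suc i) * P (Suc i) - E i * P i) + \<eta> * (N (T i) - N (T (Suc i))))"
    by (simp add: sum.distrib sum_distrib_left)
  also have "\<dots> \<le> (\<Sum>i<K. (E (Suc i) - E i) * P (Suc i))"
  proof (rule sum_mono)
    fix i assume "i \<in> {..<K}"
    then show "(E (Suc i) * P (Suc i) - E i * P i) + \<eta> * (N (T i) - N (T (Suc i))) \<le> (E (Suc i) - E i) * P (Suc i)"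
      using step[of i] by (simp add: algebra_simps)
  qed
  finally have A1: "real n / (real n - 1) * (\<eta> * N R - y ^ (n - 1) * R ^ n)
      \<le> real n / (real n - 1) * (\<Sum>i<K. (E (Suc i) - E i) * P (Suc i))"
    using n by (intro mult_left_mono) auto
  also have "\<dots> = (\<Sum>i<K. real n / (real n - 1) * (E (Suc i) - E i) * P (Suc i))"
    by (simp add: sum_distrib_left mult.assoc)
  also have "\<dots> \<le> (\<Sum>i<K. d * E (Suc i) * P (Suc i))"
    using Ed T r(4) by (intro sum_mono mult_right_mono) (auto simp: P_def)
  finally have A: "real n / (real n - 1) * (\<eta> * N R - y ^ (n - 1) * R ^ n) \<le> (\<Sum>i<K. d * E (Suc i) * P (Suc i))" .
  have C: "(\<Sum>i<K. T (Suc i) powr p * (M (T i) - M (T (Suc i)))) \<le> Q R"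
  proof -
    have "(\<Sum>i<K. T (Suc i) powr p * (M (T i) - M (T (Suc i)))) \<le> (\<Sum>i<K. Q (T i) - Q (T (Suc i)))"
      using T T_dec by (intro sum_mono Q_step) auto
    then show ?thesis using tele2[of Q] Q_0 by simp
  qed
  \<comment> \<open>The gradient length of the extremal at radius \<open>T (Suc i)\<close>: the
    exponent p - 1 equals 1 / (n - 1), and \<open>B (Suc i)\<close> stands where the extremal has
    the value of \<open>g\<close> at that radius.\<close>
  define a where "a i = q * root (n - 1) (T (Suc i)) * B (Suc i)" for i
  have a0: "0 \<le> a i" for i
    unfolding a_def using q_pos T Bpos[of "Suc i"] by (intro mult_nonneg_nonneg real_root_ge_zero) (auto simp: less_imp_le)
  have a1: "a i ^ (n - 1) = q ^ (n - 1) * T (Suc i) * E (Suc i)" for i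
    by (simp only: a_def power_mult_distrib root_power_eq_powr[OF T(1)] E_def)
  have a2: "a i ^ n = q ^ n * T (Suc i) powr p * B (Suc i) ^ n" for i
    by (simp only: a_def power_mult_distrib root_power_eq_powr[OF T(1)])
  have "real n ^ 3 / (real n - 1) * q ^ (n - 1) * (\<eta> * N R - y ^ (n - 1) * R ^ n) - (real n - 1) * q ^ n * Q R
     = (real n)\<^sup>2 * q ^ (n - 1) * (real n / (real n - 1) * (\<eta> * N R - y ^ (n - 1) * R ^ n)) - (real n - 1) * q ^ n * Q R"
    by (simp add: power2_eq_square power3_eq_cube)
  also have "\<dots> \<le> (real n)\<^sup>2 * q ^ (n - 1) * (\<Sum>i<K. d * E (Suc i) * P (Suc i))
      - (real n - 1) * q ^ n * (\<Sum>i<K. T (Suc i) powr p * (M (T i) - M (T (Suc i))))"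
    using A C q_pos n by (intro diff_mono mult_left_mono) auto
  also have "\<dots> = (\<Sum>i<K. (real n)\<^sup>2 * q ^ (n - 1) * (d * E (Suc i) * P (Suc i))
      - (real n - 1) * q ^ n * (T (Suc i) powr p * (M (T i) - M (T (Suc i)))))"
    by (simp add: sum_distrib_left sum_subtractf)
  also have "\<dots> = (\<Sum>i<K. (real n)\<^sup>2 * a i ^ (n - 1) * d * r (Suc i) ^ (n - 1)
           - (real n - 1) * a i ^ n * (r i ^ n - r (Suc i) ^ n))"
  proof (rule sum.cong)
    fix i assume "i \<in> {..<K}"
    then have "M (T i) - M (T (Suc i)) = B (Suc i) ^ n * (r i ^ n - r (Suc i) ^ n)"
      using m_Suc[of i] T(3) by simp
    then show "(real n)\<^sup>2 * q ^ (n - 1) * (d * E (Suc i) * P (Suc i))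
      - (real n - 1) * q ^ n * (T (Suc i) powr p * (M (T i) - M (T (Suc i))))
      = (real n)\<^sup>2 * a i ^ (n - 1) * d * r (Suc i) ^ (n - 1)
           - (real n - 1) * a i ^ n * (r i ^ n - r (Suc i) ^ n)"
      unfolding a1 a2 P_def by (simp add: mult_ac)
  qed simp
  finally show ?thesis using that[of a] a0 unfolding \<eta>_def by blast
qed

text \<open>The consistency check behind sharpness: for zero mesh width and y = 1, the gain n q ^ n
  Q R minus the cost (n - 1) q ^ n Q R leaves exactly the energy of the extremal.\<close>

lemma energy_identity:
  "real n ^ 3 / (real n - 1) * q ^ (n - 1) * (N R - R ^ n) - (real n - 1) * q ^ n * Q R = q ^ n * Q R"
proof -
  obtain m where m: "n = Suc m" using n by (cases n) auto
  have "real n ^ 3 / (real n - 1) * q ^ (n - 1) * (N R - R ^ n)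
     = real n ^ 3 / (real n - 1) * q ^ (n - 1) * ((real n - 1) / (real n)\<^sup>2 * q * Q R)"
    by (simp add: N_R)
  also have "\<dots> = real n * q ^ n * Q R"
    using n by (simp add: power_unfold(1)[of q] power2_eq_square power3_eq_cube)
  finally show ?thesis by (simp add: algebra_simps)
qed

end


section \<open>Radial integrals\<close>

text \<open>Polar coordinates for radial functions. Two measures on the line that are finite on the
  half-lines (x, infinity) and agree there are equal, and on these the claim is the volume of a
  spherical shell.\<close>

lemma distr_norm_lborel_ball:
  fixes R :: real
  assumes R: "0 < R"
  defines "n \<equiv> DIM('a::euclidean_space)" and "W \<equiv> measure lborel (ball (0::'a) 1)"
  shows "distr (density lborel (indicator (ball (0::'a) R))) borel norm
     = density lborel (\<lambda>t. ennreal (real n * W * t ^ (n - 1)) * indicator {0..R} t)"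
    (is "?M1 = ?M2")
proof (rule measure_eqI_lessThan)
  have n: "0 < n" by (simp add: n_def)
  have W: "0 \<le> W" by (simp add: W_def)
  have ball: "emeasure lborel (ball (0::'a) r) = ennreal (W * r ^ n)" "emeasure lborel (cball (0::'a) r) = ennreal (W * r ^ n)"
    if "0 \<le> r" for r
    using that by (auto simp: emeasure_ball emeasure_cball W_def content_ball n_def)
  have M1: "emeasure ?M1 {x<..} = emeasure lborel {y \<in> ball (0::'a) R. x < norm y}" for x
  proof -
    have "emeasure ?M1 {x<..} = (\<integral>\<^sup>+ y. indicator (ball 0 R) y * indicator (norm -` {x<..}) y \<partial>(lborel :: 'a measure))"
    proof -
      have "{y::'a. x < norm y} \<in> sets borel" by measurable
      moreover have "(indicator (ball 0 R) :: 'a \<Rightarrow> ennreal) \<in> borel_measurable lborel"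
        by (intro borel_measurable_indicator) simp
      ultimately show ?thesis by (simp add: emeasure_distr emeasure_density vimage_def)
    qed
    also have "\<dots> = (\<integral>\<^sup>+ y. indicator {y \<in> ball 0 R. x < norm y} y \<partial>(lborel :: 'a measure))"
      by (intro nn_integral_cong) (auto simp: indicator_def)
    finally show ?thesis by simp
  qed
  show "emeasure ?M1 {x<..} < \<infinity>" for x
  proof -
    have "emeasure lborel {y \<in> ball (0::'a) R. x < norm y} < \<infinity>"
      by (rule emeasure_bounded_finite[OF bounded_subset[OF bounded_ball[of 0 R]]]) auto
    then show ?thesis by (simp add: M1)
  qed
  show "emeasure ?M1 {x<..} = emeasure ?M2 {x<..}" for x
  proof -
    have M2: "emeasure ?M2 {x<..} = (\<integral>\<^sup>+ t. ennreal (real n * W * t ^ (n - 1)) * indicator {max x 0..R} t \<partial>lborel)"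
    proof -
      have "emeasure ?M2 {x<..} = (\<integral>\<^sup>+ t. ennreal (real n * W * t ^ (n - 1)) * indicator {0..R} t * indicator {x<..} t \<partial>lborel)"
        by (simp add: emeasure_density)
      \<comment> \<open>The open half-line may be closed at x, because a single point is a null
        set.\<close>
      also have "\<dots> = (\<integral>\<^sup>+ t. ennreal (real n * W * t ^ (n - 1)) * indicator {max x 0..R} t \<partial>lborel)"
        by (intro nn_integral_cong_AE eventually_mono[OF AE_lborel_singleton[of x]]) (auto simp: indicator_def)
      finally show ?thesis .
    qed
    show ?thesis
    proof (cases "x \<le> R")
      case True
      let ?a = "max x 0"
      have "emeasure ?M2 {x<..} = ennreal (W * R ^ n - W * ?a ^ n)"
        unfolding M2
      proof (rule nn_integral_FTC_Icc)
        show "((\<lambda>t. W * t ^ n) has_real_derivative real n * W * t ^ (n - 1)) (at t)" for t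
          by (auto intro!: derivative_eq_intros)
      qed (use W R True in auto)
      also have "\<dots> = emeasure ?M1 {x<..}"
      proof (cases "0 \<le> x")
        case True
        then have "{y \<in> ball (0::'a) R. x < norm y} = ball 0 R - cball 0 x" by auto
        moreover have "emeasure lborel (ball (0::'a) R - cball 0 x) = ennreal (W * R ^ n - W * x ^ n)"
        proof (cases "x = R")
          case True
          have "ball (0::'a) R - cball 0 R = {}" by auto
          then show ?thesis using True by (simp only: emeasure_empty) simp
        next
          case False
          then have "emeasure lborel (ball (0::'a) R - cball 0 x) = emeasure lborel (ball (0::'a) R) - emeasure lborel (cball (0::'a) x)"
            using \<open>x \<le> R\<close> \<open>0 \<le> x\<close> by (intro emeasure_Diff) (auto simp: ball)
          also have "\<dots> = ennreal (W * R ^ n - W * x ^ n)"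
            using \<open>0 \<le> x\<close> R W by (simp add: ball ennreal_minus)
          finally show ?thesis .
        qed
        ultimately show ?thesis using True by (simp add: M1)
      next
        case False
        then have "{y \<in> ball (0::'a) R. x < norm y} = ball 0 R"
          by (auto intro: less_le_trans[OF _ norm_ge_zero])
        then show ?thesis using False R n by (simp add: M1 ball power_0_left)
      qed
      finally show ?thesis ..
    next
      case False
      then have e: "{y \<in> ball (0::'a) R. x < norm y} = {}" "{max x 0..R} = {}" by auto
      show ?thesis unfolding M1 M2 e by simp
    qed
  qed
qed auto

lemma radial_integral:
  fixes f :: "real \<Rightarrow> real"
  assumes R: "0 < R" and f: "continuous_on {0..R} f"
  shows "set_integrable lborel (ball (0::'a::euclidean_space) R) (\<lambda>x. f (norm x))"
    and "(LINT x:ball (0::'a) R|lborel. f (norm x))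
      = real DIM('a) * measure lborel (ball (0::'a) 1) * integral {0..R} (\<lambda>t. t ^ (DIM('a) - 1) * f t)"
proof -
  let ?n = "DIM('a)" and ?W = "measure lborel (ball (0::'a) 1)"
  \<comment> \<open>Continuity is given on [0, R] only; extension by 0 yields a Borel function on
    the whole line to which the change of variables applies.\<close>
  define h where "h t = indicator {0..R} t *\<^sub>R f t" for t
  have h: "h \<in> borel_measurable borel"
    unfolding h_def by (rule borel_measurable_continuous_on_indicator) (use f in auto)
  have hn: "(\<lambda>x::'a. h (norm x)) \<in> borel_measurable borel"
    by (rule measurable_compose[OF _ h]) simp
  have "compact (f ` {0..R})" using f by (intro compact_continuous_image) auto
  then obtain B where B: "\<And>t. t \<in> {0..R} \<Longrightarrow> norm (f t) \<le> B"
    by (meson bounded_iff compact_imp_bounded imageI)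
  have B0: "0 \<le> B" using B[of 0] R norm_ge_zero[of "f 0"] by (simp del: norm_ge_zero)
  have eq: "indicator (ball 0 R) x *\<^sub>R f (norm x) = indicator (ball 0 R) x *\<^sub>R h (norm x)" for x :: 'a
    by (auto simp: h_def indicator_def)
  show "set_integrable lborel (ball (0::'a) R) (\<lambda>x. f (norm x))"
    unfolding set_integrable_def eq
  proof (rule integrableI_bounded_set[where A="ball 0 R" and B=B])
    show "AE x in lborel. x \<in> ball (0::'a) R \<longrightarrow> norm (indicat_real (ball 0 R) x *\<^sub>R h (norm x)) \<le> B"
      using B B0 by (auto simp: h_def indicator_def)
    show "(\<lambda>x. indicat_real (ball 0 R) x *\<^sub>R h (norm x)) \<in> borel_measurable (lborel :: 'a measure)"
      using hn by (auto intro!: borel_measurable_times borel_measurable_indicator)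
  qed (use emeasure_bounded_finite[OF bounded_ball] in auto)
  have "(LINT x:ball (0::'a) R|lborel. f (norm x)) = (\<integral>x. indicator (ball 0 R) x *\<^sub>R h (norm x) \<partial>(lborel :: 'a measure))"
    unfolding set_lebesgue_integral_def eq ..
  also have "\<dots> = (\<integral>x. h (norm x) \<partial>(density lborel (\<lambda>x::'a. ennreal (indicator (ball 0 R) x))))"
    using hn by (subst integral_density) (auto intro!: borel_measurable_indicator)
  also have "\<dots> = (\<integral>t. h t \<partial>(distr (density lborel (indicator (ball (0::'a) R))) borel norm))"
    using h by (subst integral_distr) (auto simp: ennreal_indicator)
  also have "\<dots> = (\<integral>t. h t \<partial>(density lborel (\<lambda>t. ennreal (real ?n * ?W * t ^ (?n - 1) * indicator {0..R} t))))"
    unfolding distr_norm_lborel_ball[OF R]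
    by (intro arg_cong2[where f="integral\<^sup>L"] refl arg_cong[where f="density lborel"] ext)
      (auto simp: indicator_def)
  also have "\<dots> = (\<integral>t. (real ?n * ?W * t ^ (?n - 1) * indicator {0..R} t) *\<^sub>R h t \<partial>lborel)"
    using h by (intro integral_density) (auto simp: indicator_def)
  also have "\<dots> = (LINT t:{0..R}|lborel. real ?n * ?W * (t ^ (?n - 1) * f t))"
    unfolding set_lebesgue_integral_def by (intro Bochner_Integration.integral_cong) (auto simp: h_def indicator_def)
  also have "\<dots> = integral {0..R} (\<lambda>t. real ?n * ?W * (t ^ (?n - 1) * f t))"
    by (intro set_borel_integral_eq_integral(2) borel_integrable_atLeastAtMost') (intro continuous_intros f)
  finally show "(LINT x:ball (0::'a) R|lborel. f (norm x))
      = real ?n * ?W * integral {0..R} (\<lambda>t. t ^ (?n - 1) * f t)" by simp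
qed


section \<open>The density\<close>

text \<open>The origin is the delicate point, since p - 2 may be negative: there p > 1 makes the
  difference quotient tend to 0.\<close>

lemma GDERIV_norm_powr:
  fixes x :: "'a::real_inner"
  assumes p: "1 < p"
  shows "GDERIV (\<lambda>x. norm x powr p) x :> (p * norm x powr (p - 2)) *\<^sub>R x"
proof (cases "x = 0")
  case True
  have "((\<lambda>h::'a. norm h powr p / norm h) \<longlongrightarrow> 0) (at 0)"
  proof -
    have "((\<lambda>h::'a. norm h powr (p - 1)) \<longlongrightarrow> norm (0::'a) powr (p - 1)) (at 0)"
      using p by (intro tendsto_powr' tendsto_intros) auto
    moreover have "norm h powr (p - 1) = norm h powr p / norm h" if "h \<noteq> 0" for h :: 'a
      using that by (simp add: powr_diff)
    ultimately show ?thesis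
      using p by (auto elim!: Lim_transform_within[where d=1])
  qed
  then show ?thesis
    using True p unfolding gderiv_def has_derivative_at by (simp add: bounded_linear_zero)
next
  case False
  have "((\<lambda>t. t powr p) has_real_derivative p * norm x powr (p - 1)) (at (norm x))"
    using False by (auto intro!: derivative_eq_intros)
  from GDERIV_DERIV_compose[OF GDERIV_norm[OF False] this]
  have "GDERIV (\<lambda>x. norm x powr p) x :> (p * norm x powr (p - 1)) *\<^sub>R sgn x" .
  moreover have "(p * norm x powr (p - 1)) *\<^sub>R sgn x = (p * norm x powr (p - 2)) *\<^sub>R x"
  proof -
    have "norm x powr (p - 1) = norm x powr (p - 2) * norm x"
      using False powr_add[of "norm x" "p - 2" 1] by simp
    then show ?thesis using False by (simp add: sgn_div_norm)
  qed
  ultimately show ?thesis by simp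
qed

lemma norm_powr_scaleR:
  fixes x :: "'a::real_normed_vector"
  shows "norm (norm x powr (p - 2) *\<^sub>R x) = norm x powr (p - 1)"
proof (cases "x = 0")
  case False
  then show ?thesis using powr_add[of "norm x" "p - 2" 1] by simp
qed simp

text \<open>At the origin the field tends to 0 because its norm is norm x powr (p - 1) with p - 1
  positive.\<close>

lemma continuous_on_norm_powr_scaleR:
  fixes S :: "'a::real_normed_vector set"
  assumes p: "1 < p"
  shows "continuous_on S (\<lambda>x. norm x powr (p - 2) *\<^sub>R x)"
proof -
  have "isCont (\<lambda>x. norm x powr (p - 2) *\<^sub>R x) x" for x :: 'a
  proof (cases "x = 0")
    case True
    have "((\<lambda>h::'a. norm h powr (p - 1)) \<longlongrightarrow> norm (0::'a) powr (p - 1)) (at 0)"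
      using p by (intro tendsto_powr' tendsto_intros) auto
    then have "((\<lambda>h::'a. norm (norm h powr (p - 2) *\<^sub>R h)) \<longlongrightarrow> 0) (at 0)"
      unfolding norm_powr_scaleR using p by simp
    then have "((\<lambda>h::'a. norm h powr (p - 2) *\<^sub>R h) \<longlongrightarrow> 0) (at 0)" by (rule tendsto_norm_zero_cancel)
    then show ?thesis using True by (simp add: isCont_def)
  next
    case False
    then show ?thesis by (intro continuous_intros) auto
  qed
  then show ?thesis by (auto intro!: continuous_at_imp_continuous_on)
qed

lemma grad_eqI: "GDERIV f x :> D \<Longrightarrow> grad f x = D"
  unfolding grad_def
proof (rule the_equality)
  fix D' assume "GDERIV f x :> D" "GDERIV f x :> D'"
  then have "(\<lambda>h. h \<bullet> D) = (\<lambda>h. h \<bullet> D')" unfolding gderiv_def by (rule has_derivative_unique)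
  then have "(D' - D) \<bullet> D = (D' - D) \<bullet> D'" by (rule fun_cong)
  then have "(D' - D) \<bullet> (D' - D) = 0" by (simp add: inner_diff_right)
  then show "D' = D" by simp
qed

lemma set_lebesgue_integral_completion:
  fixes f :: "'a::euclidean_space \<Rightarrow> 'b::{banach, second_countable_topology}"
  assumes "A \<in> sets borel" "f \<in> borel_measurable borel"
  shows "(LINT x:A|lebesgue. f x) = (LINT x:A|lborel. f x)"
    and "set_integrable lebesgue A f \<longleftrightarrow> set_integrable lborel A f"
proof -
  have "(\<lambda>x. indicat_real A x *\<^sub>R f x) \<in> borel_measurable lborel"
    using assms by (auto intro!: borel_measurable_scaleR borel_measurable_indicator)
  then show "(LINT x:A|lebesgue. f x) = (LINT x:A|lborel. f x)"
    "set_integrable lebesgue A f \<longleftrightarrow> set_integrable lborel A f"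
    unfolding set_lebesgue_integral_def set_integrable_def
    by (simp_all add: integral_completion integrable_completion)
qed

text \<open>The type argument ties the dimension of the radial profile to the index type 'n, and
  \<open>vol1\<close> names the volume of the unit ball, to which all constants are reduced.\<close>

locale onofri_ball = radial_profile "CARD('n::finite)" R for T :: "'n::finite itself" and R :: real +
  fixes vol1 :: real
  assumes vol1_def: "vol1 = measure lborel (ball (0 :: real ^ 'n) 1)"
begin

section \<open>The density in terms of the radial profile\<close>

lemma vol1_pos: "0 < vol1" by (simp add: vol1_def)

text \<open>The truncated cone over the whole sphere is the closed unit ball without its centre, and
  a point has volume 0.\<close>

lemma sphere_area_eq: "sphere_area TYPE('n) = real CARD('n) * vol1"
proof -
  have "{r *\<^sub>R x | r x. 0 < r \<and> r \<le> 1 \<and> x \<in> sphere (0 :: real ^ 'n) 1} = cball 0 1 - {0}"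
  proof (intro set_eqI iffI)
    fix y :: "real ^ 'n" assume "y \<in> cball 0 1 - {0}"
    then show "y \<in> {r *\<^sub>R x | r x. 0 < r \<and> r \<le> 1 \<and> x \<in> sphere (0 :: real ^ 'n) 1}"
      by (intro CollectI exI[of _ "norm y"] exI[of _ "sgn y"]) (auto simp: sgn_div_norm)
  qed auto
  moreover have "measure lebesgue (cball (0 :: real ^ 'n) 1 - {0}) = measure lebesgue (cball (0 :: real ^ 'n) 1)"
    by (intro measure_Diff_null_set) auto
  ultimately show ?thesis
    unfolding sphere_area_def sphere_measure_def by (simp add: content_cball content_ball vol1_def)
qed

lemma mu_eq: "mu (y :: real ^ 'n) = 1 / (vol1 * D (norm y) ^ CARD('n))"
  unfolding mu_def sphere_area_eq D_def p_def using n by simp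

lemma mu_pos: "0 < mu (y :: real ^ 'n)"
  unfolding mu_eq using D_pos vol1_pos by simp

lemma continuous_on_D_norm: "continuous_on S (\<lambda>y :: real ^ 'n. D (norm y))"
  by (rule continuous_on_compose2[OF continuous_D]) (auto intro!: continuous_intros)

lemma continuous_on_mu: "continuous_on S (mu :: real ^ 'n \<Rightarrow> real)"
  unfolding mu_eq[abs_def] using vol1_pos by (intro continuous_intros continuous_on_D_norm) auto

lemma mu_borel [measurable]: "(mu :: real ^ 'n \<Rightarrow> real) \<in> borel_measurable borel"
  by (rule borel_measurable_continuous_onI[OF continuous_on_mu])

text \<open>\<open>M\<close> divided by \<open>D R ^ n\<close> no longer involves R and is an
  antiderivative of the integrand, so r may be any positive radius here.\<close>

lemma mass_integral:
  assumes r: "0 < r"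
  shows "integral {0..r} (\<lambda>t. real CARD('n) * t ^ (CARD('n) - 1) / D t ^ CARD('n)) = r ^ CARD('n) / D r ^ (CARD('n) - 1)"
proof -
  have e: "M t / D R ^ CARD('n) = t ^ CARD('n) / D t ^ (CARD('n) - 1)" for t
    by (simp add: M_def)
  have "((\<lambda>t. real CARD('n) * t ^ (CARD('n) - 1) / D t ^ CARD('n)) has_integral M r / D R ^ CARD('n) - M 0 / D R ^ CARD('n)) {0..r}"
  proof (rule fundamental_theorem_of_calculus_interior)
    show "continuous_on {0..r} (\<lambda>t. M t / D R ^ CARD('n))"
      by (intro continuous_intros continuous_on_subset[OF continuous_M]) auto
    fix x assume "x \<in> {0<..<r}"
    then have x: "0 < x" by simp
    have "((\<lambda>t. M t / D R ^ CARD('n)) has_real_derivative real CARD('n) * x ^ (CARD('n) - 1) * g x ^ CARD('n) / D R ^ CARD('n)) (at x)"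
      by (intro DERIV_cdivide DERIV_M x)
    also have "real CARD('n) * x ^ (CARD('n) - 1) * g x ^ CARD('n) / D R ^ CARD('n) = real CARD('n) * x ^ (CARD('n) - 1) / D x ^ CARD('n)"
      by (simp add: g_def power_divide)
    finally show "((\<lambda>t. M t / D R ^ CARD('n)) has_vector_derivative real CARD('n) * x ^ (CARD('n) - 1) / D x ^ CARD('n)) (at x)"
      by (simp add: has_real_derivative_iff_has_vector_derivative)
  qed (use r in auto)
  then show ?thesis by (simp add: integral_unique M_0 e)
qed

lemma mu_ball_integral:
  assumes r: "0 < r"
  shows "set_integrable lborel (ball 0 r) (mu :: real ^ 'n \<Rightarrow> real)"
    and "(LINT y:ball (0 :: real ^ 'n) r|lborel. mu y) = r ^ CARD('n) / D r ^ (CARD('n) - 1)"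
proof -
  have c: "continuous_on {0..r} (\<lambda>t. 1 / (vol1 * D t ^ CARD('n)))"
    using vol1_pos by (intro continuous_intros continuous_on_subset[OF continuous_D]) auto
  show "set_integrable lborel (ball 0 r) (mu :: real ^ 'n \<Rightarrow> real)"
    using radial_integral(1)[OF r c, where 'a="real ^ 'n"] by (simp add: mu_eq[abs_def])
  have "(LINT y:ball (0 :: real ^ 'n) r|lborel. mu y) = real CARD('n) * vol1 * integral {0..r} (\<lambda>t. t ^ (CARD('n) - 1) * (1 / (vol1 * D t ^ CARD('n))))"
    using radial_integral(2)[OF r c, where 'a="real ^ 'n"] by (simp add: mu_eq vol1_def)
  also have "\<dots> = integral {0..r} (\<lambda>t. real CARD('n) * vol1 * (t ^ (CARD('n) - 1) * (1 / (vol1 * D t ^ CARD('n)))))"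
    by (rule integral_mult_right[symmetric])
  also have "(\<lambda>t. real CARD('n) * vol1 * (t ^ (CARD('n) - 1) * (1 / (vol1 * D t ^ CARD('n))))) = (\<lambda>t. real CARD('n) * t ^ (CARD('n) - 1) / D t ^ CARD('n))"
    using vol1_pos by (auto simp: fun_eq_iff)
  finally show "(LINT y:ball (0 :: real ^ 'n) r|lborel. mu y) = r ^ CARD('n) / D r ^ (CARD('n) - 1)"
    unfolding mass_integral[OF r] .
qed

lemma theta_eq: "theta TYPE('n) R = R ^ CARD('n) / D R ^ (CARD('n) - 1)"
  unfolding theta_def by (subst set_lebesgue_integral_completion(1)) (simp_all add: mu_ball_integral R)

text \<open>The ball of radius r has mass (1 - 1 / D r) ^ (n - 1), which tends to 1 because
  \<open>D\<close> is unbounded; monotone convergence over growing balls gives the total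
  mass.\<close>

lemma mu_prob: "(mu :: real ^ 'n \<Rightarrow> real) \<in> prob_densities"
proof -
  let ?f = "\<lambda>k x :: real ^ 'n. indicator (ball 0 (real (Suc k))) x *\<^sub>R mu x"
  have i: "integrable lborel (?f k)" for k
    using mu_ball_integral(1)[of "real (Suc k)"] by (simp add: set_integrable_def)
  have "(\<lambda>k. real (Suc k) ^ CARD('n) / D (real (Suc k)) ^ (CARD('n) - 1)) \<longlonglongrightarrow> 1"
  proof -
    have e: "r ^ CARD('n) / D r ^ (CARD('n) - 1) = (1 - 1 / D r) ^ (CARD('n) - 1)" if r: "0 < r" for r
    proof -
      have "(r powr p) ^ (CARD('n) - 1) = r powr (real (CARD('n) - 1) * p)" using r by (simp only: powr_power)
      also have "real (CARD('n) - 1) * p = real CARD('n)" using p n by (simp add: of_nat_diff)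
      finally have "(r powr p) ^ (CARD('n) - 1) = r ^ CARD('n)" using r by (simp add: powr_realpow)
      moreover have "1 - 1 / D r = r powr p / D r" using D_neq_0[of r] by (simp add: field_simps) (simp add: D_def)
      ultimately show ?thesis by (simp add: power_divide)
    qed
    have "filterlim (\<lambda>k. real (Suc k)) at_top sequentially"
      by (rule filterlim_compose[OF filterlim_real_sequentially filterlim_Suc])
    moreover have "filterlim D at_top at_top"
      unfolding D_def[abs_def] using p
      by (intro filterlim_tendsto_add_at_top[OF tendsto_const] real_powr_at_top) auto
    ultimately have "filterlim (\<lambda>k. D (real (Suc k))) at_top sequentially"
      by (rule filterlim_compose[rotated])
    then have "(\<lambda>k. 1 / D (real (Suc k))) \<longlonglongrightarrow> 0"
      by (intro tendsto_divide_0[OF tendsto_const] filterlim_at_top_imp_at_infinity)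
    then have "(\<lambda>k. (1 - 1 / D (real (Suc k))) ^ (CARD('n) - 1)) \<longlonglongrightarrow> (1 - 0) ^ (CARD('n) - 1)"
      by (intro tendsto_intros)
    moreover have "(\<lambda>k. real (Suc k) ^ CARD('n) / D (real (Suc k)) ^ (CARD('n) - 1))
        = (\<lambda>k. (1 - 1 / D (real (Suc k))) ^ (CARD('n) - 1))"
      by (intro ext e) simp
    ultimately show ?thesis by simp
  qed
  then have lim: "(\<lambda>k. integral\<^sup>L lborel (?f k)) \<longlonglongrightarrow> 1"
    using mu_ball_integral(2)[of "real (Suc _)"] by (simp add: set_lebesgue_integral_def)
  have mono: "AE x in lborel. mono (\<lambda>k. ?f k x)"
    using mu_pos by (intro AE_I2 monoI) (auto simp: indicator_def less_imp_le)
  have nonneg: "AE x in lborel. 0 \<le> ?f k x" for k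
    using mu_pos by (auto simp: less_imp_le)
  have ptw: "AE x in lborel. (\<lambda>k. ?f k x) \<longlonglongrightarrow> mu x"
  proof (intro AE_I2 tendsto_eventually)
    fix x :: "real ^ 'n"
    obtain k0 where k0: "norm x < real k0" using reals_Archimedean2 by blast
    show "\<forall>\<^sub>F k in sequentially. ?f k x = mu x"
      using eventually_ge_at_top[of k0] by eventually_elim (use k0 in \<open>auto simp: indicator_def\<close>)
  qed
  have "integrable lborel (mu :: real ^ 'n \<Rightarrow> real)" "integral\<^sup>L lborel (mu :: real ^ 'n \<Rightarrow> real) = 1"
    using integral_monotone_convergence_nonneg[OF i mono nonneg ptw lim] by auto
  then show ?thesis
    unfolding prob_densities_def using mu_pos mu_borel
    by (auto simp: integral_completion integrable_completion less_imp_le intro!: measurable_completion)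
qed

lemma mu_admissible: "(mu :: real ^ 'n \<Rightarrow> real) \<in> admissible_densities R"
  using mu_prob by (simp add: admissible_densities_def theta_def)

section \<open>Gradient and energy of \<open>ln mu\<close>\<close>

definition Dm :: "real ^ 'n \<Rightarrow> real ^ 'n" where
  "Dm x = - (real CARD('n) * p / D (norm x)) *\<^sub>R (norm x powr (p - 2) *\<^sub>R x)"

lemma GDERIV_D_norm: "GDERIV (\<lambda>x :: real ^ 'n. D (norm x)) x :> p *\<^sub>R (norm x powr (p - 2) *\<^sub>R x)"
  using GDERIV_add[OF GDERIV_const[of 1 x] GDERIV_norm_powr[OF p(1), of x]] by (simp add: D_def)

lemma ln_mu: "ln (mu x) = - ln vol1 - real CARD('n) * ln (D (norm (x :: real ^ 'n)))"
  unfolding mu_eq using D_pos vol1_pos by (simp add: ln_div ln_mult ln_realpow)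

lemma GDERIV_ln_mu: "GDERIV (\<lambda>y :: real ^ 'n. ln (mu y)) x :> Dm x"
proof -
  have "((\<lambda>t. - ln vol1 - real CARD('n) * ln t) has_real_derivative - (real CARD('n) / D (norm x))) (at (D (norm x)))"
    using D_pos[of "norm x"] by (auto intro!: derivative_eq_intros)
  from GDERIV_DERIV_compose[OF GDERIV_D_norm this] show ?thesis
    unfolding ln_mu by (simp add: Dm_def mult.assoc)
qed

lemma grad_ln_mu: "grad (\<lambda>y :: real ^ 'n. ln (mu y)) x = Dm x"
  by (rule grad_eqI[OF GDERIV_ln_mu])

lemma continuous_on_Dm: "continuous_on S Dm"
  unfolding Dm_def using p
  by (intro continuous_intros continuous_on_norm_powr_scaleR continuous_on_D_norm) auto

lemma norm_Dm: "norm (Dm x) = real CARD('n) * p * norm x powr (p - 1) / D (norm x)"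
  unfolding Dm_def norm_scaleR norm_powr_scaleR[unfolded norm_scaleR] using p D_pos[of "norm x"]
  by (simp add: norm_powr_scaleR[unfolded norm_scaleR] abs_mult)

text \<open>For norm x at most 1 the power in the numerator is at most 1; beyond that it is
  dominated by norm x powr p, hence by \<open>D\<close>.\<close>

lemma norm_Dm_le: "norm (Dm x) \<le> real CARD('n) * p"
proof -
  have "norm x powr (p - 1) \<le> D (norm x)"
  proof (cases "norm x \<le> 1")
    case True
    then have "norm x powr (p - 1) \<le> 1 powr (p - 1)" using p by (intro powr_mono2) auto
    then show ?thesis using D_ge_1[of "norm x"] by simp
  next
    case False
    then have "norm x powr (p - 1) \<le> norm x powr p" by (intro powr_mono) auto
    then show ?thesis by (simp add: D_def)
  qed
  then show ?thesis unfolding norm_Dm using p D_pos[of "norm x"] n by (simp add: divide_le_eq mult_left_mono)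
qed

lemma norm_Dm_power: "norm (Dm x) ^ CARD('n) = (real CARD('n) * p) ^ CARD('n) * norm x powr p / D (norm x) ^ CARD('n)"
proof -
  have "real CARD('n) * (p - 1) = p" using p by (simp add: algebra_simps)
  moreover have "(norm x powr (p - 1)) ^ CARD('n) = norm x powr (real CARD('n) * (p - 1))"
    by (cases "x = 0") (simp_all add: powr_power)
  ultimately show ?thesis unfolding norm_Dm by (simp add: power_mult_distrib power_divide)
qed

lemma energy_eq: 
  "(LINT x:ball (0 :: real ^ 'n) R|lborel. norm (Dm x) ^ CARD('n)) = vol1 * q ^ CARD('n) * Q R"
  "set_integrable lborel (ball (0 :: real ^ 'n) R) (\<lambda>x. norm (Dm x) ^ CARD('n))"
proof -
  have c: "continuous_on {0..R} (\<lambda>t. (real CARD('n) * p) ^ CARD('n) * t powr p / D t ^ CARD('n))"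
    using p by (intro continuous_on_divide continuous_on_mult continuous_on_const continuous_on_power
        continuous_on_powr' continuous_on_id continuous_on_subset[OF continuous_D]) auto
  show "set_integrable lborel (ball (0 :: real ^ 'n) R) (\<lambda>x. norm (Dm x) ^ CARD('n))"
    unfolding norm_Dm_power by (rule radial_integral(1)[OF R c])
  have "(LINT x:ball (0 :: real ^ 'n) R|lborel. norm (Dm x) ^ CARD('n))
    = real CARD('n) * vol1 * integral {0..R} (\<lambda>t. t ^ (CARD('n) - 1) * ((real CARD('n) * p) ^ CARD('n) * t powr p / D t ^ CARD('n)))"
    unfolding norm_Dm_power using radial_integral(2)[OF R c, where 'a="real ^ 'n"] by (simp add: vol1_def)
  also have "(\<lambda>t. t ^ (CARD('n) - 1) * ((real CARD('n) * p) ^ CARD('n) * t powr p / D t ^ CARD('n)))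
    = (\<lambda>t. (q ^ CARD('n) / real CARD('n)) * (real CARD('n) * t ^ (CARD('n) - 1) * t powr p * g t ^ CARD('n)))"
    by (auto simp: fun_eq_iff q_def g_def power_divide)
  also have "real CARD('n) * vol1 * integral {0..R} \<dots> = vol1 * q ^ CARD('n) * Q R"
    unfolding Q_def integral_mult_right by simp
  finally show "(LINT x:ball (0 :: real ^ 'n) R|lborel. norm (Dm x) ^ CARD('n)) = vol1 * q ^ CARD('n) * Q R" .
qed

text \<open>The divergence of this field is a multiple of \<open>mu\<close>, which is the Liouville equation for \<open>ln mu\<close>.\<close>

lemma Dm_flux: "norm (Dm x) ^ (CARD('n) - 2) *\<^sub>R Dm x = - ((real CARD('n) * p) ^ (CARD('n) - 1) / D (norm x) ^ (CARD('n) - 1)) *\<^sub>R x"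
proof (cases "x = 0")
  case True
  then show ?thesis by (simp add: Dm_def)
next
  case False
  \<comment> \<open>The exponents of norm x add up to 0, so every power of the norm cancels and only
    \<open>D\<close> remains as a radial factor.\<close>
  have "(p - 1) * (real CARD('n) - 2) + (p - 2) = 0" using p by (simp add: algebra_simps)
  moreover have "(norm x powr (p - 1)) ^ (CARD('n) - 2) = norm x powr (real (CARD('n) - 2) * (p - 1))"
    using False by (simp only: powr_power norm_eq_zero not_False_eq_True simp_thms)
  ultimately have "(norm x powr (p - 1)) ^ (CARD('n) - 2) * norm x powr (p - 2) = 1"
  proof -
    assume e: "(p - 1) * (real CARD('n) - 2) + (p - 2) = 0"
      "(norm x powr (p - 1)) ^ (CARD('n) - 2) = norm x powr (real (CARD('n) - 2) * (p - 1))"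
    have "real (CARD('n) - 2) * (p - 1) + (p - 2) = 0" using e(1) n by (simp add: of_nat_diff mult.commute)
    then show ?thesis unfolding e(2) using False by (simp only: powr_add[symmetric]) simp
  qed
  then have "norm (Dm x) ^ (CARD('n) - 2) * (real CARD('n) * p / D (norm x) * norm x powr (p - 2))
     = (real CARD('n) * p / D (norm x)) * (real CARD('n) * p / D (norm x)) ^ (CARD('n) - 2)"
    unfolding norm_Dm by (simp add: power_mult_distrib power_divide mult_ac)
  also have "\<dots> = (real CARD('n) * p) ^ (CARD('n) - 1) / D (norm x) ^ (CARD('n) - 1)"
    by (simp only: power_unfold(2)[symmetric] power_divide[symmetric])
  finally show ?thesis by (simp add: Dm_def)
qed

end


section \<open>The concave functional\<close>

text \<open>Weighted AM-GM for x / m and 1 with weights s and 1 - s, multiplied by m powr s.\<close>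

lemma powr_le_tangent:
  fixes x m s :: real
  assumes x: "0 \<le> x" and m: "0 < m" and s: "0 < s" "s < 1"
  shows "x powr s \<le> m powr s + s * m powr (s - 1) * (x - m)"
proof (cases "x = 0")
  case True
  have "m powr s = m powr (s - 1) * m" using m powr_add[of m "s - 1" 1] by simp
  then have "m powr s + s * m powr (s - 1) * (x - m) = (1 - s) * m powr s"
    using True by (simp add: algebra_simps)
  then show ?thesis using True s by simp
next
  case False
  then have x: "0 < x" using x by simp
  have ms: "m powr s = m powr (s - 1) * m" using m powr_add[of m "s - 1" 1] by simp
  have "(x / m) powr s * 1 powr (1 - s) \<le> s * (x / m) + (1 - s) * 1"
    using x m s by (intro Youngs_inequality_0) auto
  then have "m powr s * (x / m) powr s \<le> m powr s * (s * (x / m) + (1 - s))"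
    by (intro mult_left_mono) auto
  moreover have "m powr s * (x / m) powr s = x powr s" using x m by (simp add: powr_divide)
  moreover have "m powr s * (s * (x / m) + (1 - s)) = m powr s + s * m powr (s - 1) * (x - m)"
    unfolding ms using m by (simp add: field_simps)
  ultimately show ?thesis by simp
qed

context onofri_ball
begin

text \<open>This is what the normalisation of \<open>alpha\<close> achieves: the derivative of alpha
  times t powr ((n - 1) / n) at t = mu y is 1 + norm y powr p, and its second summand is the weight
  subtracted in \<open>J_functional\<close>.\<close>

lemma alpha_slope:
  "alpha TYPE('n) * ((real CARD('n) - 1) / real CARD('n) * mu (y :: real ^ 'n) powr ((real CARD('n) - 1) / real CARD('n) - 1)) = D (norm y)"
proof -
  have "(real CARD('n) - 1) / real CARD('n) - 1 = - (1 / real CARD('n))"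
    using n by (simp add: field_simps)
  then have "mu y powr ((real CARD('n) - 1) / real CARD('n) - 1) = (vol1 * D (norm y) ^ CARD('n)) powr (1 / real CARD('n))"
    unfolding mu_eq using vol1_pos D_pos[of "norm y"] by (simp add: powr_minus powr_divide inverse_eq_divide)
  also have "\<dots> = vol1 powr (1 / real CARD('n)) * D (norm y)"
    using vol1_pos D_pos[of "norm y"] by (simp add: powr_mult powr_realpow[symmetric] powr_powr)
  finally have "mu y powr ((real CARD('n) - 1) / real CARD('n) - 1) = vol1 powr (1 / real CARD('n)) * D (norm y)" .
  moreover have "alpha TYPE('n) = real CARD('n) / (real CARD('n) - 1) * (1 / vol1) powr (1 / real CARD('n))"
    unfolding alpha_def sphere_area_eq by simp
  ultimately show ?thesis using n vol1_pos by (simp add: powr_divide)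
qed

lemma alpha_pos: "0 < alpha TYPE('n)"
  using n vol1_pos by (simp add: alpha_def sphere_area_eq)

text \<open>In the tangent inequality at \<open>mu\<close>, the weight norm y powr p cancels against
  the linear part of the functional. What remains is the integral of \<rho> - mu over the ball,
  which is 0 by the mass constraint.\<close>

theorem J_functional_le:
  fixes \<rho> :: "real ^ 'n \<Rightarrow> real"
  assumes \<rho>: "\<rho> \<in> admissible_densities R"
  shows "J_functional R \<rho> \<le> J_functional R (mu :: real ^ 'n \<Rightarrow> real)"
proof -
  define s where "s = (real CARD('n) - 1) / real CARD('n)"
  let ?B = "ball (0 :: real ^ 'n) R"
  have s: "0 < s" "s < 1" using n by (auto simp: s_def)
  have main: "set_integrable lebesgue ?B (\<lambda>x. f x powr s) \<and> set_integrable lebesgue ?B f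
      \<and> set_integrable lebesgue ?B (\<lambda>x. norm x powr p * f x)
      \<and> (\<forall>x. 0 \<le> f x) \<and> (LINT y:?B|lebesgue. f y) = theta TYPE('n) R"
    if f: "f \<in> admissible_densities R" for f :: "real ^ 'n \<Rightarrow> real"
  proof -
    have f0: "0 \<le> f x" and [measurable]: "f \<in> borel_measurable lebesgue" and fi: "integrable lebesgue f"
      and ft: "(LINT y:?B|lebesgue. f y) = theta TYPE('n) R" for x
      using f by (auto simp: admissible_densities_def prob_densities_def)
    have Bs: "?B \<in> sets lebesgue" by simp
    have iB: "set_integrable lebesgue ?B f"
      unfolding set_integrable_def using integrable_mult_indicator[OF Bs fi] by simp
    have i1: "set_integrable lebesgue ?B (\<lambda>x. 1 + f x)"
      by (intro set_integral_add iB) (simp add: set_integrable_def lmeasurable_iff_integrable[symmetric])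
    have "set_integrable lebesgue ?B (\<lambda>x. f x powr s)"
    proof (rule set_integrable_bound[OF i1])
      show "set_borel_measurable lebesgue ?B (\<lambda>x. f x powr s)"
        unfolding set_borel_measurable_def using Bs by (intro borel_measurable_scaleR borel_measurable_indicator) auto
      have "f x powr s \<le> 1 + f x" for x
      proof -
        \<comment> \<open>The tangent at m = 1 gives the majorant 1 + f, which is integrable on the
          ball.\<close>
        have "f x powr s \<le> 1 powr s + s * 1 powr (s - 1) * (f x - 1)"
          using f0 s by (intro powr_le_tangent) auto
        also have "\<dots> = (1 - s) + s * f x" by (simp add: algebra_simps)
        also have "\<dots> \<le> 1 + 1 * f x" using s f0[of x] by (intro add_mono mult_right_mono) auto
        finally show ?thesis by simp
      qed
      then show "AE x in lebesgue. x \<in> ?B \<longrightarrow> norm (f x powr s) \<le> norm (1 + f x)"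
        using f0 by (intro AE_I2) auto
    qed
    moreover have "set_integrable lebesgue ?B (\<lambda>x. norm x powr p * f x)"
    proof (rule set_integrable_bound[where f="\<lambda>x. R powr p * f x"])
      show "set_integrable lebesgue ?B (\<lambda>x. R powr p * f x)" using iB by (rule set_integrable_mult_right)
      have "(\<lambda>x :: real ^ 'n. norm x powr p) \<in> borel_measurable borel" by measurable
      then have [measurable]: "(\<lambda>x :: real ^ 'n. norm x powr p) \<in> borel_measurable lebesgue"
        by (intro measurable_completion) simp
      show "set_borel_measurable lebesgue ?B (\<lambda>x. norm x powr p * f x)"
        unfolding set_borel_measurable_def using Bs by (intro borel_measurable_scaleR borel_measurable_indicator) auto
      have "norm x powr p * f x \<le> R powr p * f x" if "x \<in> ?B" for x
        using that f0[of x] p by (intro mult_right_mono powr_mono2) auto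
      then show "AE x in lebesgue. x \<in> ?B \<longrightarrow> norm (norm x powr p * f x) \<le> norm (R powr p * f x)"
        using f0 by (intro AE_I2) (auto simp: abs_mult)
    qed
    ultimately show ?thesis using iB f0 ft by blast
  qed
  note r = main[OF \<rho>] and m = main[OF mu_admissible]
  have "(LINT y:?B|lebesgue. alpha TYPE('n) * \<rho> y powr s - norm y powr p * \<rho> y)
     \<le> (LINT y:?B|lebesgue. alpha TYPE('n) * mu y powr s - norm y powr p * mu y + (\<rho> y - mu y))"
  proof (rule set_integral_mono)
    fix y :: "real ^ 'n"
    have "\<rho> y powr s \<le> mu y powr s + s * mu y powr (s - 1) * (\<rho> y - mu y)"
      using r s mu_pos by (intro powr_le_tangent) auto
    then have "alpha TYPE('n) * \<rho> y powr s \<le> alpha TYPE('n) * (mu y powr s + s * mu y powr (s - 1) * (\<rho> y - mu y))"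
      using alpha_pos by (intro mult_left_mono) auto
    also have "\<dots> = alpha TYPE('n) * mu y powr s + D (norm y) * (\<rho> y - mu y)"
      unfolding alpha_slope[symmetric, of y, folded s_def] by (simp add: algebra_simps)
    finally show "alpha TYPE('n) * \<rho> y powr s - norm y powr p * \<rho> y
        \<le> alpha TYPE('n) * mu y powr s - norm y powr p * mu y + (\<rho> y - mu y)"
      by (simp add: D_def algebra_simps)
  qed (intro set_integral_diff set_integral_add set_integrable_mult_right; use r m in simp)+
  also have "\<dots> = (LINT y:?B|lebesgue. alpha TYPE('n) * mu y powr s - norm y powr p * mu y)
     + ((LINT y:?B|lebesgue. \<rho> y) - (LINT y:?B|lebesgue. mu y))"
    using r m by (simp add: set_integral_add set_integral_diff)
  also have "\<dots> = (LINT y:?B|lebesgue. alpha TYPE('n) * mu y powr s - norm y powr p * mu y)"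
    using r m by simp
  finally show ?thesis
    unfolding J_functional_def p_def[symmetric] s_def[symmetric] using r m by (simp add: set_integral_diff)
qed

end


section \<open>Smooth bump functions\<close>

lemma GDERIV_grad:
  fixes f :: "real ^ 'n \<Rightarrow> real"
  assumes "f differentiable (at x)"
  shows "GDERIV f x :> grad f x"
proof -
  obtain f' where f': "(f has_derivative f') (at x)" using assms by (auto simp: differentiable_def)
  define D where "D = (\<chi> i. f' (axis i 1))"
  have lin: "linear f'" using f' by (rule has_derivative_linear)
  have "f' h = h \<bullet> D" for h
  proof -
    have "f' h = f' (\<Sum>i\<in>UNIV. (h $ i) *\<^sub>R axis i 1)"
      using basis_expansion[of h] by (simp add: scalar_mult_eq_scaleR)
    also have "\<dots> = (\<Sum>i\<in>UNIV. h $ i * f' (axis i 1))"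
      by (simp add: linear_sum[OF lin] linear_scale[OF lin])
    finally show ?thesis by (simp add: D_def inner_vec_def)
  qed
  then have "GDERIV f x :> D" using f' by (simp add: gderiv_def fun_eq_iff[symmetric] cong: if_cong) presburger
  then show ?thesis using grad_eqI by metis
qed

lemma GDERIV_imp_differentiable: "GDERIV f x :> D \<Longrightarrow> f differentiable (at x)"
  by (auto simp: gderiv_def differentiable_def)

lemma continuously_differentiable_imp_continuous:
  "continuously_differentiable k f \<Longrightarrow> continuous_on UNIV f"
  by (cases k) (auto intro: continuous_at_imp_continuous_on differentiable_imp_continuous_within)

lemma continuously_differentiable_Suc_D:
  "continuously_differentiable (Suc k) f \<Longrightarrow> continuously_differentiable k f"
proof (induction k arbitrary: f)
  case 0
  then show ?case using continuously_differentiable_imp_continuous by fastforce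
next
  case (Suc k)
  then show ?case by (metis continuously_differentiable.simps(2))
qed

lemma continuously_differentiable_SucI:
  assumes "\<And>x. GDERIV f x :> G x" "\<And>i. continuously_differentiable k (\<lambda>x. G x $ i)"
  shows "continuously_differentiable (Suc k) f"
proof -
  have "grad f x = G x" for x by (rule grad_eqI[OF assms(1)])
  then show ?thesis using assms GDERIV_imp_differentiable by fastforce
qed

lemma continuously_differentiable_const: "continuously_differentiable k (\<lambda>x. c)"
proof (induction k arbitrary: c)
  case (Suc k)
  show ?case by (rule continuously_differentiable_SucI[of _ "\<lambda>_. 0"]) (auto simp: GDERIV_const Suc)
qed simp

lemma continuously_differentiable_add:
  "continuously_differentiable k f \<Longrightarrow> continuously_differentiable k g \<Longrightarrow>
   continuously_differentiable k (\<lambda>x. f x + g x)"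
proof (induction k arbitrary: f g)
  case 0
  then show ?case by (auto intro: continuous_on_add)
next
  case (Suc k)
  show ?case
    by (rule continuously_differentiable_SucI[of _ "\<lambda>x. grad f x + grad g x"])
      (use Suc in \<open>auto intro!: GDERIV_add GDERIV_grad\<close>)
qed

lemma continuously_differentiable_mult:
  "continuously_differentiable k f \<Longrightarrow> continuously_differentiable k g \<Longrightarrow>
   continuously_differentiable k (\<lambda>x. f x * g x)"
proof (induction k arbitrary: f g)
  case 0
  then show ?case by (auto intro: continuous_on_mult)
next
  case (Suc k)
  note fg = continuously_differentiable_Suc_D[OF Suc.prems(1)] continuously_differentiable_Suc_D[OF Suc.prems(2)]
  show ?case
  proof (rule continuously_differentiable_SucI[of _ "\<lambda>x. f x *\<^sub>R grad g x + g x *\<^sub>R grad f x"])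
    show "GDERIV (\<lambda>x. f x * g x) x :> f x *\<^sub>R grad g x + g x *\<^sub>R grad f x" for x
      using Suc.prems by (intro GDERIV_mult GDERIV_grad) auto
    show "continuously_differentiable k (\<lambda>x. (f x *\<^sub>R grad g x + g x *\<^sub>R grad f x) $ i)" for i
      using Suc.prems fg by (auto intro!: continuously_differentiable_add Suc.IH)
  qed
qed

lemma continuously_differentiable_prod:
  "finite I \<Longrightarrow> (\<And>i. i \<in> I \<Longrightarrow> continuously_differentiable k (F i)) \<Longrightarrow>
   continuously_differentiable k (\<lambda>x. \<Prod>i\<in>I. F i x)"
  by (induction I rule: finite_induct)
    (auto intro: continuously_differentiable_const continuously_differentiable_mult)

text \<open>A family closed under differentiation consists of smooth functions, by induction on the
  order with the function left arbitrary; this avoids formulas for higher derivatives.\<close>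

lemma continuously_differentiable_coordinate:
  fixes S :: "(real \<Rightarrow> real) set" and i :: "'n::finite"
  assumes "h \<in> S" and S: "\<And>h. h \<in> S \<Longrightarrow> \<exists>h'\<in>S. \<forall>t. (h has_real_derivative h' t) (at t)"
  shows "continuously_differentiable k (\<lambda>x. h (x $ i))"
  using assms(1)
proof (induction k arbitrary: h)
  case 0
  then obtain h' where "\<forall>t. (h has_real_derivative h' t) (at t)" using S by blast
  then have "continuous_on UNIV h" by (auto intro!: continuous_at_imp_continuous_on DERIV_isCont)
  then show ?case by (auto intro!: continuous_on_compose2[of UNIV h] continuous_intros)
next
  case (Suc k)
  then obtain h' where h': "h' \<in> S" "\<And>t. (h has_real_derivative h' t) (at t)" using S by blast
  have G: "GDERIV (\<lambda>x. x $ i) x :> axis i 1" for x :: "real ^ 'n"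
    unfolding gderiv_def by (simp add: inner_axis bounded_linear_imp_has_derivative bounded_linear_vec_nth)
  show ?case
  proof (rule continuously_differentiable_SucI[of _ "\<lambda>x. h' (x $ i) *\<^sub>R axis i 1"])
    show "GDERIV (\<lambda>x. h (x $ i)) x :> h' (x $ i) *\<^sub>R axis i 1" for x :: "real ^ 'n"
      by (rule GDERIV_DERIV_compose[OF G h'(2)])
    show "continuously_differentiable k (\<lambda>x :: real ^ 'n. (h' (x $ i) *\<^sub>R axis i 1) $ j)" for j
      using Suc.IH[OF h'(1)] continuously_differentiable_const[of k 0] by (cases "j = i") (auto simp: axis_def)
  qed
qed

text \<open>The polynomial parameter makes the class of functions r(1/t) exp(-1/t), extended by 0,
  closed under differentiation.\<close>

definition flat :: "real poly \<Rightarrow> real \<Rightarrow> real" where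
  "flat r t = (if 0 < t then poly r (1 / t) * exp (- (1 / t)) else 0)"

lemma poly_div_exp_tendsto_0: "((\<lambda>x. poly r x / exp x) \<longlongrightarrow> (0::real)) at_top"
proof -
  have "((\<lambda>x. \<Sum>i\<le>degree r. coeff r i * (x ^ i / exp x)) \<longlongrightarrow> (\<Sum>i\<le>degree r. coeff r i * 0)) at_top"
    by (intro tendsto_intros tendsto_power_div_exp_0)
  then show ?thesis by (simp add: poly_altdef sum_divide_distrib)
qed

text \<open>Differentiation turns r(1/t) exp(-1/t) into (r - r')(1/t) exp(-1/t) divided by t
  squared; the division is multiplication of the polynomial by the square of its variable.\<close>

lemma DERIV_flat: "(flat r has_real_derivative flat ([:0, 0, 1:] * (r - pderiv r)) t) (at t)"
proof -
  consider "t < 0" | "t = 0" | "0 < t" by linarith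
  then show ?thesis
  proof cases
    case 1
    have "((\<lambda>t. 0) has_real_derivative 0) (at t)" by simp
    moreover have "\<forall>\<^sub>F x in nhds t. 0 = flat r x"
      using eventually_nhds_in_open[of "{..<0}" t] 1 by (auto simp: flat_def elim!: eventually_mono)
    ultimately show ?thesis using 1 by (simp add: flat_def DERIV_cong_ev)
  next
    case 2
    have "((\<lambda>h. flat r h / h) \<longlongrightarrow> 0) (at 0)"
    proof (rule filterlim_split_at)
      show "((\<lambda>h. flat r h / h) \<longlongrightarrow> 0) (at_left 0)"
        by (rule tendsto_eventually) (auto simp: flat_def eventually_at_filter)
      \<comment> \<open>Division by h raises the polynomial in 1 / h by one degree, which is
        \<open>pCons 0 r\<close>, and exp still dominates it.\<close>
      have "((\<lambda>h. poly (pCons 0 r) (inverse h) / exp (inverse h)) \<longlongrightarrow> 0) (at_right 0)"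
        by (rule filterlim_compose[OF poly_div_exp_tendsto_0 filterlim_inverse_at_top_right])
      moreover have "\<forall>\<^sub>F h in at_right 0. poly (pCons 0 r) (inverse h) / exp (inverse h) = flat r h / h"
        by (auto simp: eventually_at_filter flat_def exp_minus field_simps)
      ultimately show "((\<lambda>h. flat r h / h) \<longlongrightarrow> 0) (at_right 0)"
        by (rule Lim_transform_eventually)
    qed
    then show ?thesis using 2 by (simp add: DERIV_def flat_def)
  next
    case 3
    have "((\<lambda>t. poly r (1 / t) * exp (- (1 / t))) has_real_derivative
       poly (pderiv r) (1 / t) * (- (1 / t\<^sup>2)) * exp (- (1 / t)) + exp (- (1 / t)) * (1 / t\<^sup>2) * poly r (1 / t)) (at t)"
    proof -
      have i: "((\<lambda>t. 1 / t) has_real_derivative - (1 / t\<^sup>2)) (at t)"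
        using 3 by (auto intro!: derivative_eq_intros simp: power2_eq_square)
      have "((\<lambda>t. poly r (1 / t)) has_real_derivative poly (pderiv r) (1 / t) * (- (1 / t\<^sup>2))) (at t)"
        by (rule DERIV_chain2[OF poly_DERIV i])
      moreover have "((\<lambda>t. exp (- (1 / t))) has_real_derivative exp (- (1 / t)) * (1 / t\<^sup>2)) (at t)"
        using DERIV_chain2[OF DERIV_exp DERIV_minus[OF i]] by simp
      ultimately show ?thesis by (rule DERIV_mult)
    qed
    moreover have "\<forall>\<^sub>F x in nhds t. poly r (1 / x) * exp (- (1 / x)) = flat r x"
      using eventually_nhds_in_open[of "{0<..}" t] 3 by (auto simp: flat_def elim!: eventually_mono)
    moreover have "poly (pderiv r) (1 / t) * (- (1 / t\<^sup>2)) * exp (- (1 / t)) + exp (- (1 / t)) * (1 / t\<^sup>2) * poly r (1 / t)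
       = flat ([:0, 0, 1:] * (r - pderiv r)) t"
      using 3 by (simp add: flat_def power2_eq_square field_simps)
    ultimately show ?thesis by (metis DERIV_cong_ev)
  qed
qed

lemma continuously_differentiable_flat:
  "continuously_differentiable k (\<lambda>x. c * flat r (a * (x $ i) + b))"
proof -
  let ?S = "{\<lambda>t. c * flat r (a * t + b) | c r. True}"
  have "continuously_differentiable k (\<lambda>x. (\<lambda>t. c * flat r (a * t + b)) (x $ i))"
  proof (rule continuously_differentiable_coordinate[where S="?S"])
    fix h assume "h \<in> ?S"
    then obtain c r where h: "h = (\<lambda>t. c * flat r (a * t + b))" by blast
    let ?h = "\<lambda>t. (c * a) * flat ([:0, 0, 1:] * (r - pderiv r)) (a * t + b)"
    have "(h has_real_derivative ?h t) (at t)" for t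
    proof -
      have "((\<lambda>t. a * t + b) has_real_derivative a) (at t)" by (auto intro!: derivative_eq_intros)
      from DERIV_cmult[OF DERIV_chain2[OF DERIV_flat this], of c] show ?thesis
        unfolding h by (simp add: mult_ac)
    qed
    moreover have "?h \<in> ?S" by blast
    ultimately show "\<exists>h'\<in>?S. \<forall>t. (h has_real_derivative h' t) (at t)" by (intro bexI[of _ ?h]) auto
  qed blast
  then show ?thesis by simp
qed

text \<open>The factor \<open>Suc k\<close> steepens the flanks: the functions vanish off the open
  box, lie between 0 and 1, and converge pointwise to 1 inside.\<close>

definition bump :: "real ^ 'n \<Rightarrow> real ^ 'n \<Rightarrow> nat \<Rightarrow> real ^ 'n \<Rightarrow> real" where
  "bump a b k x = (\<Prod>i\<in>UNIV. flat 1 (real (Suc k) * (x $ i - a $ i)) * flat 1 (real (Suc k) * (b $ i - x $ i)))"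

lemma flat_1: "0 \<le> flat 1 t" "flat 1 t \<le> 1" "t \<le> 0 \<Longrightarrow> flat 1 t = 0"
  by (auto simp: flat_def)

lemma bump_bounds: "0 \<le> bump a b k x" "bump a b k x \<le> 1"
  unfolding bump_def by (auto intro!: prod_nonneg prod_le_1 mult_nonneg_nonneg mult_le_one simp: flat_1)

lemma bump_outside: "x \<notin> box a b \<Longrightarrow> bump a b k x = 0"
proof -
  assume "x \<notin> box a b"
  then obtain i where "x $ i \<le> a $ i \<or> b $ i \<le> x $ i" by (auto simp: mem_box_cart not_less)
  then have "flat 1 (real (Suc k) * (x $ i - a $ i)) * flat 1 (real (Suc k) * (b $ i - x $ i)) = 0"
    using flat_1(3) by (auto simp: mult_nonneg_nonpos)
  then show ?thesis unfolding bump_def by (intro prod_zero) auto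
qed

lemma bump_test:
  assumes "cbox a b \<subseteq> \<Omega>"
  shows "bump a b k \<in> test_functions \<Omega>"
proof -
  have "continuously_differentiable m (bump a b k)" for m
  proof -
    have "continuously_differentiable m (\<lambda>x. flat 1 (real (Suc k) * (x $ i - a $ i)))"
      "continuously_differentiable m (\<lambda>x. flat 1 (real (Suc k) * (b $ i - x $ i)))" for i
      using continuously_differentiable_flat[of m 1 1 "real (Suc k)" i "- real (Suc k) * a $ i"]
        continuously_differentiable_flat[of m 1 1 "- real (Suc k)" i "real (Suc k) * b $ i"]
      by (simp_all add: algebra_simps)
    then show ?thesis unfolding bump_def[abs_def]
      by (intro continuously_differentiable_prod continuously_differentiable_mult) auto
  qed
  moreover have "closure {x. bump a b k x \<noteq> 0} \<subseteq> cbox a b"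
    using bump_outside box_subset_cbox by (intro closure_minimal closed_cbox) blast
  moreover from this have "compact (closure {x. bump a b k x \<noteq> 0})"
    by (meson bounded_cbox bounded_subset closed_closure compact_eq_bounded_closed)
  ultimately show ?thesis using assms by (auto simp: test_functions_def)
qed

lemma bump_tendsto:
  assumes x: "x \<in> box a b"
  shows "(\<lambda>k. bump a b k x) \<longlonglongrightarrow> 1"
proof -
  have l: "(\<lambda>k. flat 1 (real (Suc k) * t)) \<longlonglongrightarrow> 1" if t: "0 < t" for t
  proof -
    have "(\<lambda>k. exp (- ((1 / t) * (1 / real (Suc k))))) \<longlonglongrightarrow> exp (- ((1 / t) * 0))"
      by (intro tendsto_intros LIMSEQ_Suc[OF lim_1_over_n])
    moreover have "flat 1 (real (Suc k) * t) = exp (- ((1 / t) * (1 / real (Suc k))))" for k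
      using t by (simp add: flat_def mult.commute)
    ultimately show ?thesis by simp
  qed
  have "(\<lambda>k. bump a b k x) \<longlonglongrightarrow> (\<Prod>i\<in>(UNIV :: 'a set). 1 * 1)"
    unfolding bump_def using x by (intro tendsto_prod tendsto_mult l) (auto simp: mem_box_cart)
  then show ?thesis by simp
qed


section \<open>Weak gradients\<close>

lemma GDERIV_eq_0_off_support:
  fixes f :: "real ^ 'n \<Rightarrow> real"
  assumes "closed K" "\<And>x. x \<notin> K \<Longrightarrow> f x = 0" "GDERIV f x :> D" "x \<notin> K"
  shows "D = 0"
proof -
  have "GDERIV f x :> 0"
    unfolding gderiv_def
    by (rule has_derivative_transform_within_open[of "\<lambda>_. 0" _ _ _ "- K"]) (use assms in auto)
  then show ?thesis using assms(3) grad_eqI by metis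
qed

lemma bounded_if_compact_support:
  fixes f :: "'a::euclidean_space \<Rightarrow> 'b::real_normed_vector"
  assumes K: "compact K" and f: "continuous_on UNIV f" "\<And>x. x \<notin> K \<Longrightarrow> f x = 0"
  obtains C where "0 \<le> C" "\<And>x. norm (f x) \<le> C"
proof -
  have "compact (f ` K)" using K f by (intro compact_continuous_image) (auto intro: continuous_on_subset)
  then obtain C where C: "\<And>x. x \<in> K \<Longrightarrow> norm (f x) \<le> C"
    using compact_imp_bounded by (force simp: bounded_iff)
  have "norm (f x) \<le> max C 0" for x using C[of x] f(2)[of x] by (cases "x \<in> K") auto
  then show ?thesis using that[of "max C 0"] by simp
qed

lemma integrable_if_compact_support:
  fixes f :: "'a::euclidean_space \<Rightarrow> 'b::{banach, second_countable_topology}"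
  assumes K: "compact K" and f: "continuous_on UNIV f" "\<And>x. x \<notin> K \<Longrightarrow> f x = 0"
  shows "integrable lborel f"
proof -
  have "integrable lborel (\<lambda>x. indicator K x *\<^sub>R f x)"
    using K f by (intro borel_integrable_compact) (auto intro: continuous_on_subset)
  moreover have "indicator K x *\<^sub>R f x = f x" for x using f(2)[of x] by (auto simp: indicator_def)
  ultimately show ?thesis by simp
qed

lemma test_functionD:
  assumes "\<phi> \<in> test_functions \<Omega>"
  shows "GDERIV \<phi> x :> grad \<phi> x" "continuous_on UNIV \<phi>" "continuous_on UNIV (grad \<phi>)"
proof -
  have cd: "continuously_differentiable k \<phi>" for k using assms by (auto simp: test_functions_def)
  show "GDERIV \<phi> x :> grad \<phi> x" using cd[of 1] by (auto intro: GDERIV_grad)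
  show "continuous_on UNIV \<phi>" using cd by (rule continuously_differentiable_imp_continuous)
  have "continuous_on UNIV (\<lambda>x. \<chi> i. grad \<phi> x $ i)"
    using cd[of 1] by (intro continuous_on_vec_lambda) auto
  then show "continuous_on UNIV (grad \<phi>)" by simp
qed

lemma test_function_support:
  assumes "\<phi> \<in> test_functions \<Omega>"
  obtains K where "compact K" "K \<subseteq> \<Omega>" "\<And>x. x \<notin> K \<Longrightarrow> \<phi> x = 0" "\<And>x. x \<notin> K \<Longrightarrow> grad \<phi> x = 0"
proof (rule that[of "closure {x. \<phi> x \<noteq> 0}"])
  show *: "\<phi> x = 0" if "x \<notin> closure {x. \<phi> x \<noteq> 0}" for x
    using that closure_subset[of "{x. \<phi> x \<noteq> 0}"] by auto
  show "grad \<phi> x = 0" if "x \<notin> closure {x. \<phi> x \<noteq> 0}" for x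
    by (rule GDERIV_eq_0_off_support[OF closed_closure * test_functionD(1)[OF assms] that])
qed (use assms in \<open>auto simp: test_functions_def\<close>)

lemma zero_test_function: "(\<lambda>_. 0) \<in> test_functions \<Omega>"
  by (simp add: test_functions_def continuously_differentiable_const)

section \<open>Integration by parts\<close>

lemma lborel_integral_translate:
  fixes f :: "'a::euclidean_space \<Rightarrow> 'b::{banach, second_countable_topology}"
  assumes "integrable lborel f"
  shows "integrable lborel (\<lambda>x. f (c + x))" "(\<integral>x. f (c + x) \<partial>lborel) = (\<integral>x. f x \<partial>lborel)"
proof -
  have [measurable]: "f \<in> borel_measurable borel" using assms by auto
  show "integrable lborel (\<lambda>x. f (c + x))"
    using integrable_distr_eq[of "(+) c" lborel borel f] assms by (simp add: lborel_distr_plus)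
  show "(\<integral>x. f (c + x) \<partial>lborel) = (\<integral>x. f x \<partial>lborel)"
    using integral_distr[of "(+) c" lborel borel f] by (simp add: lborel_distr_plus)
qed

text \<open>A partial derivative is the limit of difference quotients, whose integrals vanish by
  translation invariance. The Lipschitz constant and a slightly enlarged support dominate
  them.\<close>

lemma integral_GDERIV_eq_0:
  fixes f :: "real ^ 'n \<Rightarrow> real"
  assumes f: "\<And>x. GDERIV f x :> G x" and G: "continuous_on UNIV G"
    and K: "compact K" "\<And>x. x \<notin> K \<Longrightarrow> f x = 0"
  shows "(\<integral>x. G x $ i \<partial>lborel) = 0"
proof -
  let ?e = "axis i 1 :: real ^ 'n"
  have fcont: "continuous_on UNIV f"
    using f by (auto intro!: continuous_at_imp_continuous_on has_derivative_continuous simp: gderiv_def)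
  have G0: "G x = 0" if "x \<notin> K" for x
    using GDERIV_eq_0_off_support[OF compact_imp_closed[OF K(1)] K(2) f that] by blast
  obtain L where L: "0 \<le> L" "\<And>x. norm (G x) \<le> L"
    using bounded_if_compact_support[OF K(1) G G0] by blast
  obtain r where r: "\<And>x. x \<in> K \<Longrightarrow> norm x \<le> r"
    using K(1) compact_imp_bounded by (force simp: bounded_iff)
  have lip: "\<bar>f y - f x\<bar> \<le> L * norm (y - x)" for x y
  proof -
    have "onorm (\<lambda>h. h \<bullet> G z) \<le> L" for z
    proof (rule onorm_bound[OF L(1)])
      fix h
      have "\<bar>h \<bullet> G z\<bar> \<le> norm h * norm (G z)" by (rule Cauchy_Schwarz_ineq2)
      also have "\<dots> \<le> norm h * L" using L by (intro mult_left_mono) auto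
      finally show "norm (h \<bullet> G z) \<le> L * norm h" by (simp add: mult.commute)
    qed
    then have "norm (f y - f x) \<le> L * norm (y - x)"
      using f by (intro differentiable_bound[of UNIV f "\<lambda>x h. h \<bullet> G x"]) (auto simp: gderiv_def)
    then show ?thesis by simp
  qed
  have int_f: "integrable lborel f" by (rule integrable_if_compact_support[OF K(1) fcont K(2)])
  define e where "e k = 1 / real (Suc k)" for k
  have e: "0 < e k" "e k \<le> 1" for k by (auto simp: e_def)
  define d where "d k x = (f (e k *\<^sub>R ?e + x) - f x) / e k" for k x
  have fm [measurable]: "f \<in> borel_measurable borel" using fcont by (rule borel_measurable_continuous_onI)
  have Gm [measurable]: "G \<in> borel_measurable borel" using G by (rule borel_measurable_continuous_onI)
  have "(\<lambda>k. \<integral>x. d k x \<partial>lborel) \<longlonglongrightarrow> (\<integral>x. G x $ i \<partial>lborel)"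
  proof (rule integral_dominated_convergence[where w="\<lambda>x. L * indicator (cball 0 (r + 1)) x"])
    show "(\<lambda>x. G x $ i) \<in> borel_measurable lborel"
      using borel_measurable_continuous_onI[OF continuous_on_component[OF G, of i]] by simp
    show "d k \<in> borel_measurable lborel" for k unfolding d_def by measurable
    show "integrable lborel (\<lambda>x :: real ^ 'n. L * indicator (cball 0 (r + 1)) x)"
      using emeasure_bounded_finite[OF bounded_cball[of "0 :: real ^ 'n" "r + 1"]] by (intro integrable_mult_right) simp
    show "AE x in lborel. (\<lambda>k. d k x) \<longlonglongrightarrow> G x $ i"
    proof (rule AE_I2)
      fix x
      have 1: "((\<lambda>t. t *\<^sub>R ?e + x) has_derivative (\<lambda>t. t *\<^sub>R ?e)) (at 0)"
        by (auto intro!: derivative_eq_intros)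
      have 2: "(f has_derivative (\<lambda>h. h \<bullet> G x)) (at (0 *\<^sub>R ?e + x))" using f by (simp add: gderiv_def)
      have "((\<lambda>t. f (t *\<^sub>R ?e + x)) has_derivative (\<lambda>t. (t *\<^sub>R ?e) \<bullet> G x)) (at 0)"
        by (rule has_derivative_compose[OF 1 2])
      moreover have "(\<lambda>t. (t *\<^sub>R ?e) \<bullet> G x) = (*) (G x $ i)" by (auto simp: fun_eq_iff inner_axis')
      ultimately have "((\<lambda>t. f (t *\<^sub>R ?e + x)) has_real_derivative G x $ i) (at 0)"
        by (simp only: has_field_derivative_def)
      then have "((\<lambda>h. (f (h *\<^sub>R ?e + x) - f x) / h) \<longlongrightarrow> G x $ i) (at 0)"
        by (simp add: DERIV_def)
      moreover have "filterlim e (at 0) sequentially"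
        unfolding e_def filterlim_at using LIMSEQ_Suc[OF lim_1_over_n[where 'a=real]] by simp
      ultimately show "(\<lambda>k. d k x) \<longlonglongrightarrow> G x $ i"
        unfolding d_def by (rule filterlim_compose)
    qed
    show "AE x in lborel. norm (d k x) \<le> L * indicator (cball 0 (r + 1)) x" for k
    proof (rule AE_I2)
      fix x
      have "norm x \<le> r + 1" if "d k x \<noteq> 0"
      proof -
        have "x \<in> K \<or> e k *\<^sub>R ?e + x \<in> K" using that K(2)[of x] K(2)[of "e k *\<^sub>R ?e + x"] by (cases "x \<in> K") (auto simp: d_def)
        then show ?thesis
        proof
          assume "e k *\<^sub>R ?e + x \<in> K"
          then have "norm (e k *\<^sub>R ?e + x) \<le> r" by (rule r)
          moreover have "norm x \<le> norm (e k *\<^sub>R ?e + x) + norm (e k *\<^sub>R ?e)"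
            using norm_triangle_ineq4[of "e k *\<^sub>R ?e + x" "e k *\<^sub>R ?e"] by simp
          moreover have "norm (e k *\<^sub>R ?e) \<le> 1" using e[of k] by simp
          ultimately show ?thesis by linarith
        qed (use r in force)
      qed
      moreover have "\<bar>d k x\<bar> \<le> L"
        using lip[of "e k *\<^sub>R ?e + x" x] e[of k] by (simp add: d_def abs_div field_simps)
      ultimately show "norm (d k x) \<le> L * indicator (cball 0 (r + 1)) x"
        by (cases "d k x = 0") (auto simp: indicator_def L)
    qed
  qed
  moreover have "(\<integral>x. d k x \<partial>lborel) = 0" for k
    unfolding d_def using int_f lborel_integral_translate[OF int_f, of "e k *\<^sub>R ?e"]
    by (simp add: Bochner_Integration.integral_diff)
  ultimately show ?thesis by (simp add: LIMSEQ_const_iff)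
qed

lemma integral_by_parts_test:
  fixes \<phi> h :: "real ^ 'n \<Rightarrow> real"
  assumes \<phi>: "\<phi> \<in> test_functions \<Omega>"
    and h: "\<And>x. GDERIV h x :> G x" and G: "continuous_on UNIV G"
  shows "(\<integral>x. h x * grad \<phi> x $ i \<partial>lborel) = - (\<integral>x. \<phi> x * G x $ i \<partial>lborel)"
proof -
  obtain K where K: "compact K" "\<And>x. x \<notin> K \<Longrightarrow> \<phi> x = 0" "\<And>x. x \<notin> K \<Longrightarrow> grad \<phi> x = 0"
    using test_function_support[OF \<phi>] by metis
  note t = test_functionD[OF \<phi>]
  have hc: "continuous_on UNIV h"
    using h by (auto intro!: continuous_at_imp_continuous_on has_derivative_continuous simp: gderiv_def)
  have c: "continuous_on UNIV (\<lambda>x. h x * grad \<phi> x $ i)" "continuous_on UNIV (\<lambda>x. \<phi> x * G x $ i)"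
    by (intro continuous_intros hc t G)+
  have int: "integrable lborel (\<lambda>x. h x * grad \<phi> x $ i)" "integrable lborel (\<lambda>x. \<phi> x * G x $ i)"
    by (rule integrable_if_compact_support[OF K(1) c(1)]; simp add: K)
      (rule integrable_if_compact_support[OF K(1) c(2)]; simp add: K)
  have "(\<integral>x. (h x *\<^sub>R grad \<phi> x + \<phi> x *\<^sub>R G x) $ i \<partial>lborel) = 0"
    by (rule integral_GDERIV_eq_0[OF GDERIV_mult[OF h t(1)] _ K(1)])
      (auto intro!: continuous_intros hc t G simp: K)
  then show ?thesis using int by simp
qed

lemma integral_vec_nth:
  fixes f :: "'a \<Rightarrow> real ^ 'n"
  assumes "integrable M f"
  shows "(\<integral>x. f x \<partial>M) $ i = (\<integral>x. f x $ i \<partial>M)"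
  by (rule integral_bounded_linear[OF bounded_linear_vec_nth assms, symmetric])

lemma has_weak_grad_C1:
  fixes h :: "real ^ 'n \<Rightarrow> real"
  assumes h: "\<And>x. GDERIV h x :> G x" and G: "continuous_on UNIV G"
  shows "has_weak_grad \<Omega> h G"
proof -
  have hc: "continuous_on UNIV h"
    using h by (auto intro!: continuous_at_imp_continuous_on has_derivative_continuous simp: gderiv_def)
  have hm: "h \<in> borel_measurable borel" and Gm: "G \<in> borel_measurable borel"
    using hc G by (auto intro: borel_measurable_continuous_onI)
  have "set_integrable lebesgue K h \<and> set_integrable lebesgue K G" if K: "compact K" for K
  proof -
    have Kb: "K \<in> sets borel" using K by (simp add: borel_compact)
    have "set_integrable lborel K h" "set_integrable lborel K G"
      unfolding set_integrable_def using K
      by (intro borel_integrable_compact continuous_on_subset[OF hc] continuous_on_subset[OF G]; simp)+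
    then show ?thesis using hm Gm Kb by (simp add: set_lebesgue_integral_completion)
  qed
  moreover have "(LINT x:\<Omega>|lebesgue. h x *\<^sub>R grad \<phi> x) = - (LINT x:\<Omega>|lebesgue. \<phi> x *\<^sub>R G x)"
    if \<phi>: "\<phi> \<in> test_functions \<Omega>" for \<phi>
  proof -
    obtain K where K: "compact K" "K \<subseteq> \<Omega>" "\<And>x. x \<notin> K \<Longrightarrow> \<phi> x = 0" "\<And>x. x \<notin> K \<Longrightarrow> grad \<phi> x = 0"
      using test_function_support[OF \<phi>] by metis
    note t = test_functionD[OF \<phi>]
    have e: "(LINT x:\<Omega>|lebesgue. w x) = (\<integral>x. w x \<partial>lborel)"
      if w: "continuous_on UNIV w" "\<And>x. x \<notin> K \<Longrightarrow> w x = 0" for w :: "real ^ 'n \<Rightarrow> real ^ 'n"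
    proof -
      have "indicator \<Omega> x *\<^sub>R w x = w x" for x using w(2)[of x] K(2) by (auto simp: indicator_def)
      then have "(LINT x:\<Omega>|lebesgue. w x) = (\<integral>x. w x \<partial>lebesgue)" by (simp add: set_lebesgue_integral_def)
      also have "\<dots> = (\<integral>x. w x \<partial>lborel)"
        using borel_measurable_continuous_onI[OF w(1)] by (intro integral_completion) simp
      finally show ?thesis .
    qed
    have c: "continuous_on UNIV (\<lambda>x. h x *\<^sub>R grad \<phi> x)" "continuous_on UNIV (\<lambda>x. \<phi> x *\<^sub>R G x)"
      by (intro continuous_intros hc t G)+
    have z: "\<And>x. x \<notin> K \<Longrightarrow> h x *\<^sub>R grad \<phi> x = 0" "\<And>x. x \<notin> K \<Longrightarrow> \<phi> x *\<^sub>R G x = 0"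
      by (auto simp: K)
    have int: "integrable lborel (\<lambda>x. h x *\<^sub>R grad \<phi> x)" "integrable lborel (\<lambda>x. \<phi> x *\<^sub>R G x)"
      by (rule integrable_if_compact_support[OF K(1) c(1) z(1)], assumption)
        (rule integrable_if_compact_support[OF K(1) c(2) z(2)], assumption)
    have "(\<integral>x. h x *\<^sub>R grad \<phi> x \<partial>lborel) = - (\<integral>x. \<phi> x *\<^sub>R G x \<partial>lborel)"
      using integral_by_parts_test[OF \<phi> h G]
      by (simp add: vec_eq_iff integral_vec_nth[OF int(1)] integral_vec_nth[OF int(2)])
    then show ?thesis using e[OF c(1) z(1)] e[OF c(2) z(2)] by simp
  qed
  ultimately show ?thesis by (auto simp: has_weak_grad_def)
qed

lemma has_weak_grad_test:
  assumes "\<phi> \<in> test_functions \<Omega>'"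
  shows "has_weak_grad \<Omega> \<phi> (grad \<phi>)"
  using has_weak_grad_C1[OF test_functionD(1)[OF assms] test_functionD(3)[OF assms]] .

text \<open>The two versions correspond to the two sides of the defining identity of a weak
  gradient: a function times the gradient of a test function, and a test function times a vector
  field.\<close>

lemma set_integrable_scaleR_compact_support:
  fixes u :: "'a::euclidean_space \<Rightarrow> real" and w :: "'a \<Rightarrow> 'b::{banach, second_countable_topology}"
  assumes K: "compact K" "K \<subseteq> \<Omega>"
  shows "set_integrable lebesgue K u \<Longrightarrow> continuous_on UNIV w \<Longrightarrow> (\<And>x. x \<notin> K \<Longrightarrow> w x = 0) \<Longrightarrow>
      set_integrable lebesgue \<Omega> (\<lambda>x. u x *\<^sub>R w x)" (is "PROP ?A")
    and "set_integrable lebesgue K w \<Longrightarrow> continuous_on UNIV u \<Longrightarrow> (\<And>x. x \<notin> K \<Longrightarrow> u x = 0) \<Longrightarrow>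
      set_integrable lebesgue \<Omega> (\<lambda>x. u x *\<^sub>R w x)" (is "PROP ?B")
proof -
  show "PROP ?A"
  proof -
    assume u: "set_integrable lebesgue K u" and w: "continuous_on UNIV w" "\<And>x. x \<notin> K \<Longrightarrow> w x = 0"
    obtain C where C: "0 \<le> C" "\<And>x. norm (w x) \<le> C" using bounded_if_compact_support[OF K(1) w] by blast
    have wm: "w \<in> borel_measurable lebesgue"
      using borel_measurable_continuous_onI[OF w(1)] by (intro measurable_completion) simp
    have eq: "indicator \<Omega> x *\<^sub>R u x *\<^sub>R w x = (indicator K x *\<^sub>R u x) *\<^sub>R w x" for x
      using w(2)[of x] K(2) by (auto simp: indicator_def)
    have ui: "integrable lebesgue (\<lambda>x. indicator K x *\<^sub>R u x)" using u by (simp add: set_integrable_def)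
    show ?thesis
      unfolding set_integrable_def eq
    proof (rule Bochner_Integration.integrable_bound[OF integrable_mult_right[OF ui, of C]])
      show "(\<lambda>x. (indicator K x *\<^sub>R u x) *\<^sub>R w x) \<in> borel_measurable lebesgue"
        using borel_measurable_integrable[OF ui] wm by (rule borel_measurable_scaleR)
      show "AE x in lebesgue. norm ((indicator K x *\<^sub>R u x) *\<^sub>R w x) \<le> norm (C * (indicator K x *\<^sub>R u x))"
      proof (rule AE_I2)
        fix x
        have "norm ((indicator K x *\<^sub>R u x) *\<^sub>R w x) = \<bar>indicator K x *\<^sub>R u x\<bar> * norm (w x)" by simp
        also have "\<dots> \<le> \<bar>indicator K x *\<^sub>R u x\<bar> * C" using C by (intro mult_left_mono) auto
        finally show "norm ((indicator K x *\<^sub>R u x) *\<^sub>R w x) \<le> norm (C * (indicator K x *\<^sub>R u x))"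
          using C(1) by (simp add: abs_mult mult_ac)
      qed
    qed
  qed
  show "PROP ?B"
  proof -
    assume w: "set_integrable lebesgue K w" and u: "continuous_on UNIV u" "\<And>x. x \<notin> K \<Longrightarrow> u x = 0"
    obtain C where C: "0 \<le> C" "\<And>x. norm (u x) \<le> C" using bounded_if_compact_support[OF K(1) u] by blast
    have um: "u \<in> borel_measurable lebesgue"
      using borel_measurable_continuous_onI[OF u(1)] by (intro measurable_completion) simp
    have eq: "indicator \<Omega> x *\<^sub>R u x *\<^sub>R w x = u x *\<^sub>R (indicator K x *\<^sub>R w x)" for x
      using u(2)[of x] K(2) by (auto simp: indicator_def)
    have wi: "integrable lebesgue (\<lambda>x. indicator K x *\<^sub>R w x)" using w by (simp add: set_integrable_def)
    show ?thesis
      unfolding set_integrable_def eq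
    proof (rule Bochner_Integration.integrable_bound[OF integrable_scaleR_right[OF wi, of C]])
      show "(\<lambda>x. u x *\<^sub>R (indicator K x *\<^sub>R w x)) \<in> borel_measurable lebesgue"
        using um borel_measurable_integrable[OF wi] by (rule borel_measurable_scaleR)
      show "AE x in lebesgue. norm (u x *\<^sub>R (indicator K x *\<^sub>R w x)) \<le> norm (C *\<^sub>R (indicator K x *\<^sub>R w x))"
      proof (rule AE_I2)
        fix x
        have "norm (u x *\<^sub>R (indicator K x *\<^sub>R w x)) = norm (u x) * norm (indicator K x *\<^sub>R w x)" by (rule norm_scaleR[of "u x", unfolded real_norm_def[symmetric]])
        also have "\<dots> \<le> C * norm (indicator K x *\<^sub>R w x)" using C by (intro mult_right_mono) auto
        finally show "norm (u x *\<^sub>R (indicator K x *\<^sub>R w x)) \<le> norm (C *\<^sub>R (indicator K x *\<^sub>R w x))"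
          using C(1) by simp
      qed
    qed
  qed
qed

lemma has_weak_grad_diff:
  assumes 1: "has_weak_grad \<Omega> u v" and 2: "has_weak_grad \<Omega> u' v'"
  shows "has_weak_grad \<Omega> (\<lambda>x. u x - u' x) (\<lambda>x. v x - v' x)"
proof -
  have "(LINT x:\<Omega>|lebesgue. (u x - u' x) *\<^sub>R grad \<phi> x) = - (LINT x:\<Omega>|lebesgue. \<phi> x *\<^sub>R (v x - v' x))"
    if \<phi>: "\<phi> \<in> test_functions \<Omega>" for \<phi>
  proof -
    obtain K where K: "compact K" "K \<subseteq> \<Omega>" "\<And>x. x \<notin> K \<Longrightarrow> \<phi> x = 0" "\<And>x. x \<notin> K \<Longrightarrow> grad \<phi> x = 0"
      using test_function_support[OF \<phi>] by metis
    note t = test_functionD[OF \<phi>]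
    have iK: "set_integrable lebesgue K u" "set_integrable lebesgue K v"
      "set_integrable lebesgue K u'" "set_integrable lebesgue K v'"
      using 1 2 K(1,2) by (auto simp: has_weak_grad_def)
    note s = set_integrable_scaleR_compact_support[OF K(1,2)]
    have i: "set_integrable lebesgue \<Omega> (\<lambda>x. u x *\<^sub>R grad \<phi> x)" "set_integrable lebesgue \<Omega> (\<lambda>x. u' x *\<^sub>R grad \<phi> x)"
      "set_integrable lebesgue \<Omega> (\<lambda>x. \<phi> x *\<^sub>R v x)" "set_integrable lebesgue \<Omega> (\<lambda>x. \<phi> x *\<^sub>R v' x)"
      by (rule s(1)[OF iK(1) t(3) K(4)] s(1)[OF iK(3) t(3) K(4)] s(2)[OF iK(2) t(2) K(3)] s(2)[OF iK(4) t(2) K(3)]; assumption)+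
    have "(LINT x:\<Omega>|lebesgue. (u x - u' x) *\<^sub>R grad \<phi> x)
        = (LINT x:\<Omega>|lebesgue. u x *\<^sub>R grad \<phi> x) - (LINT x:\<Omega>|lebesgue. u' x *\<^sub>R grad \<phi> x)"
      unfolding scaleR_diff_left using i by (intro set_integral_diff) auto
    also have "\<dots> = - ((LINT x:\<Omega>|lebesgue. \<phi> x *\<^sub>R v x) - (LINT x:\<Omega>|lebesgue. \<phi> x *\<^sub>R v' x))"
      using 1 2 \<phi> by (simp add: has_weak_grad_def)
    also have "(LINT x:\<Omega>|lebesgue. \<phi> x *\<^sub>R v x) - (LINT x:\<Omega>|lebesgue. \<phi> x *\<^sub>R v' x)
        = (LINT x:\<Omega>|lebesgue. \<phi> x *\<^sub>R (v x - v' x))"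
      unfolding scaleR_diff_right using i by (intro set_integral_diff(2)[symmetric]) auto
    finally show ?thesis .
  qed
  then show ?thesis using 1 2 by (auto simp: has_weak_grad_def intro: set_integral_diff)
qed

section \<open>Almost everywhere uniqueness of weak gradients\<close>

lemma sigma_finite_lebesgue: "sigma_finite_measure (lebesgue :: 'a::euclidean_space measure)"
proof
  obtain \<A> where "countable \<A>" "\<A> \<subseteq> sets (lborel :: 'a measure)" "\<Union>\<A> = space lborel"
    "\<forall>a\<in>\<A>. emeasure lborel a \<noteq> \<infinity>"
    using lborel.sigma_finite_countable by blast
  then show "\<exists>\<A>. countable \<A> \<and> \<A> \<subseteq> sets (lebesgue :: 'a measure) \<and> \<Union>\<A> = space lebesgue \<and>
      (\<forall>a\<in>\<A>. emeasure lebesgue a \<noteq> \<infinity>)"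
    by (intro exI[of _ \<A>]) (auto simp: subset_iff intro!: sets_completionI_sets)
qed

text \<open>Boxes are stable under intersection and generate the Borel sets, and the sets over which
  the integral vanishes form a Dynkin system; a Lebesgue set differs from a Borel set by a null set.
  Closure under complements uses that the total integral is 0, which holds because \<open>F\<close>
  is supported in a single box.\<close>

lemma AE_zero_if_box_integrals_zero:
  fixes F :: "'a::euclidean_space \<Rightarrow> 'b::{banach, second_countable_topology}"
  assumes F: "integrable lebesgue F" and box: "\<And>a b. (LINT x:box a b|lebesgue. F x) = 0"
    and bdd: "\<And>x. x \<notin> box c d \<Longrightarrow> F x = 0"
  shows "AE x in lebesgue. F x = 0"
proof (rule sigma_finite_measure.density_zero[OF _ F])
  show "sigma_finite_measure (lebesgue :: 'a measure)"
    by (rule sigma_finite_lebesgue)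
next
  have sF: "set_integrable lebesgue A F" if "A \<in> sets lebesgue" for A
    unfolding set_integrable_def by (rule integrable_mult_indicator[OF that F])
  have "indicator (box c d) x *\<^sub>R F x = F x" for x using bdd[of x] by (auto simp: indicator_def)
  then have tot: "(\<integral>x. F x \<partial>lebesgue) = 0" using box[of c d] by (simp add: set_lebesgue_integral_def)
  have borel: "(LINT x:S|lebesgue. F x) = 0" if "S \<in> sets borel" for S
  proof -
    have sig: "sets (borel :: 'a measure) = sigma_sets UNIV (range (\<lambda>(a, b). box a b))"
      unfolding borel_eq_box by (rule sets_measure_of) simp
    have S: "S \<in> sigma_sets UNIV (range (\<lambda>(a, b). box a b))"
      using that unfolding sig .
    have sub: "A \<in> sets lebesgue" if "A \<in> sigma_sets UNIV (range (\<lambda>(a, b). box a b :: 'a set))" for A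
      using that unfolding sig[symmetric] by (intro sets_completionI_sets) simp
    show ?thesis
    proof (rule sigma_sets_induct_disjoint[OF _ _ S])
      show "Int_stable (range (\<lambda>(a, b). box a b :: 'a set))"
        by (auto simp: Int_stable_def box_Int_box)
      show "(LINT x:A|lebesgue. F x) = 0" if "A \<in> range (\<lambda>(a, b). box a b)" for A
        using that box by auto
      show "(LINT x:{}|lebesgue. F x) = 0" by (simp add: set_lebesgue_integral_def)
      show "(LINT x:UNIV - A|lebesgue. F x) = 0"
        if A: "A \<in> sigma_sets UNIV (range (\<lambda>(a, b). box a b))" and 0: "(LINT x:A|lebesgue. F x) = 0" for A
      proof -
        have "indicator (UNIV - A) x *\<^sub>R F x = F x - indicator A x *\<^sub>R F x" for x by (auto simp: indicator_def)
        then show ?thesis using 0 tot sF[OF sub[OF A]] F by (simp add: set_lebesgue_integral_def set_integrable_def)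
      qed
      show "(LINT x:(\<Union>i. A i)|lebesgue. F x) = 0"
        if A: "disjoint_family A" "range A \<subseteq> sigma_sets UNIV (range (\<lambda>(a, b). box a b))"
          and 0: "\<And>i. (LINT x:A i|lebesgue. F x) = 0" for A :: "nat \<Rightarrow> 'a set"
      proof -
        have m: "A i \<in> sets lebesgue" for i using A(2) sub by blast
        have "(LINT x:(\<Union>i. A i)|lebesgue. F x) = (\<Sum>i. (LINT x:(A i)|lebesgue. F x))"
          using A(1) m by (intro lebesgue_integral_countable_add sF) (auto simp: disjoint_family_on_def)
        then show ?thesis using 0 by simp
      qed
    qed auto
  qed
  fix A :: "'a set" assume A: "A \<in> sets lebesgue"
  then obtain S N N' where SN: "A = S \<union> N" "N \<subseteq> N'" "N' \<in> null_sets lborel" "S \<in> sets lborel"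
    by (rule sets_completionE)
  have "(A - S) \<union> (S - A) \<in> null_sets lebesgue"
  proof (rule null_sets_completion_subset)
    show "(A - S) \<union> (S - A) \<subseteq> N'" using SN by blast
    show "N' \<in> null_sets lebesgue" using SN(3) by (rule null_sets_completionI)
  qed
  then have "(LINT x:A|lebesgue. F x) = (LINT x:S|lebesgue. F x)"
    using A SN(4) F by (intro set_integral_null_delta) auto
  then show "(LINT x:A|lebesgue. F x) = 0" using borel SN(4) by simp
qed

text \<open>The fundamental lemma of the calculus of variations: testing the difference with bump
  functions and letting them increase to the indicator of a box shows that its integral vanishes
  over every box whose closure lies in \<Omega>.\<close>

lemma weak_grad_unique:
  fixes u :: "real ^ 'n \<Rightarrow> real"
  assumes \<Omega>: "open \<Omega>" and 1: "has_weak_grad \<Omega> u v" and 2: "has_weak_grad \<Omega> u v'"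
  shows "AE x in lebesgue. x \<in> \<Omega> \<longrightarrow> v x = v' x"
proof -
  define w where "w x = v x - v' x" for x
  have w: "has_weak_grad \<Omega> (\<lambda>_. 0) w"
    using has_weak_grad_diff[OF 1 2] unfolding w_def by simp
  have iK: "set_integrable lebesgue K w" if "compact K" "K \<subseteq> \<Omega>" for K
    using w that by (auto simp: has_weak_grad_def)
  have box0: "(LINT x:box a b|lebesgue. w x) = 0" if ab: "cbox a b \<subseteq> \<Omega>" for a b
  proof -
    have wi: "integrable lebesgue (\<lambda>x. indicator (cbox a b) x *\<^sub>R w x)"
      using iK[OF compact_cbox ab] by (simp add: set_integrable_def)
    have zero: "(\<integral>x. bump a b k x *\<^sub>R (indicator (cbox a b) x *\<^sub>R w x) \<partial>lebesgue) = 0" for k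
    proof -
      have "(LINT x:\<Omega>|lebesgue. bump a b k x *\<^sub>R w x) = 0"
        using w bump_test[OF ab, of k] by (auto simp: has_weak_grad_def set_lebesgue_integral_def)
      moreover have "indicator \<Omega> x *\<^sub>R bump a b k x *\<^sub>R w x = bump a b k x *\<^sub>R (indicator (cbox a b) x *\<^sub>R w x)" for x
        using bump_outside[of x a b k] ab box_subset_cbox[of a b] by (auto simp: indicator_def)
      ultimately show ?thesis by (simp only: set_lebesgue_integral_def)
    qed
    have "(\<lambda>k. \<integral>x. bump a b k x *\<^sub>R (indicator (cbox a b) x *\<^sub>R w x) \<partial>lebesgue) \<longlonglongrightarrow> (\<integral>x. indicator (box a b) x *\<^sub>R w x \<partial>lebesgue)"
    proof (rule integral_dominated_convergence[where w="\<lambda>x. norm (indicator (cbox a b) x *\<^sub>R w x)"])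
      have e: "indicator (box a b) x *\<^sub>R w x = indicator (box a b) x *\<^sub>R (indicator (cbox a b) x *\<^sub>R w x)" for x
        using box_subset_cbox[of a b] by (auto simp: indicator_def)
      show "(\<lambda>x. indicator (box a b) x *\<^sub>R w x) \<in> borel_measurable lebesgue"
        unfolding e
        by (rule borel_measurable_scaleR[OF borel_measurable_indicator borel_measurable_integrable[OF wi]]) simp
      show "(\<lambda>x. bump a b k x *\<^sub>R (indicator (cbox a b) x *\<^sub>R w x)) \<in> borel_measurable lebesgue" for k
      proof (rule borel_measurable_scaleR[OF measurable_completion borel_measurable_integrable[OF wi]])
        show "bump a b k \<in> borel_measurable lborel"
          using borel_measurable_continuous_onI[OF test_functionD(2)[OF bump_test[OF ab, of k]]] by simp
      qed
      show "AE x in lebesgue. (\<lambda>k. bump a b k x *\<^sub>R (indicator (cbox a b) x *\<^sub>R w x)) \<longlonglongrightarrow> indicator (box a b) x *\<^sub>R w x"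
      proof (rule AE_I2)
        fix x show "(\<lambda>k. bump a b k x *\<^sub>R (indicator (cbox a b) x *\<^sub>R w x)) \<longlonglongrightarrow> indicator (box a b) x *\<^sub>R w x"
        proof (cases "x \<in> box a b")
          case True
          have "(\<lambda>k. bump a b k x *\<^sub>R (indicator (cbox a b) x *\<^sub>R w x)) \<longlonglongrightarrow> 1 *\<^sub>R (indicator (cbox a b) x *\<^sub>R w x)"
            by (intro tendsto_intros bump_tendsto True)
          then show ?thesis using True box_subset_cbox[of a b] by (auto simp: indicator_def)
        qed (simp add: bump_outside)
      qed
      show "AE x in lebesgue. norm (bump a b k x *\<^sub>R (indicator (cbox a b) x *\<^sub>R w x)) \<le> norm (indicator (cbox a b) x *\<^sub>R w x)" for k
      proof (rule AE_I2)
        fix x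
        have "norm (bump a b k x *\<^sub>R (indicator (cbox a b) x *\<^sub>R w x)) = \<bar>bump a b k x\<bar> * norm (indicator (cbox a b) x *\<^sub>R w x)"
          by (rule norm_scaleR)
        also have "\<dots> \<le> 1 * norm (indicator (cbox a b) x *\<^sub>R w x)"
          using bump_bounds[of a b k x] by (intro mult_right_mono) auto
        finally show "norm (bump a b k x *\<^sub>R (indicator (cbox a b) x *\<^sub>R w x)) \<le> norm (indicator (cbox a b) x *\<^sub>R w x)"
          by simp
      qed
    qed (rule integrable_norm[OF wi])
    then show ?thesis unfolding zero by (simp add: set_lebesgue_integral_def LIMSEQ_const_iff)
  qed
  \<comment> \<open>Integrability is available on compact sets only, so the difference is restricted
    to one box first. The boundary of the box is a null set, and countably many closed boxes cover
    \<Omega>.\<close>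
  have local: "AE x in lebesgue. x \<in> cbox c d \<longrightarrow> w x = 0" if cd: "cbox c d \<subseteq> \<Omega>" for c d
  proof -
    define F where "F x = indicator (box c d) x *\<^sub>R w x" for x
    have F: "integrable lebesgue F"
    proof -
      have "indicator (box c d) x *\<^sub>R (indicator (cbox c d) x *\<^sub>R w x) = F x" for x
        using box_subset_cbox[of c d] by (auto simp: indicator_def F_def)
      then show ?thesis
        using integrable_mult_indicator[of "box c d" lebesgue "\<lambda>x. indicator (cbox c d) x *\<^sub>R w x"]
          iK[OF compact_cbox cd] by (simp add: set_integrable_def)
    qed
    have "AE x in lebesgue. F x = 0"
    proof (rule AE_zero_if_box_integrals_zero[OF F, where c=c and d=d])
      fix a b
      obtain a' b' where ab: "box a b \<inter> box c d = box a' b'" "cbox a' b' \<subseteq> cbox c d"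
      proof -
        let ?a = "\<Sum>i\<in>Basis. max (a\<bullet>i) (c\<bullet>i) *\<^sub>R i" and ?b = "\<Sum>i\<in>Basis. min (b\<bullet>i) (d\<bullet>i) *\<^sub>R i"
        have "cbox ?a ?b \<subseteq> cbox c d" by (auto simp: mem_box)
        then show ?thesis using that box_Int_box by blast
      qed
      have "indicator (box a b) x *\<^sub>R F x = indicator (box a' b') x *\<^sub>R w x" for x
        unfolding ab(1)[symmetric] F_def by (auto simp: indicator_def)
      then show "(LINT x:box a b|lebesgue. F x) = 0"
        using box0[of a' b'] ab(2) cd by (simp add: set_lebesgue_integral_def)
    qed (simp add: F_def)
    moreover have "AE x in lebesgue. x \<notin> cbox c d - box c d"
      using negligible_frontier_interval[of c d] by (intro AE_not_in) (simp add: negligible_iff_null_sets)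
    ultimately show ?thesis by eventually_elim (auto simp: F_def indicator_def split: if_splits)
  qed
  obtain \<D> where D: "countable \<D>" "\<D> \<subseteq> Pow \<Omega>" "\<And>X. X \<in> \<D> \<Longrightarrow> \<exists>a b. X = cbox a b" "\<Union>\<D> = \<Omega>"
    by (rule open_countable_Union_open_cbox[OF \<Omega>], rule that) (assumption | fast)+
  have "AE x in lebesgue. \<forall>X\<in>\<D>. x \<in> X \<longrightarrow> w x = 0"
  proof (subst AE_ball_countable[OF D(1)], intro ballI)
    fix X assume X: "X \<in> \<D>"
    then obtain a b where "X = cbox a b" using D(3) by blast
    then show "AE x in lebesgue. x \<in> X \<longrightarrow> w x = 0" using local X D(2) by blast
  qed
  then show ?thesis by eventually_elim (use D(4) in \<open>auto simp: w_def\<close>)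
qed

text \<open>This makes the arbitrary choice in \<open>weak_grad\<close> harmless: as soon as one
  weak gradient is known, the chosen one agrees with it almost everywhere.\<close>

lemma weak_grad_AE_eq:
  assumes "open \<Omega>" "has_weak_grad \<Omega> u v"
  shows "has_weak_grad \<Omega> u (weak_grad \<Omega> u)" "AE x in lebesgue. x \<in> \<Omega> \<longrightarrow> weak_grad \<Omega> u x = v x"
proof -
  show *: "has_weak_grad \<Omega> u (weak_grad \<Omega> u)"
    unfolding weak_grad_def by (rule someI[of "has_weak_grad \<Omega> u", OF assms(2)])
  show "AE x in lebesgue. x \<in> \<Omega> \<longrightarrow> weak_grad \<Omega> u x = v x"
    by (rule weak_grad_unique[OF assms(1) * assms(2)])
qed


section \<open>The energy inequality for smooth functions\<close>

context onofri_ball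
begin

text \<open>
  The level sets of \<open>v\<close> at heights \<open>i * d\<close> cut the ball into slices. On each slice Young's
  inequality with a constant slope \<open>a i\<close> reduces the energy to the isoperimetric bound, and the
  slopes are those provided by the transport to the extremal profile.
\<close>

lemma energy_lower_bound_mesh:
  fixes v :: "real ^ 'n \<Rightarrow> real" and G :: "real ^ 'n \<Rightarrow> real ^ 'n"
  assumes der: "\<And>x. GDERIV v x :> G x" and G: "continuous_on UNIV G" and GL: "\<And>x. norm (G x) \<le> L"
    and neg: "\<And>x. R < norm x \<Longrightarrow> v x < 0" and y: "0 < y"
    and mass: "vol1 * M R \<le> y ^ CARD('n) * (\<integral>x. exp (v x) * indicator (cball 0 R) x \<partial>lborel)"
    and d: "0 < d"
  shows "vol1 * (real CARD('n) ^ 3 / (real CARD('n) - 1) * q ^ (CARD('n) - 1)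
          * (exp (- (real CARD('n) - 1) * d / real CARD('n)) * N R - y ^ (CARD('n) - 1) * R ^ CARD('n))
       - (real CARD('n) - 1) * q ^ CARD('n) * Q R)
    \<le> (\<integral>x. norm (G x) ^ CARD('n) * indicator (cball 0 R) x \<partial>lborel)"
proof -
  let ?n = "CARD('n)" and ?C = "cball (0 :: real ^ 'n) R"
  have vcont: "continuous_on UNIV v"
    using der by (auto intro!: continuous_at_imp_continuous_on has_derivative_continuous simp: gderiv_def)
  have vm [measurable]: "v \<in> borel_measurable borel" using vcont by (rule borel_measurable_continuous_onI)
  have Gm [measurable]: "G \<in> borel_measurable borel" using G by (rule borel_measurable_continuous_onI)
  have Cm [measurable]: "?C \<in> sets borel" by simp
  have fin: "emeasure lborel A < \<infinity>" if "A \<subseteq> ?C" for A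
    using emeasure_bounded_finite[OF bounded_subset[OF bounded_cball that]] .
  have "compact (v ` ?C)" using vcont by (intro compact_continuous_image) (auto intro: continuous_on_subset)
  then have "bounded (v ` ?C)" by (rule compact_imp_bounded)
  then obtain c where c': "\<forall>z\<in>v ` ?C. norm z \<le> c" unfolding bounded_iff by blast
  have c: "v x \<le> c" if "x \<in> ?C" for x
    using bspec[OF c' imageI[OF that]] by simp
  obtain K0 :: nat where "c / d < real K0" using reals_Archimedean2 by blast
  then have K0: "c < real K0 * d" using d by (simp add: field_simps)
  \<comment> \<open>The successor guarantees that K is not 0, so \<open>A K\<close> below is a
    genuine superlevel set, and it is empty.\<close>
  define K where "K = Suc K0"
  have vK: "v x < real K * d" for x
  proof (cases "x \<in> ?C")
    case True
    then show ?thesis using c[OF True] K0 d by (simp add: K_def algebra_simps)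
  next
    case False
    then have "v x < 0" using neg by simp
    then show ?thesis using d by (meson less_le_trans mult_nonneg_nonneg less_imp_le of_nat_0_le_iff)
  qed
  \<comment> \<open>Level 0 is the whole closed ball and not {x. 0 \<le> v x}, so that the first
    radius is R and points with negative v fall into the lowest slice.\<close>
  define A where "A i = (if i = 0 then ?C else {x. real i * d \<le> v x})" for i
  have A_sub: "A i \<subseteq> ?C" for i
  proof (cases "i = 0")
    case False
    then have "0 < real i * d" using d by simp
    then show ?thesis using neg False by (force simp: A_def not_less)
  qed (simp add: A_def)
  have A_dec: "A (Suc i) \<subseteq> A i" for i
  proof (cases "i = 0")
    case True
    then show ?thesis using A_sub[of 1] by (simp add: A_def)
  next
    case False
    then show ?thesis using d by (auto simp: A_def algebra_simps)
  qed
  have AK: "A K = {}" using vK by (auto simp: A_def K_def not_le)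
  have Am [measurable]: "A i \<in> sets borel" for i unfolding A_def by simp
  define V where "V i = measure lborel (A i)" for i
  define r where "r i = root ?n (V i / vol1)" for i
  have V0: "0 \<le> V i" for i by (simp add: V_def)
  have V_dec: "V (Suc i) \<le> V i" for i
    unfolding V_def using A_dec fin[OF A_sub] by (intro measure_mono_fmeasurable fmeasurableI) auto
  have r0: "r 0 = R"
  proof -
    have "V 0 = vol1 * R ^ ?n" using R by (simp add: V_def A_def content_cball content_ball vol1_def)
    then show ?thesis using vol1_pos R n by (simp add: r_def real_root_power_cancel)
  qed
  have rK: "r K = 0" by (simp add: r_def V_def AK)
  have r_nonneg: "0 \<le> r i" for i unfolding r_def using V0 vol1_pos by (intro real_root_ge_zero) simp
  have r_dec: "r (Suc i) \<le> r i" for i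
    unfolding r_def using V_dec vol1_pos n by (simp add: divide_right_mono)
  have rn: "vol1 * r i ^ ?n = V i" for i
    using V0[of i] vol1_pos n by (simp add: r_def)
  define S where "S i = A i - A (Suc i)" for i
  have Sm [measurable]: "S i \<in> sets borel" for i unfolding S_def by measurable
  have S_sub: "S i \<subseteq> ?C" for i using A_sub by (auto simp: S_def)
  have S_meas: "measure lborel (S i) = V i - V (Suc i)" for i
    unfolding S_def V_def using A_dec fin[OF A_sub] by (intro measure_Diff) (auto simp: less_top)
  have S_upper: "v x < real (Suc i) * d" if "x \<in> S i" for i x
    using that by (auto simp: S_def A_def not_le)
  \<comment> \<open>Equality can fail in the lowest slice, which also contains the points of the
    ball where v is negative. The inclusion suffices, since the integrand norm (G x) is
    nonnegative.\<close>
  have S_slice: "{x. real i * d \<le> v x \<and> v x < real (Suc i) * d} \<subseteq> S i" for i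
  proof
    fix x assume x: "x \<in> {x. real i * d \<le> v x \<and> v x < real (Suc i) * d}"
    have "0 \<le> real i * d" using d by simp
    then have "x \<in> ?C" using x neg[of x] by (cases "R < norm x") auto
    then show "x \<in> S i" using x by (auto simp: S_def A_def)
  qed
  have sum_ind: "indicator ?C x = (\<Sum>i<K. indicator (S i) x :: real)" for x
  proof -
    have "(\<Sum>i<K. indicator (S i) x :: real) = (\<Sum>i<K. indicator (A i) x - indicator (A (Suc i)) x)"
      using A_dec by (intro sum.cong) (auto simp: S_def indicator_def)
    also have "\<dots> = indicator (A 0) x - indicator (A K) x"
      by (rule sum_lessThan_telescope'[of "\<lambda>i. indicator (A i) x"])
    finally show ?thesis using AK by (simp add: A_def)
  qed
  have intS: "integrable lborel (\<lambda>x. f x * indicator (S i) x)"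
    if "continuous_on UNIV f" for f :: "real ^ 'n \<Rightarrow> real" and i
  proof -
    have "integrable lborel (\<lambda>x. indicator ?C x *\<^sub>R f x)"
      using that by (intro borel_integrable_compact) (auto intro: continuous_on_subset)
    from integrable_mult_indicator[of "S i", OF _ this] S_sub[of i]
    have "integrable lborel (\<lambda>x. indicator (S i) x *\<^sub>R indicator ?C x *\<^sub>R f x)" by simp
    moreover have "indicator (S i) x *\<^sub>R indicator ?C x *\<^sub>R f x = f x * indicator (S i) x" for x
      using S_sub[of i] by (auto simp: indicator_def)
    ultimately show ?thesis by (simp only:)
  qed
  have split: "(\<integral>x. f x * indicator ?C x \<partial>lborel) = (\<Sum>i<K. \<integral>x. f x * indicator (S i) x \<partial>lborel)"
    if "continuous_on UNIV f" for f :: "real ^ 'n \<Rightarrow> real"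
    unfolding sum_ind sum_distrib_left using intS[OF that] by (intro Bochner_Integration.integral_sum)
  \<comment> \<open>An upper sum for the mass: exp v is replaced by its largest possible value on
    each slice. Overestimating is safe, because the mass is given a lower bound.\<close>
  define m0 where "m0 = (\<Sum>i<K. exp (real (Suc i) * d) * (r i ^ ?n - r (Suc i) ^ ?n))"
  have "(\<integral>x. exp (v x) * indicator ?C x \<partial>lborel) \<le> vol1 * m0"
  proof -
    have c: "continuous_on UNIV (\<lambda>x. exp (v x))" by (intro continuous_intros vcont)
    have "(\<integral>x. exp (v x) * indicator (S i) x \<partial>lborel) \<le> exp (real (Suc i) * d) * (V i - V (Suc i))" for i
    proof -
      have "(\<integral>x. exp (v x) * indicator (S i) x \<partial>lborel) \<le> (\<integral>x. exp (real (Suc i) * d) * indicator (S i) x \<partial>lborel)"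
        using S_upper by (intro integral_mono intS c continuous_intros) (auto simp: indicator_def less_imp_le)
      also have "\<dots> = exp (real (Suc i) * d) * measure lborel (S i)" by simp
      finally show ?thesis by (simp only: S_meas)
    qed
    then have "(\<integral>x. exp (v x) * indicator ?C x \<partial>lborel) \<le> (\<Sum>i<K. exp (real (Suc i) * d) * (V i - V (Suc i)))"
      unfolding split[OF c] by (intro sum_mono)
    also have "\<dots> = vol1 * m0"
      unfolding m0_def sum_distrib_left rn[symmetric] by (intro sum.cong) (auto simp: algebra_simps)
    finally show ?thesis .
  qed
  then have "y ^ ?n * (\<integral>x. exp (v x) * indicator ?C x \<partial>lborel) \<le> y ^ ?n * (vol1 * m0)"
    using y by (intro mult_left_mono) auto
  with mass have "vol1 * M R \<le> vol1 * (y ^ ?n * m0)" by (simp add: mult_ac)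
  then have m0: "M R \<le> y ^ ?n * m0" using vol1_pos by simp
  have MR: "0 < M R" unfolding M_R using D_pos R by simp
  have m0_pos: "0 < m0" using m0 MR y by (metis less_le_trans zero_less_mult_pos zero_less_power)
  \<comment> \<open>The discrete bound wants the mass equation to hold exactly. The factor y is
    lowered until it does, and since y enters that bound with a negative sign, the result for y
    follows.\<close>
  define y' where "y' = root ?n (M R / m0)"
  have y': "0 < y'" "y' ^ ?n = M R / m0" using MR m0_pos n by (auto simp: y'_def)
  have "y' ^ ?n \<le> y ^ ?n" unfolding y' using m0 m0_pos by (simp add: divide_le_eq)
  then have y'y: "y' \<le> y" using y y'(1) n by (meson power_less_imp_less_base less_imp_le not_le power_strict_mono zero_less_card_finite)
  define B where "B i = y' * exp (real i * d / real ?n)" for i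
  have Bn: "B i ^ ?n = y' ^ ?n * exp (real i * d)" for i
    unfolding B_def power_mult_distrib using n by (simp add: exp_of_nat_mult[symmetric])
  have massB: "(\<Sum>i<K. B (Suc i) ^ ?n * (r i ^ ?n - r (Suc i) ^ ?n)) = M R"
  proof -
    have "(\<Sum>i<K. B (Suc i) ^ ?n * (r i ^ ?n - r (Suc i) ^ ?n)) = y' ^ ?n * m0"
      unfolding Bn m0_def sum_distrib_left by (simp add: mult.assoc)
    then show ?thesis using y'(2) m0_pos by simp
  qed
  obtain a where a: "\<And>i. 0 \<le> a i"
    "real ?n ^ 3 / (real ?n - 1) * q ^ (?n - 1) * (exp (- (real ?n - 1) * d / real ?n) * N R - y' ^ (?n - 1) * R ^ ?n)
       - (real ?n - 1) * q ^ ?n * Q R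
     \<le> (\<Sum>i<K. (real ?n)\<^sup>2 * a i ^ (?n - 1) * d * r (Suc i) ^ (?n - 1)
           - (real ?n - 1) * a i ^ ?n * (r i ^ ?n - r (Suc i) ^ ?n))"
    by (rule discrete_energy_bound[OF r0 rK r_dec r_nonneg d y'(1) B_def massB]) blast
  have slice: "vol1 * ((real ?n)\<^sup>2 * a i ^ (?n - 1) * d * r (Suc i) ^ (?n - 1)
           - (real ?n - 1) * a i ^ ?n * (r i ^ ?n - r (Suc i) ^ ?n))
      \<le> (\<integral>x. norm (G x) ^ ?n * indicator (S i) x \<partial>lborel)" for i
  proof -
    have cG: "continuous_on UNIV (\<lambda>x. norm (G x))" by (intro continuous_intros G)
    have bdd: "bounded {x. real i * d \<le> v x}"
    proof (rule bounded_subset[OF bounded_cball])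
      have "0 \<le> real i * d" using d by simp
      then show "{x. real i * d \<le> v x} \<subseteq> ?C" using neg by (force simp: not_less)
    qed
    have "real DIM(real ^ 'n) * root DIM(real ^ 'n) (measure lborel (ball (0 :: real ^ 'n) 1)) * (real (Suc i) * d - real i * d) *
      root DIM(real ^ 'n) (measure lborel {x. real (Suc i) * d \<le> v x}) ^ (DIM(real ^ 'n) - 1)
      \<le> (\<integral>x. norm (G x) * indicator {x. real i * d \<le> v x \<and> v x < real (Suc i) * d} x \<partial>lborel)"
    proof (rule slice_isoperimetric)
      show "(v has_derivative (\<lambda>h. G x \<bullet> h)) (at x)" for x using der[of x] by (simp add: gderiv_def inner_commute)
    qed (use n d G GL bdd in auto)
    also have "\<dots> \<le> (\<integral>x. norm (G x) * indicator (S i) x \<partial>lborel)"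
    proof (rule integral_mono')
      show "integrable lborel (\<lambda>x. norm (G x) * indicator (S i) x)" by (rule intS[OF cG])
    qed (use S_slice[of i] in \<open>auto simp: indicator_def\<close>)
    finally have s: "real ?n * root ?n vol1 * d * root ?n (V (Suc i)) ^ (?n - 1) \<le> (\<integral>x. norm (G x) * indicator (S i) x \<partial>lborel)"
      by (simp add: vol1_def[symmetric] V_def A_def algebra_simps)
    have "root ?n (V (Suc i)) = root ?n vol1 * r (Suc i)"
      unfolding r_def using vol1_pos n by (simp add: real_root_mult[symmetric])
    \<comment> \<open>One n-th root of \<open>vol1\<close> comes from the isoperimetric constant and
      n - 1 of them from the radius; together they make up \<open>vol1\<close>.\<close>
    then have "root ?n vol1 * root ?n (V (Suc i)) ^ (?n - 1) = (root ?n vol1 * root ?n vol1 ^ (?n - 1)) * r (Suc i) ^ (?n - 1)"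
      by (simp add: power_mult_distrib)
    also have "root ?n vol1 * root ?n vol1 ^ (?n - 1) = vol1"
      unfolding power_unfold(1)[symmetric] using vol1_pos n by simp
    finally have s': "real ?n * vol1 * d * r (Suc i) ^ (?n - 1) \<le> (\<integral>x. norm (G x) * indicator (S i) x \<partial>lborel)"
      using s by (simp add: mult_ac)
    have iG: "integrable lborel (\<lambda>x. norm (G x) * indicator (S i) x)" by (rule intS[OF cG])
    have iS: "integrable lborel (\<lambda>x :: real ^ 'n. indicator (S i) x :: real)"
      using intS[of "\<lambda>_. 1" i] by simp
    have "vol1 * ((real ?n)\<^sup>2 * a i ^ (?n - 1) * d * r (Suc i) ^ (?n - 1)
           - (real ?n - 1) * a i ^ ?n * (r i ^ ?n - r (Suc i) ^ ?n))
      = real ?n * a i ^ (?n - 1) * (real ?n * vol1 * d * r (Suc i) ^ (?n - 1)) - (real ?n - 1) * a i ^ ?n * (V i - V (Suc i))"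
      unfolding rn[symmetric] by (simp add: algebra_simps power2_eq_square)
    also have "\<dots> \<le> real ?n * a i ^ (?n - 1) * (\<integral>x. norm (G x) * indicator (S i) x \<partial>lborel) - (real ?n - 1) * a i ^ ?n * measure lborel (S i)"
      unfolding S_meas using s' a(1)[of i] by (intro diff_right_mono mult_left_mono) auto
    also have "\<dots> = (\<integral>x. real ?n * a i ^ (?n - 1) * (norm (G x) * indicator (S i) x) - (real ?n - 1) * a i ^ ?n * indicator (S i) x \<partial>lborel)"
      using iG iS by (simp add: Bochner_Integration.integral_diff)
    also have "\<dots> \<le> (\<integral>x. norm (G x) ^ ?n * indicator (S i) x \<partial>lborel)"
    proof (rule integral_mono)
      show "integrable lborel (\<lambda>x. norm (G x) ^ ?n * indicator (S i) x)" by (intro intS continuous_intros G)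
      show "real ?n * a i ^ (?n - 1) * (norm (G x) * indicator (S i) x) - (real ?n - 1) * a i ^ ?n * indicator (S i) x
        \<le> norm (G x) ^ ?n * indicator (S i) x" for x
        using young_power[of "a i" "norm (G x)" ?n] a(1)[of i] n by (auto simp: indicator_def algebra_simps)
    qed (use iG iS in auto)
    finally show ?thesis .
  qed
  have "vol1 * (real ?n ^ 3 / (real ?n - 1) * q ^ (?n - 1) * (exp (- (real ?n - 1) * d / real ?n) * N R - y ^ (?n - 1) * R ^ ?n)
       - (real ?n - 1) * q ^ ?n * Q R)
    \<le> vol1 * (real ?n ^ 3 / (real ?n - 1) * q ^ (?n - 1) * (exp (- (real ?n - 1) * d / real ?n) * N R - y' ^ (?n - 1) * R ^ ?n)
       - (real ?n - 1) * q ^ ?n * Q R)"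
    using y'y y'(1) R n vol1_pos q_pos
    by (intro mult_left_mono diff_right_mono diff_left_mono mult_right_mono power_mono) auto
  also have "\<dots> \<le> vol1 * (\<Sum>i<K. (real ?n)\<^sup>2 * a i ^ (?n - 1) * d * r (Suc i) ^ (?n - 1)
           - (real ?n - 1) * a i ^ ?n * (r i ^ ?n - r (Suc i) ^ ?n))"
    using a(2) vol1_pos by (intro mult_left_mono) auto
  also have "\<dots> \<le> (\<Sum>i<K. \<integral>x. norm (G x) ^ ?n * indicator (S i) x \<partial>lborel)"
    unfolding sum_distrib_left using slice by (intro sum_mono)
  also have "\<dots> = (\<integral>x. norm (G x) ^ ?n * indicator ?C x \<partial>lborel)"
    by (intro split[symmetric] continuous_intros G)
  finally show ?thesis .
qed

text \<open>The loss in the energy bound when the mass constraint is met only up to the factor y ^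
  n; it vanishes at y = 1.\<close>

definition energy_defect :: "real \<Rightarrow> real" where
  "energy_defect y = vol1 * (real CARD('n) ^ 3 / (real CARD('n) - 1) * q ^ (CARD('n) - 1) * ((y ^ (CARD('n) - 1) - 1) * R ^ CARD('n)))"

text \<open>The mesh estimate is applied to \<phi> + ln mu minus the boundary value of
  \<open>ln mu\<close>. This function is negative outside the closed ball, because \<open>mu\<close>
  is radially decreasing and \<phi> vanishes there; afterwards the mesh width tends to 0.\<close>

theorem energy_lower_bound:
  fixes \<phi> :: "real ^ 'n \<Rightarrow> real"
  assumes \<phi>: "\<And>x. GDERIV \<phi> x :> F x" "continuous_on UNIV F"
    and supp: "\<And>x. R \<le> norm x \<Longrightarrow> \<phi> x = 0" and y: "0 < y"
    and mass: "theta TYPE('n) R \<le> y ^ CARD('n) * (LINT x:ball 0 R|lborel. exp (\<phi> x) * mu x)"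
  shows "vol1 * q ^ CARD('n) * Q R - energy_defect y \<le> (LINT x:ball 0 R|lborel. norm (F x + Dm x) ^ CARD('n))"
proof -
  let ?n = "CARD('n)" and ?B = "ball (0 :: real ^ 'n) R" and ?C = "cball (0 :: real ^ 'n) R"
  \<comment> \<open>The value of \<open>mu\<close> on the sphere of radius R.\<close>
  define m where "m = 1 / (vol1 * D R ^ ?n)"
  have m: "0 < m" using vol1_pos D_pos by (simp add: m_def)
  define v where "v x = \<phi> x + (ln (mu x) - ln m)" for x
  have exp_v: "exp (v x) = exp (\<phi> x) * mu x / m" for x
    using m mu_pos[of x] by (simp add: v_def exp_add exp_diff)
  have der: "GDERIV v x :> F x + Dm x" for x
    using GDERIV_add[OF \<phi>(1) GDERIV_diff[OF GDERIV_ln_mu GDERIV_const]] unfolding v_def[abs_def] by simp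
  have G: "continuous_on UNIV (\<lambda>x. F x + Dm x)" by (intro continuous_intros \<phi>(2) continuous_on_Dm)
  have F0: "F x = 0" if "x \<notin> ?C" for x
    by (rule GDERIV_eq_0_off_support[of ?C \<phi>]) (use \<phi> supp that in auto)
  obtain L where L: "\<And>x. norm (F x) \<le> L"
    using bounded_if_compact_support[OF compact_cball \<phi>(2) F0] by blast
  have GL: "norm (F x + Dm x) \<le> L + real ?n * p" for x
    using norm_triangle_ineq[of "F x" "Dm x"] L[of x] norm_Dm_le[of x] by linarith
  have neg: "v x < 0" if "R < norm x" for x
  proof -
    have "R powr p < norm x powr p" using that R p by (intro powr_less_mono2) auto
    then have "D R ^ ?n < D (norm x) ^ ?n" using D_pos[of R] n by (intro power_strict_mono) (auto simp: D_def)
    then have "mu x < m"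
      unfolding mu_eq m_def using vol1_pos D_pos by (intro divide_strict_left_mono mult_strict_left_mono mult_pos_pos) auto
    then show ?thesis using supp[of x] that mu_pos[of x] m by (simp add: v_def)
  qed
  \<comment> \<open>The mesh estimate lives on the closed ball and the functionals on the open one;
    the sphere between them is a null set.\<close>
  have BC: "(\<integral>x. f x * indicator ?C x \<partial>lborel) = (LINT x:?B|lborel. f x)" if "f \<in> borel_measurable borel" for f :: "_ \<Rightarrow> real"
    unfolding set_lebesgue_integral_def
  proof (rule integral_cong_AE)
    have "sphere (0 :: real ^ 'n) R \<in> null_sets lborel"
      using negligible_sphere[of "0 :: real ^ 'n" R] by (simp add: negligible_iff_null_sets null_sets_completion_iff)
    then show "AE x in lborel. f x * indicator ?C x = indicator ?B x *\<^sub>R f x"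
      by (rule AE_not_in[THEN eventually_mono]) (auto simp: indicator_def)
  qed (use that in \<open>auto intro!: borel_measurable_times borel_measurable_indicator\<close>)
  have pm: "\<phi> \<in> borel_measurable borel"
    using \<phi>(1) by (intro borel_measurable_continuous_onI continuous_at_imp_continuous_on)
      (auto intro!: has_derivative_continuous simp: gderiv_def)
  have "vol1 * M R \<le> y ^ ?n * (\<integral>x. exp (v x) * indicator ?C x \<partial>lborel)"
  proof -
    have "(\<integral>x. exp (v x) * indicator ?C x \<partial>lborel) = (LINT x:?B|lborel. exp (\<phi> x) * mu x) / m"
      unfolding exp_v using pm by (subst BC) auto
    moreover have "theta TYPE('n) R / m = vol1 * M R"
      unfolding theta_eq m_def M_R by (simp add: power_unfold(1)[of "D R"])
    moreover have "theta TYPE('n) R / m \<le> y ^ ?n * (LINT x:?B|lborel. exp (\<phi> x) * mu x) / m"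
      using mass m by (intro divide_right_mono) auto
    ultimately show ?thesis by simp
  qed
  note mesh = energy_lower_bound_mesh[OF der G GL neg y this]
  define c where "c = real ?n ^ 3 / (real ?n - 1) * q ^ (?n - 1)"
  have "((\<lambda>d. vol1 * (c * (exp (- (real ?n - 1) * d / real ?n) * N R - y ^ (?n - 1) * R ^ ?n)
       - (real ?n - 1) * q ^ ?n * Q R)) \<longlongrightarrow> vol1 * (c * (exp (- (real ?n - 1) * 0 / real ?n) * N R - y ^ (?n - 1) * R ^ ?n)
       - (real ?n - 1) * q ^ ?n * Q R)) (at_right 0)"
    by (intro tendsto_intros) auto
  moreover have "\<forall>\<^sub>F d in at_right 0. vol1 * (c * (exp (- (real ?n - 1) * d / real ?n) * N R - y ^ (?n - 1) * R ^ ?n)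
       - (real ?n - 1) * q ^ ?n * Q R) \<le> (\<integral>x. norm (F x + Dm x) ^ ?n * indicator ?C x \<partial>lborel)"
    using mesh unfolding c_def eventually_at_right_field by (intro exI[of _ 1]) auto
  ultimately have "vol1 * (c * (exp (- (real ?n - 1) * 0 / real ?n) * N R - y ^ (?n - 1) * R ^ ?n)
       - (real ?n - 1) * q ^ ?n * Q R) \<le> (\<integral>x. norm (F x + Dm x) ^ ?n * indicator ?C x \<partial>lborel)"
    by (rule tendsto_upperbound) simp
  moreover have "vol1 * (c * (exp (- (real ?n - 1) * 0 / real ?n) * N R - y ^ (?n - 1) * R ^ ?n)
       - (real ?n - 1) * q ^ ?n * Q R)
     = vol1 * (c * (N R - R ^ ?n) - (real ?n - 1) * q ^ ?n * Q R) - energy_defect y"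
    unfolding energy_defect_def c_def[symmetric] by (simp add: algebra_simps)
  moreover have "c * (N R - R ^ ?n) - (real ?n - 1) * q ^ ?n * Q R = q ^ ?n * Q R"
    unfolding c_def by (rule energy_identity)
  moreover have "(\<integral>x. norm (F x + Dm x) ^ ?n * indicator ?C x \<partial>lborel) = (LINT x:?B|lborel. norm (F x + Dm x) ^ ?n)"
    using borel_measurable_continuous_onI[OF G] by (intro BC) auto
  ultimately show ?thesis by (simp add: mult.assoc)
qed

end


section \<open>Approximation in Sobolev spaces\<close>

lemma Lp_on_integrableD:
  assumes "f \<in> Lp_on p \<Omega>"
  shows "set_borel_measurable lebesgue \<Omega> f" "set_integrable lebesgue \<Omega> (\<lambda>x. norm (f x) ^ p)"
  using assms by (auto simp: Lp_on_def)

lemma Lp_on_cong_AE: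
  fixes f g :: "real ^ 'n \<Rightarrow> 'b::euclidean_space"
  assumes f: "f \<in> Lp_on p \<Omega>" and ae: "AE x in lebesgue. x \<in> \<Omega> \<longrightarrow> f x = g x"
  shows "g \<in> Lp_on p \<Omega>"
    and "(LINT x:\<Omega>|lebesgue. norm (g x) ^ p) = (LINT x:\<Omega>|lebesgue. norm (f x) ^ p)"
proof -
  have 1: "AE x in lebesgue. indicat_real \<Omega> x *\<^sub>R f x = indicat_real \<Omega> x *\<^sub>R g x"
    using ae by eventually_elim (auto simp: indicator_def)
  have 2: "AE x in lebesgue. indicat_real \<Omega> x *\<^sub>R (norm (f x) ^ p) = indicat_real \<Omega> x *\<^sub>R (norm (g x) ^ p)"
    using ae by eventually_elim (auto simp: indicator_def)
  have m: "set_borel_measurable lebesgue \<Omega> g"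
    using borel_measurable_AE[OF _ 1] Lp_on_integrableD(1)[OF f] by (simp add: set_borel_measurable_def)
  have i: "integrable lebesgue (\<lambda>x. indicat_real \<Omega> x *\<^sub>R (norm (f x) ^ p))"
    using Lp_on_integrableD(2)[OF f] by (simp only: set_integrable_def)
  have m2: "(\<lambda>x. indicat_real \<Omega> x *\<^sub>R (norm (g x) ^ p)) \<in> borel_measurable lebesgue"
    by (rule borel_measurable_AE[OF borel_measurable_integrable[OF i] 2])
  have "integrable lebesgue (\<lambda>x. indicat_real \<Omega> x *\<^sub>R (norm (g x) ^ p))"
    by (rule integrable_cong_AE_imp[OF i m2 2])
  then show "g \<in> Lp_on p \<Omega>" using m by (simp add: Lp_on_def set_integrable_def)
  show "(LINT x:\<Omega>|lebesgue. norm (g x) ^ p) = (LINT x:\<Omega>|lebesgue. norm (f x) ^ p)"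
    unfolding set_lebesgue_integral_def
    by (rule integral_cong_AE[OF borel_measurable_integrable[OF i] m2 2, symmetric])
qed

lemma power_norm_diff_le:
  fixes a b :: "'b::real_normed_vector"
  shows "norm (a - b) ^ p \<le> 2 ^ p * (norm a ^ p + norm b ^ p)"
proof -
  have "norm (a - b) \<le> 2 * max (norm a) (norm b)" using norm_triangle_ineq4[of a b] by linarith
  then have "norm (a - b) ^ p \<le> (2 * max (norm a) (norm b)) ^ p" by (intro power_mono) auto
  also have "\<dots> = 2 ^ p * max (norm a) (norm b) ^ p" by (simp add: power_mult_distrib)
  also have "\<dots> \<le> 2 ^ p * (norm a ^ p + norm b ^ p)" by (intro mult_left_mono) (auto simp: max_def)
  finally show ?thesis .
qed

lemma set_borel_measurable_norm_power:
  fixes f :: "'a \<Rightarrow> 'b::euclidean_space"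
  assumes f: "set_borel_measurable M \<Omega> f" and p: "1 \<le> p"
  shows "set_borel_measurable M \<Omega> (\<lambda>x. norm (f x) ^ p)"
proof -
  have "(\<lambda>x. norm (indicat_real \<Omega> x *\<^sub>R f x) ^ p) \<in> borel_measurable M"
  proof -
    have [measurable]: "(\<lambda>x. indicat_real \<Omega> x *\<^sub>R f x) \<in> borel_measurable M"
      using f by (simp only: set_borel_measurable_def)
    show ?thesis by measurable
  qed
  moreover have "norm (indicat_real \<Omega> x *\<^sub>R f x) ^ p = indicat_real \<Omega> x *\<^sub>R (norm (f x) ^ p)" for x
    using p by (auto simp: indicator_def)
  ultimately show ?thesis by (simp add: set_borel_measurable_def)
qed

lemma Lp_on_diff:
  fixes f g :: "real ^ 'n \<Rightarrow> 'b::euclidean_space"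
  assumes f: "f \<in> Lp_on p \<Omega>" and g: "g \<in> Lp_on p \<Omega>" and p: "1 \<le> p"
  shows "(\<lambda>x. f x - g x) \<in> Lp_on p \<Omega>"
proof -
  have m: "set_borel_measurable lebesgue \<Omega> (\<lambda>x. f x - g x)"
    using Lp_on_integrableD(1)[OF f] Lp_on_integrableD(1)[OF g]
    unfolding set_borel_measurable_def scaleR_diff_right by (rule borel_measurable_diff)
  have "set_integrable lebesgue \<Omega> (\<lambda>x. norm (f x - g x) ^ p)"
  proof (rule set_integrable_bound)
    show "set_integrable lebesgue \<Omega> (\<lambda>x. 2 ^ p * (norm (f x) ^ p + norm (g x) ^ p))"
      by (intro set_integrable_mult_right set_integral_add Lp_on_integrableD f g)
    show "set_borel_measurable lebesgue \<Omega> (\<lambda>x. norm (f x - g x) ^ p)"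
      by (rule set_borel_measurable_norm_power[OF m p])
    show "AE x in lebesgue. x \<in> \<Omega> \<longrightarrow> norm (norm (f x - g x) ^ p) \<le> norm (2 ^ p * (norm (f x) ^ p + norm (g x) ^ p))"
      using power_norm_diff_le by (intro AE_I2) (simp add: power_norm_diff_le)
  qed
  then show ?thesis using m by (simp add: Lp_on_def)
qed

lemma Lp_on_uminus:
  fixes f :: "real ^ 'n \<Rightarrow> 'b::euclidean_space"
  assumes f: "f \<in> Lp_on p \<Omega>"
  shows "(\<lambda>x. - f x) \<in> Lp_on p \<Omega>"
  using f by (auto simp: Lp_on_def set_borel_measurable_def)

lemma bounded_continuous_in_Lp_on:
  fixes f :: "real ^ 'n \<Rightarrow> 'b::euclidean_space"
  assumes \<Omega>: "\<Omega> \<in> lmeasurable" and f: "f \<in> borel_measurable borel" "\<And>x. x \<in> \<Omega> \<Longrightarrow> norm (f x) \<le> C"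
    and p: "1 \<le> p"
  shows "f \<in> Lp_on p \<Omega>"
proof -
  have \<Omega>s: "\<Omega> \<in> sets lebesgue" using \<Omega> by (simp add: fmeasurable_def)
  have m: "set_borel_measurable lebesgue \<Omega> f"
    unfolding set_borel_measurable_def using \<Omega>s f(1)
    by (intro borel_measurable_scaleR borel_measurable_indicator measurable_completion) auto
  have "set_integrable lebesgue \<Omega> (\<lambda>x. norm (f x) ^ p)"
    unfolding set_integrable_def
  proof (rule integrableI_bounded_set[where A=\<Omega> and B="C ^ p"])
    show "(\<lambda>x. indicat_real \<Omega> x *\<^sub>R norm (f x) ^ p) \<in> borel_measurable lebesgue"
      using set_borel_measurable_norm_power[OF m p] by (simp add: set_borel_measurable_def)
    show "AE x in lebesgue. x \<in> \<Omega> \<longrightarrow> norm (indicat_real \<Omega> x *\<^sub>R norm (f x) ^ p) \<le> C ^ p"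
      using f(2) by (intro AE_I2) (auto simp: power_mono)
  qed (use \<Omega> in \<open>auto simp: fmeasurable_def\<close>)
  then show ?thesis using m by (simp add: Lp_on_def)
qed

lemma test_function_in_Lp_on:
  assumes \<phi>: "\<phi> \<in> test_functions \<Omega>'" and \<Omega>: "\<Omega> \<in> lmeasurable" and p: "1 \<le> p"
  shows "\<phi> \<in> Lp_on p \<Omega>" "grad \<phi> \<in> Lp_on p \<Omega>"
proof -
  obtain K where K: "compact K" "K \<subseteq> \<Omega>'" "\<And>x. x \<notin> K \<Longrightarrow> \<phi> x = 0" "\<And>x. x \<notin> K \<Longrightarrow> grad \<phi> x = 0"
    using test_function_support[OF \<phi>] by blast
  note t = test_functionD[OF \<phi>]
  obtain C where C: "\<And>x. norm (\<phi> x) \<le> C" using bounded_if_compact_support[OF K(1) t(2) K(3)] by blast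
  obtain C' where C': "\<And>x. norm (grad \<phi> x) \<le> C'" using bounded_if_compact_support[OF K(1) t(3) K(4)] by blast
  show "\<phi> \<in> Lp_on p \<Omega>"
    by (rule bounded_continuous_in_Lp_on[OF \<Omega> borel_measurable_continuous_onI[OF t(2)] C p])
  show "grad \<phi> \<in> Lp_on p \<Omega>"
    by (rule bounded_continuous_in_Lp_on[OF \<Omega> borel_measurable_continuous_onI[OF t(3)] C' p])
qed

text \<open>Convergence in the Sobolev norm is separated into convergence of the functions and of
  the gradients, both of whose contributions are nonnegative.\<close>

lemma sobolev_W1_0_approx:
  fixes u :: "real ^ 'n \<Rightarrow> real"
  assumes u: "u \<in> sobolev_W1_0 p \<Omega>" and \<Omega>: "open \<Omega>" "\<Omega> \<in> lmeasurable" and p: "1 \<le> p"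
  obtains \<phi> where "u \<in> Lp_on p \<Omega>" "weak_grad \<Omega> u \<in> Lp_on p \<Omega>" "\<And>k. \<phi> k \<in> test_functions \<Omega>"
    "(\<lambda>k. LINT x:\<Omega>|lebesgue. norm (u x - \<phi> k x) ^ p) \<longlonglongrightarrow> 0"
    "(\<lambda>k. LINT x:\<Omega>|lebesgue. norm (weak_grad \<Omega> u x - grad (\<phi> k) x) ^ p) \<longlonglongrightarrow> 0"
proof -
  obtain \<phi> where uW: "u \<in> sobolev_W1 p \<Omega>" and \<phi>: "\<And>k. \<phi> k \<in> test_functions \<Omega>"
    and lim: "(\<lambda>k. sobolev_norm p \<Omega> (\<lambda>x. u x - \<phi> k x)) \<longlonglongrightarrow> 0"
    using u unfolding sobolev_W1_0_def by blast
  obtain v where uL: "u \<in> Lp_on p \<Omega>" and v: "v \<in> Lp_on p \<Omega>" "has_weak_grad \<Omega> u v"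
    using uW by (auto simp: sobolev_W1_def)
  note wg = weak_grad_AE_eq[OF \<Omega>(1) v(2)]
  have DuL: "weak_grad \<Omega> u \<in> Lp_on p \<Omega>"
    by (rule Lp_on_cong_AE(1)[OF v(1)]) (use wg(2) in \<open>auto elim!: eventually_mono\<close>)
  define A where "A k = (LINT x:\<Omega>|lebesgue. norm (u x - \<phi> k x) ^ p)" for k
  define E where "E k = (LINT x:\<Omega>|lebesgue. norm (weak_grad \<Omega> u x - grad (\<phi> k) x) ^ p)" for k
  have nonneg: "0 \<le> A k" "0 \<le> E k" for k
    unfolding A_def E_def set_lebesgue_integral_def by (auto intro!: integral_nonneg_AE)
  \<comment> \<open>The norm involves the weak gradient chosen for the difference, which agrees only
    almost everywhere with the chosen weak gradient of u minus the classical gradient of \<phi>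
    k.\<close>
  have norm_eq: "sobolev_norm p \<Omega> (\<lambda>x. u x - \<phi> k x) = root p (A k + E k)" for k
  proof -
    have d: "has_weak_grad \<Omega> (\<lambda>x. u x - \<phi> k x) (\<lambda>x. weak_grad \<Omega> u x - grad (\<phi> k) x)"
      by (rule has_weak_grad_diff[OF wg(1) has_weak_grad_test[OF \<phi>]])
    have L: "(\<lambda>x. weak_grad \<Omega> u x - grad (\<phi> k) x) \<in> Lp_on p \<Omega>"
      by (rule Lp_on_diff[OF DuL test_function_in_Lp_on(2)[OF \<phi> \<Omega>(2) p] p])
    have "(LINT x:\<Omega>|lebesgue. norm (weak_grad \<Omega> (\<lambda>x. u x - \<phi> k x) x) ^ p) = E k"
      unfolding E_def
      by (rule Lp_on_cong_AE(2)[OF L]) (use weak_grad_AE_eq(2)[OF \<Omega>(1) d] in \<open>auto elim!: eventually_mono\<close>)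
    then show ?thesis by (simp add: sobolev_norm_def A_def)
  qed
  have "(\<lambda>k. sobolev_norm p \<Omega> (\<lambda>x. u x - \<phi> k x) ^ p) \<longlonglongrightarrow> 0 ^ p"
    by (intro tendsto_power lim)
  then have AE0: "(\<lambda>k. A k + E k) \<longlonglongrightarrow> 0"
    using p nonneg by (simp add: norm_eq add_nonneg_nonneg power_0_left)
  have "A \<longlonglongrightarrow> 0"
    by (rule tendsto_sandwich[OF _ _ tendsto_const AE0]) (use nonneg in auto)
  moreover have "E \<longlonglongrightarrow> 0"
    by (rule tendsto_sandwich[OF _ _ tendsto_const AE0]) (use nonneg in auto)
  ultimately show ?thesis using that[OF uL DuL \<phi>] by (simp add: A_def[abs_def] E_def[abs_def])
qed

text \<open>Either z is at most t, or z is at most z ^ p / t ^ (p - 1). Integrated over a set of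
  finite measure, this takes the place of Hoelder's inequality.\<close>

lemma le_add_power_div:
  fixes z t :: real
  assumes "0 \<le> z" "0 < t" "1 \<le> p"
  shows "z \<le> t + z ^ p / t ^ (p - 1)"
proof (cases "z \<le> t")
  case True
  then show ?thesis using assms by (simp add: add_increasing2)
next
  case False
  have "z * t ^ (p - 1) \<le> z * z ^ (p - 1)" using False assms by (intro mult_left_mono power_mono) auto
  also have "\<dots> = z ^ p" using assms by (cases p) auto
  finally have "z \<le> z ^ p / t ^ (p - 1)" using assms by (simp add: le_divide_eq)
  then show ?thesis using assms by simp
qed

lemma Lp_on_norm_integrable:
  fixes f :: "real ^ 'n \<Rightarrow> 'b::euclidean_space"
  assumes f: "f \<in> Lp_on p \<Omega>" and \<Omega>: "\<Omega> \<in> lmeasurable" and p: "1 \<le> p"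
  shows "set_integrable lebesgue \<Omega> (\<lambda>x. norm (f x))"
    and "0 < t \<Longrightarrow> (LINT x:\<Omega>|lebesgue. norm (f x)) \<le> t * measure lebesgue \<Omega> + (LINT x:\<Omega>|lebesgue. norm (f x) ^ p) / t ^ (p - 1)"
proof -
  have \<Omega>s: "\<Omega> \<in> sets lebesgue" using \<Omega> by (simp add: fmeasurable_def)
  have c: "set_integrable lebesgue \<Omega> (\<lambda>x. c)" for c :: real
    unfolding set_integrable_def using \<Omega> by (intro integrable_scaleR_left) (simp add: lmeasurable_iff_integrable)
  have i: "set_integrable lebesgue \<Omega> (\<lambda>x. t + norm (f x) ^ p / t ^ (p - 1))" for t
    by (intro set_integral_add c set_integrable_divide Lp_on_integrableD f)
  have b: "norm (f x) \<le> t + norm (f x) ^ p / t ^ (p - 1)" if "0 < t" for x t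
    using that p by (intro le_add_power_div) auto
  show n: "set_integrable lebesgue \<Omega> (\<lambda>x. norm (f x))"
  proof (rule set_integrable_bound[OF i[of 1]])
    show "set_borel_measurable lebesgue \<Omega> (\<lambda>x. norm (f x))"
      using set_borel_measurable_norm_power[OF Lp_on_integrableD(1)[OF f], of 1] by simp
    show "AE x in lebesgue. x \<in> \<Omega> \<longrightarrow> norm (norm (f x)) \<le> norm (1 + norm (f x) ^ p / 1 ^ (p - 1))"
      using b[of 1] by (intro AE_I2) (auto intro: order_trans[OF _ abs_ge_self])
  qed
  show "(LINT x:\<Omega>|lebesgue. norm (f x)) \<le> t * measure lebesgue \<Omega> + (LINT x:\<Omega>|lebesgue. norm (f x) ^ p) / t ^ (p - 1)"
    if t: "0 < t"
  proof -
    have "(LINT x:\<Omega>|lebesgue. norm (f x)) \<le> (LINT x:\<Omega>|lebesgue. t + norm (f x) ^ p / t ^ (p - 1))"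
      by (intro set_integral_mono n i b t)
    also have "\<dots> = (LINT x:\<Omega>|lebesgue. t) + (LINT x:\<Omega>|lebesgue. norm (f x) ^ p / t ^ (p - 1))"
      by (intro set_integral_add(2) c set_integrable_divide Lp_on_integrableD f)
    also have "(LINT x:\<Omega>|lebesgue. t) = t * measure lebesgue \<Omega>"
      using \<Omega> \<Omega>s by (simp add: set_lebesgue_integral_def mult.commute)
    finally show ?thesis by simp
  qed
qed

text \<open>On a set of finite measure, first t is fixed so small that t times the measure is at
  most r / 2; then the p-th power integrals are small against t ^ (p - 1).\<close>

lemma Lp_on_norm_tendsto:
  fixes f :: "nat \<Rightarrow> real ^ 'n \<Rightarrow> 'b::euclidean_space"
  assumes f: "\<And>k. f k \<in> Lp_on p \<Omega>" and \<Omega>: "\<Omega> \<in> lmeasurable" and p: "1 \<le> p"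
    and lim: "(\<lambda>k. LINT x:\<Omega>|lebesgue. norm (f k x) ^ p) \<longlonglongrightarrow> 0"
  shows "(\<lambda>k. LINT x:\<Omega>|lebesgue. norm (f k x)) \<longlonglongrightarrow> 0"
proof (rule LIMSEQ_I)
  fix r :: real assume r: "0 < r"
  define m where "m = measure lebesgue \<Omega> + 1"
  have m: "0 < m" by (simp add: m_def add_nonneg_pos)
  define t where "t = r / (2 * m)"
  have t: "0 < t" using r m by (simp add: t_def)
  have "t * measure lebesgue \<Omega> \<le> t * m" using t by (intro mult_left_mono) (auto simp: m_def)
  also have "\<dots> = r / 2" using m by (simp add: t_def)
  finally have tm: "t * measure lebesgue \<Omega> \<le> r / 2" .
  have "\<forall>\<^sub>F k in sequentially. (LINT x:\<Omega>|lebesgue. norm (f k x) ^ p) < r / 2 * t ^ (p - 1)"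
    using r t by (intro order_tendstoD(2)[OF lim]) auto
  then have "\<forall>\<^sub>F k in sequentially. norm ((LINT x:\<Omega>|lebesgue. norm (f k x)) - 0) < r"
  proof eventually_elim
    case (elim k)
    have "(LINT x:\<Omega>|lebesgue. norm (f k x) ^ p) / t ^ (p - 1) < r / 2"
      using elim t by (simp add: divide_less_eq)
    moreover have "0 \<le> (LINT x:\<Omega>|lebesgue. norm (f k x))"
      unfolding set_lebesgue_integral_def by (auto intro!: integral_nonneg_AE)
    ultimately show ?case using Lp_on_norm_integrable(2)[OF f[of k] \<Omega> p t] tm unfolding real_norm_def by linarith
  qed
  then show "\<exists>no. \<forall>k\<ge>no. norm ((LINT x:\<Omega>|lebesgue. norm (f k x)) - 0) < r"
    by (simp add: eventually_sequentially)
qed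

text \<open>Phrased with inner products so that it serves both the flux field, which is vector
  valued, and \<open>mu\<close>, where the inner product is multiplication of reals.\<close>

lemma set_integrable_inner_bounded:
  fixes f X :: "real ^ 'n \<Rightarrow> 'b::euclidean_space"
  assumes f: "f \<in> Lp_on p \<Omega>" and \<Omega>: "\<Omega> \<in> lmeasurable" and p: "1 \<le> p"
    and X: "X \<in> borel_measurable borel" "\<And>x. norm (X x) \<le> C"
  shows "set_integrable lebesgue \<Omega> (\<lambda>x. X x \<bullet> f x)"
    and "\<bar>LINT x:\<Omega>|lebesgue. X x \<bullet> f x\<bar> \<le> C * (LINT x:\<Omega>|lebesgue. norm (f x))"
proof -
  have Xm: "X \<in> borel_measurable lebesgue" using X(1) by (intro measurable_completion) simp
  have b: "\<bar>X x \<bullet> f x\<bar> \<le> C * norm (f x)" for x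
  proof -
    have "\<bar>X x \<bullet> f x\<bar> \<le> norm (X x) * norm (f x)" by (rule Cauchy_Schwarz_ineq2)
    also have "\<dots> \<le> C * norm (f x)" using X(2) by (intro mult_right_mono) auto
    finally show ?thesis .
  qed
  note n = set_integrable_mult_right[OF Lp_on_norm_integrable(1)[OF f \<Omega> p], of C]
  show i: "set_integrable lebesgue \<Omega> (\<lambda>x. X x \<bullet> f x)"
  proof (rule set_integrable_bound[OF n])
    have "(\<lambda>x. X x \<bullet> (indicat_real \<Omega> x *\<^sub>R f x)) \<in> borel_measurable lebesgue"
      using Xm Lp_on_integrableD(1)[OF f] unfolding set_borel_measurable_def by (rule borel_measurable_inner)
    then show "set_borel_measurable lebesgue \<Omega> (\<lambda>x. X x \<bullet> f x)"
      unfolding set_borel_measurable_def by (simp add: inner_scaleR_right)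
    show "AE x in lebesgue. x \<in> \<Omega> \<longrightarrow> norm (X x \<bullet> f x) \<le> norm (C * norm (f x))"
      using b by (intro AE_I2) (auto intro: order_trans[OF _ abs_ge_self])
  qed
  have "\<bar>LINT x:\<Omega>|lebesgue. X x \<bullet> f x\<bar> \<le> (\<integral>x. \<bar>indicator \<Omega> x *\<^sub>R (X x \<bullet> f x)\<bar> \<partial>lebesgue)"
    unfolding set_lebesgue_integral_def by (rule integral_abs_bound)
  also have "\<dots> = (LINT x:\<Omega>|lebesgue. \<bar>X x \<bullet> f x\<bar>)"
    unfolding set_lebesgue_integral_def by (intro Bochner_Integration.integral_cong) (auto simp: abs_mult)
  also have "\<dots> \<le> (LINT x:\<Omega>|lebesgue. C * norm (f x))"
    by (intro set_integral_mono n set_integrable_abs[OF i] b)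
  finally show "\<bar>LINT x:\<Omega>|lebesgue. X x \<bullet> f x\<bar> \<le> C * (LINT x:\<Omega>|lebesgue. norm (f x))" by simp
qed

lemma zero_in_sobolev_W1_0:
  fixes \<Omega> :: "(real ^ 'n) set"
  assumes \<Omega>: "open \<Omega>" "\<Omega> \<in> lmeasurable" and p: "1 \<le> p"
  shows "(\<lambda>_. 0) \<in> sobolev_W1_0 p \<Omega>" "AE x in lebesgue. x \<in> \<Omega> \<longrightarrow> weak_grad \<Omega> (\<lambda>_. 0) x = 0"
proof -
  have g0: "grad (\<lambda>_. 0) = (\<lambda>_. 0)" by (auto intro!: grad_eqI GDERIV_const)
  have w: "has_weak_grad \<Omega> (\<lambda>_. 0) (\<lambda>_. 0)"
    using has_weak_grad_test[OF zero_test_function, of \<Omega>] by (simp add: g0)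
  show ae: "AE x in lebesgue. x \<in> \<Omega> \<longrightarrow> weak_grad \<Omega> (\<lambda>_. 0) x = 0"
    by (rule weak_grad_AE_eq(2)[OF \<Omega>(1) w])
  have L: "(\<lambda>_. 0 :: real) \<in> Lp_on p \<Omega>" "(\<lambda>_. 0 :: real ^ 'n) \<in> Lp_on p \<Omega>"
    by (intro bounded_continuous_in_Lp_on[OF \<Omega>(2) _ _ p, where C=0]; simp)+
  have z: "(LINT x:\<Omega>|lebesgue. norm (weak_grad \<Omega> (\<lambda>_. 0) x) ^ p) = 0"
  proof -
    have "AE x in lebesgue. x \<in> \<Omega> \<longrightarrow> 0 = weak_grad \<Omega> (\<lambda>_. 0) x" using ae by eventually_elim auto
    from Lp_on_cong_AE(2)[OF L(2) this] show ?thesis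
      using p by (simp add: power_0_left set_lebesgue_integral_def)
  qed
  have "sobolev_norm p \<Omega> (\<lambda>x. 0 - 0) = 0"
    using p z by (simp add: sobolev_norm_def power_0_left set_lebesgue_integral_def)
  then show "(\<lambda>_. 0) \<in> sobolev_W1_0 p \<Omega>"
    unfolding sobolev_W1_0_def sobolev_W1_def
    by (intro CollectI conjI bexI[of _ "\<lambda>_. 0"] exI[of _ "\<lambda>_ _. 0"] allI w L zero_test_function) (simp_all add: w L)
qed


section \<open>The main theorem\<close>

text \<open>Convexity of the n-th power with weights 1 - t and t, from two tangent inequalities at a
  + b. As t tends to 0 the coefficient of a ^ n tends to 1, while that of b ^ n is finite for each
  fixed t; this suits a main part a and an error b.\<close>

lemma power_add_convex:
  fixes a b t :: real
  assumes "0 \<le> a" "0 \<le> b" "0 < t" "t < 1" "1 \<le> n"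
  shows "(a + b) ^ n \<le> (1 - t) * (a / (1 - t)) ^ n + t * (b / t) ^ n"
proof -
  define m where "m = a + b"
  have m: "0 \<le> m" using assms by (simp add: m_def)
  have "(1 - t) * (real n * m ^ (n - 1) * (a / (1 - t)) - (real n - 1) * m ^ n)
      + t * (real n * m ^ (n - 1) * (b / t) - (real n - 1) * m ^ n)
    \<le> (1 - t) * (a / (1 - t)) ^ n + t * (b / t) ^ n"
    using assms young_power[of m "a / (1 - t)" n] young_power[of m "b / t" n] m
    by (intro add_mono mult_left_mono) auto
  moreover have "(1 - t) * (real n * m ^ (n - 1) * (a / (1 - t)) - (real n - 1) * m ^ n)
      + t * (real n * m ^ (n - 1) * (b / t) - (real n - 1) * m ^ n) = m ^ n"
  proof -
    have "(1 - t) * (c * (a / (1 - t)) - e) + t * (c * (b / t) - e) = c * (a + b) - e" for c e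
      using assms by (simp add: field_simps)
    then have "(1 - t) * (real n * m ^ (n - 1) * (a / (1 - t)) - (real n - 1) * m ^ n)
      + t * (real n * m ^ (n - 1) * (b / t) - (real n - 1) * m ^ n)
      = real n * m ^ (n - 1) * (a + b) - (real n - 1) * m ^ n" .
    also have "\<dots> = real n * (m * m ^ (n - 1)) - (real n - 1) * m ^ n" by (simp add: m_def mult_ac)
    also have "m * m ^ (n - 1) = m ^ n" using assms by (cases n) auto
    finally show ?thesis by (simp add: algebra_simps)
  qed
  ultimately show ?thesis by (simp add: m_def)
qed

context onofri_ball
begin

section \<open>The weak form of the Liouville equation\<close>

lemma beta_eq: "beta TYPE('n) = real CARD('n) * (real CARD('n) * p) ^ (CARD('n) - 1) * (real CARD('n) * vol1)"
  unfolding beta_def sphere_area_eq p_def[symmetric]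
  by (simp add: power_mult_distrib power_unfold(1)[of "real CARD('n)"])

lemma beta_pos: "0 < beta TYPE('n)"
  unfolding beta_eq using p n vol1_pos by simp

text \<open>By \<open>Dm_flux\<close> the flux is a constant times x / D ^ (n - 1), so its weak
  divergence is computed coordinate by coordinate. The constant \<open>beta\<close> is the product
  of the factor n in front of the linear term of \<open>H_integrand\<close>, the constant in the
  flux and the constant n * vol1 in the divergence.\<close>

lemma flux_test:
  fixes \<phi> :: "real ^ 'n \<Rightarrow> real"
  assumes \<phi>: "\<phi> \<in> test_functions \<Omega>"
  shows "real CARD('n) * (\<integral>x. (norm (Dm x) ^ (CARD('n) - 2) *\<^sub>R Dm x) \<bullet> grad \<phi> x \<partial>lborel)
     = beta TYPE('n) * (\<integral>x. \<phi> x * mu x \<partial>lborel)"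
proof -
  let ?n = "CARD('n)"
  obtain K where K: "compact K" "K \<subseteq> \<Omega>" "\<And>x. x \<notin> K \<Longrightarrow> \<phi> x = 0" "\<And>x. x \<notin> K \<Longrightarrow> grad \<phi> x = 0"
    using test_function_support[OF \<phi>] by blast
  note t = test_functionD[OF \<phi>]
  define w where "w x = 1 / D (norm x) ^ (?n - 1)" for x :: "real ^ 'n"
  define W where "W x = - (real (?n - 1) * p / D (norm x) ^ ?n) *\<^sub>R (norm x powr (p - 2) *\<^sub>R x)" for x :: "real ^ 'n"
  have w: "GDERIV w x :> W x" for x
  proof -
    have "((\<lambda>t. 1 / t ^ (?n - 1)) has_real_derivative - (real (?n - 1) / D (norm x) ^ ?n)) (at (D (norm x)))"
    proof -
      have "((\<lambda>t. 1 / t ^ (?n - 1)) has_real_derivative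
          - (real (?n - 1) * D (norm x) ^ (?n - 1 - Suc 0)) / (D (norm x) ^ (?n - 1))\<^sup>2) (at (D (norm x)))"
        by (auto intro!: derivative_eq_intros simp: power2_eq_square)
      moreover have "D (norm x) ^ (?n - 1 - Suc 0) / (D (norm x) ^ (?n - 1))\<^sup>2 = 1 / D (norm x) ^ ?n"
      proof -
        have "?n - 1 - Suc 0 = ?n - 2" by simp
        moreover have "(D (norm x) ^ (?n - 1))\<^sup>2 = D (norm x) ^ ?n * D (norm x) ^ (?n - 2)"
        proof -
          have "b\<^sup>2 = a * c" if "a = z * b" "b = z * c" for a b c z :: real
          proof -
            have "b\<^sup>2 = b * (z * c)" using that(2) by (simp add: power2_eq_square)
            then show ?thesis by (simp add: that(1) mult_ac)
          qed
          from this[OF power_unfold[of "D (norm x)"]] show ?thesis .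
        qed
        ultimately show ?thesis by simp
      qed
      ultimately show ?thesis by (simp add: divide_inverse mult.assoc)
    qed
    from GDERIV_DERIV_compose[OF GDERIV_D_norm this] show ?thesis
      by (simp add: w_def[abs_def] W_def mult.assoc)
  qed
  have wc: "continuous_on UNIV w" unfolding w_def by (intro continuous_intros continuous_on_D_norm) auto
  have Wc: "continuous_on UNIV W"
    unfolding W_def using p by (intro continuous_intros continuous_on_norm_powr_scaleR continuous_on_D_norm) auto
  \<comment> \<open>The gradient of the i-th component of the field x / D ^ (n - 1); its i-th entry
    is the contribution to the divergence.\<close>
  define H where "H i x = (x $ i) *\<^sub>R W x + w x *\<^sub>R axis i 1" for i and x :: "real ^ 'n"
  have coord: "GDERIV (\<lambda>x. x $ i) x :> axis i 1" for i and x :: "real ^ 'n"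
    unfolding gderiv_def by (simp add: inner_axis bounded_linear_imp_has_derivative bounded_linear_vec_nth)
  have H: "GDERIV (\<lambda>x. x $ i * w x) x :> H i x" for i x
    unfolding H_def by (rule GDERIV_mult[OF coord w])
  have Hc: "continuous_on UNIV (H i)" for i
    unfolding H_def by (intro continuous_intros wc Wc)
  have div: "(\<Sum>i\<in>UNIV. H i x $ i) = real ?n * vol1 * mu x" for x
  proof -
    have "(\<Sum>i\<in>UNIV. H i x $ i) = x \<bullet> W x + real ?n * w x"
      by (simp add: H_def sum.distrib inner_vec_def)
    also have "x \<bullet> W x = - (real ?n * norm x powr p / D (norm x) ^ ?n)"
    proof -
      have "norm x powr (p - 2) * (norm x)\<^sup>2 = norm x powr p"
        using powr_add[of "norm x" "p - 2" 2] by (cases "x = 0") auto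
      moreover have "real (?n - 1) * p = real ?n" using p n by (simp add: of_nat_diff)
      moreover have "x \<bullet> W x = - (real (?n - 1) * p * (norm x powr (p - 2) * (norm x)\<^sup>2) / D (norm x) ^ ?n)"
        by (simp add: W_def power2_norm_eq_inner)
      ultimately show ?thesis by simp
    qed
    \<comment> \<open>Brought over the common denominator D ^ n, the numerator is D - norm x powr p
      = 1, which leaves a multiple of \<open>mu\<close>.\<close>
    also have "w x = D (norm x) / D (norm x) ^ ?n"
      by (simp add: w_def power_unfold(1)[of "D (norm x)"])
    also have "- (real ?n * norm x powr p / D (norm x) ^ ?n) + real ?n * (D (norm x) / D (norm x) ^ ?n)
        = real ?n * (D (norm x) - norm x powr p) / D (norm x) ^ ?n"
      by (simp add: diff_divide_distrib algebra_simps)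
    also have "D (norm x) - norm x powr p = 1" by (simp add: D_def)
    finally show ?thesis using vol1_pos by (simp add: mu_eq)
  qed
  have i1: "integrable lborel (\<lambda>x. (x $ i * w x) * grad \<phi> x $ i)" for i
    by (rule integrable_if_compact_support[OF K(1)]) (auto intro!: continuous_intros wc t simp: K)
  have i2: "integrable lborel (\<lambda>x. \<phi> x * H i x $ i)" for i
    by (rule integrable_if_compact_support[OF K(1)]) (auto intro!: continuous_intros Hc t simp: K)
  have "(\<integral>x. (\<Sum>i\<in>UNIV. (x $ i * w x) * grad \<phi> x $ i) \<partial>lborel) = - (\<integral>x. (\<Sum>i\<in>UNIV. \<phi> x * H i x $ i) \<partial>lborel)"
    using i1 i2 integral_by_parts_test[OF \<phi> H Hc] by (simp add: Bochner_Integration.integral_sum sum_negf)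
  also have "(\<integral>x. (\<Sum>i\<in>UNIV. \<phi> x * H i x $ i) \<partial>lborel) = (\<integral>x. real ?n * vol1 * (\<phi> x * mu x) \<partial>lborel)"
    unfolding sum_distrib_left[symmetric] div by (simp add: mult_ac)
  finally have main: "(\<integral>x. (\<Sum>i\<in>UNIV. (x $ i * w x) * grad \<phi> x $ i) \<partial>lborel) = - (real ?n * vol1 * (\<integral>x. \<phi> x * mu x \<partial>lborel))"
    by simp
  have "(norm (Dm x) ^ (?n - 2) *\<^sub>R Dm x) \<bullet> grad \<phi> x = - ((real ?n * p) ^ (?n - 1)) * (\<Sum>i\<in>UNIV. (x $ i * w x) * grad \<phi> x $ i)" for x
    unfolding Dm_flux inner_vec_def by (simp add: w_def sum_distrib_left sum_negf mult_ac)
  then have "(\<integral>x. (norm (Dm x) ^ (?n - 2) *\<^sub>R Dm x) \<bullet> grad \<phi> x \<partial>lborel)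
     = (\<integral>x. - ((real ?n * p) ^ (?n - 1)) * (\<Sum>i\<in>UNIV. (x $ i * w x) * grad \<phi> x $ i) \<partial>lborel)"
    by (simp only:)
  also have "\<dots> = (real ?n * p) ^ (?n - 1) * (real ?n * vol1 * (\<integral>x. \<phi> x * mu x \<partial>lborel))"
    unfolding integral_mult_right_zero main by simp
  finally show ?thesis unfolding beta_eq by (simp only: mult_ac)
qed

lemma energy_defect_tendsto: "((\<lambda>y. energy_defect y) \<longlongrightarrow> 0) (at_right 1)"
proof -
  have "((\<lambda>y. energy_defect y) \<longlongrightarrow> energy_defect 1) (at_right 1)"
    unfolding energy_defect_def by (intro tendsto_intros)
  then show ?thesis by (simp add: energy_defect_def)
qed

text \<open>If min u K exceeds z, the tangent of exp at min u K bounds the difference, with slope at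
  most exp K. Only u is truncated, because the estimate is used to bound exp z from below.\<close>

lemma exp_min_le:
  fixes u z K :: real
  shows "exp (min u K) - exp z \<le> exp K * \<bar>u - z\<bar>"
proof (cases "min u K \<le> z")
  case True
  then have "exp (min u K) - exp z \<le> 0" by simp
  also have "0 \<le> exp K * \<bar>u - z\<bar>" by simp
  finally show ?thesis .
next
  case False
  have "exp (min u K) * (1 + (z - min u K)) \<le> exp (min u K) * exp (z - min u K)"
    by (intro mult_left_mono exp_ge_add_one_self) auto
  also have "\<dots> = exp z" by (simp add: exp_add[symmetric])
  finally have "exp (min u K) - exp z \<le> exp (min u K) * (min u K - z)" by (simp add: algebra_simps)
  also have "\<dots> \<le> exp K * \<bar>u - z\<bar>" using False by (intro mult_mono) auto
  finally show ?thesis .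
qed

lemma LINT_ball_continuous:
  fixes f :: "real ^ 'n \<Rightarrow> real"
  assumes f: "continuous_on UNIV f"
  shows "set_integrable lebesgue (ball 0 R) f" "(LINT x:ball 0 R|lebesgue. f x) = (LINT x:ball 0 R|lborel. f x)"
proof -
  have m: "f \<in> borel_measurable borel" using f by (rule borel_measurable_continuous_onI)
  have c: "set_integrable lborel (cball 0 R) f"
    unfolding set_integrable_def using f by (intro borel_integrable_compact) (auto intro: continuous_on_subset)
  have "set_integrable lborel (ball 0 R) f"
    by (rule set_integrable_subset[OF c]) auto
  then show "set_integrable lebesgue (ball 0 R) f" "(LINT x:ball 0 R|lebesgue. f x) = (LINT x:ball 0 R|lborel. f x)"
    using m by (simp_all add: set_lebesgue_integral_completion)
qed

lemma mu_le: "mu (x :: real ^ 'n) \<le> 1 / vol1"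
proof -
  have "1 / (vol1 * D (norm x) ^ CARD('n)) \<le> 1 / (vol1 * 1)"
    using vol1_pos D_ge_1[of "norm x"] by (intro divide_left_mono mult_left_mono one_le_power) auto
  then show ?thesis by (simp add: mu_eq)
qed

lemma theta_pos: "0 < theta TYPE('n) R"
  unfolding theta_eq using R D_pos by simp

text \<open>The linear terms cancel, so the claim is that the energy \<open>P\<close> of u + ln mu
  is at least the energy \<open>E\<close> of ln mu. The inequality for the test functions passes to
  the limit in three stages: along the approximating sequence with s and y fixed, then s to 0, then
  y to 1.\<close>

theorem I_functional_nonneg:
  fixes u :: "real ^ 'n \<Rightarrow> real"
  assumes u: "u \<in> admissible_potentials R"
  shows "0 \<le> I_functional R u"
proof -
  let ?n = "CARD('n)" and ?B = "ball (0 :: real ^ 'n) R"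
  have n1: "1 \<le> ?n" using n by simp
  have B: "open ?B" "?B \<in> lmeasurable" "?B \<in> sets lebesgue" by auto
  have uW: "u \<in> sobolev_W1_0 ?n ?B"
    and uexp: "set_integrable lebesgue ?B (\<lambda>x. exp (u x) * mu x)"
      "(LINT x:?B|lebesgue. exp (u x) * mu x) = theta TYPE('n) R"
    using u by (auto simp: admissible_potentials_def)
  define Du where "Du = weak_grad ?B u"
  obtain \<phi> where uL: "u \<in> Lp_on ?n ?B" and DuL: "Du \<in> Lp_on ?n ?B" and \<phi>: "\<And>k. \<phi> k \<in> test_functions ?B"
    and limu: "(\<lambda>k. LINT x:?B|lebesgue. norm (u x - \<phi> k x) ^ ?n) \<longlonglongrightarrow> 0"
    and limD: "(\<lambda>k. LINT x:?B|lebesgue. norm (Du x - grad (\<phi> k) x) ^ ?n) \<longlonglongrightarrow> 0"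
    by (rule sobolev_W1_0_approx[OF uW B(1,2) n1, folded Du_def], rule that) (assumption | fast)+
  note t = test_functionD[OF \<phi>]
  note tL = test_function_in_Lp_on[OF \<phi> B(2) n1]
  have du: "(\<lambda>x. u x - \<phi> k x) \<in> Lp_on ?n ?B" for k by (rule Lp_on_diff[OF uL tL(1) n1])
  have dD: "(\<lambda>x. Du x - grad (\<phi> k) x) \<in> Lp_on ?n ?B" for k by (rule Lp_on_diff[OF DuL tL(2) n1])
  have out: "\<phi> k x = 0" "grad (\<phi> k) x = 0" if "x \<notin> ?B" for k x
  proof -
    obtain K where "K \<subseteq> ?B" "\<And>x. x \<notin> K \<Longrightarrow> \<phi> k x = 0" "\<And>x. x \<notin> K \<Longrightarrow> grad (\<phi> k) x = 0"
      using test_function_support[OF \<phi>[of k]] by metis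
    then show "\<phi> k x = 0" "grad (\<phi> k) x = 0" using that by blast+
  qed
  note L1u = Lp_on_norm_tendsto[OF du B(2) n1 limu] and L1D = Lp_on_norm_tendsto[OF dD B(2) n1 limD]

  define X where "X x = norm (Dm x) ^ (?n - 2) *\<^sub>R Dm x" for x
  have Xc: "continuous_on UNIV X" unfolding X_def by (intro continuous_intros continuous_on_Dm)
  have Xm: "X \<in> borel_measurable borel" using Xc by (rule borel_measurable_continuous_onI)
  have Xb: "norm (X x) \<le> (real ?n * p) ^ (?n - 1)" for x
  proof -
    have "norm (X x) = norm (Dm x) ^ (?n - 1)"
      unfolding power_unfold(2) by (simp add: X_def mult.commute)
    also have "\<dots> \<le> (real ?n * p) ^ (?n - 1)" by (intro power_mono norm_Dm_le) auto
    finally show ?thesis .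
  qed
  have mub: "norm (mu x) \<le> 1 / vol1" for x :: "real ^ 'n" using mu_le[of x] mu_pos[of x] by simp
  have lim_inner: "(\<lambda>k. LINT x:?B|lebesgue. Y x \<bullet> w k x) \<longlonglongrightarrow> (LINT x:?B|lebesgue. Y x \<bullet> W x)"
    if Y: "Y \<in> borel_measurable borel" "\<And>x. norm (Y x) \<le> C"
      and W: "W \<in> Lp_on ?n ?B" and w: "\<And>k. w k \<in> Lp_on ?n ?B"
      and lim: "(\<lambda>k. LINT x:?B|lebesgue. norm (W x - w k x)) \<longlonglongrightarrow> 0"
    for Y W :: "real ^ 'n \<Rightarrow> 'b::euclidean_space" and w C
  proof (rule LIM_zero_cancel, rule Lim_null_comparison)
    have "\<bar>(LINT x:?B|lebesgue. Y x \<bullet> w k x) - (LINT x:?B|lebesgue. Y x \<bullet> W x)\<bar> \<le> C * (LINT x:?B|lebesgue. norm (W x - w k x))" for k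
    proof -
      have "(LINT x:?B|lebesgue. Y x \<bullet> W x) - (LINT x:?B|lebesgue. Y x \<bullet> w k x) = (LINT x:?B|lebesgue. Y x \<bullet> (W x - w k x))"
        unfolding inner_diff_right
        by (intro set_integral_diff(2)[symmetric] set_integrable_inner_bounded(1)[OF _ B(2) n1 Y] W w)
      then show ?thesis
        using set_integrable_inner_bounded(2)[OF Lp_on_diff[OF W w n1] B(2) n1 Y, of k] by linarith
    qed
    then show "\<forall>\<^sub>F k in sequentially. norm ((LINT x:?B|lebesgue. Y x \<bullet> w k x) - (LINT x:?B|lebesgue. Y x \<bullet> W x))
        \<le> C * (LINT x:?B|lebesgue. norm (W x - w k x))"
      by (intro always_eventually allI) (simp only: real_norm_def)
    have "(\<lambda>k. C * (LINT x:?B|lebesgue. norm (W x - w k x))) \<longlonglongrightarrow> C * 0"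
      by (intro tendsto_intros lim)
    then show "(\<lambda>k. C * (LINT x:?B|lebesgue. norm (W x - w k x))) \<longlonglongrightarrow> 0" by (simp only: mult_zero_right)
  qed
  \<comment> \<open>The flux field and \<open>mu\<close> are bounded, so both sides are continuous
    along the approximating sequence, and for test functions the identity is
    \<open>flux_test\<close>.\<close>
  have flux: "real ?n * (LINT x:?B|lebesgue. X x \<bullet> Du x) = beta TYPE('n) * (LINT x:?B|lebesgue. u x * mu x)"
  proof (rule LIMSEQ_unique)
    show "(\<lambda>k. real ?n * (LINT x:?B|lebesgue. X x \<bullet> grad (\<phi> k) x)) \<longlonglongrightarrow> real ?n * (LINT x:?B|lebesgue. X x \<bullet> Du x)"
      by (intro tendsto_intros lim_inner[OF Xm Xb DuL tL(2) L1D])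
    have "(\<lambda>k. LINT x:?B|lebesgue. mu x \<bullet> \<phi> k x) \<longlonglongrightarrow> (LINT x:?B|lebesgue. mu x \<bullet> u x)"
      by (intro lim_inner[OF mu_borel mub uL tL(1) L1u])
    then have "(\<lambda>k. beta TYPE('n) * (LINT x:?B|lebesgue. \<phi> k x * mu x)) \<longlonglongrightarrow> beta TYPE('n) * (LINT x:?B|lebesgue. u x * mu x)"
      by (intro tendsto_intros) (simp add: mult.commute)
    moreover have "beta TYPE('n) * (LINT x:?B|lebesgue. \<phi> k x * mu x) = real ?n * (LINT x:?B|lebesgue. X x \<bullet> grad (\<phi> k) x)" for k
    proof -
      have c: "continuous_on UNIV (\<lambda>x. X x \<bullet> grad (\<phi> k) x)" "continuous_on UNIV (\<lambda>x. \<phi> k x * mu x)"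
        by (intro continuous_intros Xc t continuous_on_mu)+
      have e: "(LINT x:?B|lborel. f x) = (\<integral>x. f x \<partial>lborel)" if "\<And>x. x \<notin> ?B \<Longrightarrow> f x = 0" for f :: "real ^ 'n \<Rightarrow> real"
        unfolding set_lebesgue_integral_def using that
        by (intro Bochner_Integration.integral_cong) (auto simp: indicator_def)
      show ?thesis
      proof -
        have "(LINT x:?B|lborel. X x \<bullet> grad (\<phi> k) x) = (\<integral>x. X x \<bullet> grad (\<phi> k) x \<partial>lborel)"
          by (rule e, subst out(2)) simp_all
        moreover have "(LINT x:?B|lborel. \<phi> k x * mu x) = (\<integral>x. \<phi> k x * mu x \<partial>lborel)"
          by (rule e, subst out(1)) simp_all
        ultimately show ?thesis
          using flux_test[OF \<phi>[of k]] LINT_ball_continuous(2)[OF c(1)] LINT_ball_continuous(2)[OF c(2)]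
          by (simp only: X_def)
      qed
    qed
    ultimately show "(\<lambda>k. real ?n * (LINT x:?B|lebesgue. X x \<bullet> grad (\<phi> k) x)) \<longlonglongrightarrow> beta TYPE('n) * (LINT x:?B|lebesgue. u x * mu x)"
      by simp
  qed

  define E where "E = (LINT x:?B|lebesgue. norm (Dm x) ^ ?n)"
  have E_eq: "E = vol1 * q ^ ?n * Q R"
    unfolding E_def using energy_eq(1) by (subst LINT_ball_continuous(2)) (auto intro!: continuous_intros continuous_on_Dm)
  have DmL: "Dm \<in> Lp_on ?n ?B"
    by (rule bounded_continuous_in_Lp_on[OF B(2) borel_measurable_continuous_onI[OF continuous_on_Dm] norm_Dm_le n1])
  have sumL: "(\<lambda>x. Du x + Dm x) \<in> Lp_on ?n ?B"
    using Lp_on_diff[OF DuL Lp_on_uminus[OF DmL] n1] by simp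
  define P where "P = (LINT x:?B|lebesgue. norm (Du x + Dm x) ^ ?n)"
  have P0: "0 \<le> P" unfolding P_def set_lebesgue_integral_def by (auto intro!: integral_nonneg_AE)
  have "(LINT x:?B|lebesgue. H_integrand ?B u mu x)
      = (LINT x:?B|lebesgue. (norm (Du x + Dm x) ^ ?n - norm (Dm x) ^ ?n) - real ?n * (X x \<bullet> Du x))"
    by (simp add: H_integrand_def Let_def grad_ln_mu Du_def X_def mult.assoc)
  also have "\<dots> = P - E - real ?n * (LINT x:?B|lebesgue. X x \<bullet> Du x)"
    unfolding P_def E_def
    using Lp_on_integrableD(2)[OF sumL] Lp_on_integrableD(2)[OF DmL] set_integrable_inner_bounded(1)[OF DuL B(2) n1 Xm Xb]
    by (simp add: set_integral_diff)
  finally have I_eq: "I_functional R u = (P - E) / beta TYPE('n)"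
    unfolding I_functional_def flux using beta_pos by (simp add: field_simps)

  \<comment> \<open>The truncation height K is fixed before k: first the truncated mass exceeds
    theta / y ^ n, then the test functions inherit this bound, because a truncated exponential is
    controlled by convergence in mean.\<close>
  have masses: "\<forall>\<^sub>F k in sequentially. theta TYPE('n) R \<le> y ^ ?n * (LINT x:?B|lborel. exp (\<phi> k x) * mu x)" if y: "1 < y" for y
  proof -
    define \<theta> where "\<theta> = theta TYPE('n) R"
    have \<theta>: "0 < \<theta>" unfolding \<theta>_def by (rule theta_pos)
    have yn: "1 < y ^ ?n" using y by (intro one_less_power) auto
    then have target: "\<theta> / y ^ ?n < \<theta>" using \<theta> by (simp add: divide_less_eq)
    have um: "(\<lambda>x. indicat_real ?B x *\<^sub>R u x) \<in> borel_measurable lebesgue"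
      using Lp_on_integrableD(1)[OF uL] by (simp only: set_borel_measurable_def)
    have mum: "(mu :: real ^ 'n \<Rightarrow> real) \<in> borel_measurable lebesgue"
      using mu_borel by (intro measurable_completion) simp
    have trunc_m: "(\<lambda>x. indicat_real ?B x *\<^sub>R (exp (min (u x) (real K)) * mu x)) \<in> borel_measurable lebesgue" for K :: nat
    proof -
      \<comment> \<open>Measurability of u is known only after multiplication by the indicator of
        the ball, so the indicator is also placed inside the truncation.\<close>
      have "(\<lambda>x. indicat_real ?B x * (exp (min (indicat_real ?B x *\<^sub>R u x) (real K)) * mu x)) \<in> borel_measurable lebesgue"
        using um mum B(3) by (intro borel_measurable_times borel_measurable_indicator borel_measurable_exp[THEN measurable_compose[rotated]] borel_measurable_min) auto
      moreover have "indicat_real ?B x * (exp (min (indicat_real ?B x *\<^sub>R u x) (real K)) * mu x)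
          = indicat_real ?B x *\<^sub>R (exp (min (u x) (real K)) * mu x)" for x
        by (auto simp: indicator_def)
      ultimately show ?thesis by (simp only:)
    qed
    have dom: "norm (indicat_real ?B x *\<^sub>R (exp (min (u x) (real K)) * mu x)) \<le> indicat_real ?B x *\<^sub>R (exp (u x) * mu x)" for x and K :: nat
      using mu_pos[of x] by (auto simp: indicator_def)
    have trunc_i: "set_integrable lebesgue ?B (\<lambda>x. exp (min (u x) (real K)) * mu x)" for K :: nat
      unfolding set_integrable_def
      by (rule Bochner_Integration.integrable_bound[OF uexp(1)[unfolded set_integrable_def] trunc_m])
        (use dom in \<open>auto intro: order_trans[OF _ abs_ge_self]\<close>)
    have "(\<lambda>K. LINT x:?B|lebesgue. exp (min (u x) (real K)) * mu x) \<longlonglongrightarrow> (LINT x:?B|lebesgue. exp (u x) * mu x)"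
      unfolding set_lebesgue_integral_def
    proof (rule integral_dominated_convergence[OF _ trunc_m uexp(1)[unfolded set_integrable_def]])
      show "(\<lambda>x. indicat_real ?B x *\<^sub>R (exp (u x) * mu x)) \<in> borel_measurable lebesgue"
        using uexp(1) unfolding set_integrable_def by (rule borel_measurable_integrable)
      show "AE x in lebesgue. (\<lambda>K. indicat_real ?B x *\<^sub>R (exp (min (u x) (real K)) * mu x)) \<longlonglongrightarrow> indicat_real ?B x *\<^sub>R (exp (u x) * mu x)"
      proof (intro AE_I2 tendsto_eventually)
        fix x
        obtain K0 :: nat where "u x < real K0" using reals_Archimedean2 by blast
        then show "\<forall>\<^sub>F K in sequentially. indicat_real ?B x *\<^sub>R (exp (min (u x) (real K)) * mu x) = indicat_real ?B x *\<^sub>R (exp (u x) * mu x)"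
          by (intro eventually_mono[OF eventually_ge_at_top[of K0]]) (simp add: min_def)
      qed
      show "AE x in lebesgue. norm (indicat_real ?B x *\<^sub>R (exp (min (u x) (real K)) * mu x)) \<le> indicat_real ?B x *\<^sub>R (exp (u x) * mu x)" for K
        using dom by (intro AE_I2)
    qed
    then have "\<forall>\<^sub>F K in sequentially. \<theta> / y ^ ?n < (LINT x:?B|lebesgue. exp (min (u x) (real K)) * mu x)"
      using target by (intro order_tendstoD(1)) (auto simp: uexp \<theta>_def)
    then obtain K :: nat where K: "\<theta> / y ^ ?n < (LINT x:?B|lebesgue. exp (min (u x) (real K)) * mu x)"
      by (auto simp: eventually_sequentially)
    \<comment> \<open>The Lipschitz bound from \<open>exp_min_le\<close> times the bound 1 / vol1
      for \<open>mu\<close>.\<close>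
    define c where "c = exp (real K) / vol1"
    have lower: "(LINT x:?B|lebesgue. exp (min (u x) (real K)) * mu x) - c * (LINT x:?B|lebesgue. norm (u x - \<phi> k x))
       \<le> (LINT x:?B|lborel. exp (\<phi> k x) * mu x)" for k
    proof -
      have cc: "continuous_on UNIV (\<lambda>x. exp (\<phi> k x) * mu x)" by (intro continuous_intros t continuous_on_mu)
      note n_i = Lp_on_norm_integrable(1)[OF du B(2) n1, of k]
      have "(LINT x:?B|lebesgue. exp (min (u x) (real K)) * mu x) - c * (LINT x:?B|lebesgue. norm (u x - \<phi> k x))
         = (LINT x:?B|lebesgue. exp (min (u x) (real K)) * mu x - c * norm (u x - \<phi> k x))"
        using set_integral_diff(2)[OF trunc_i set_integrable_mult_right[OF n_i]] by simp
      also have "\<dots> \<le> (LINT x:?B|lebesgue. exp (\<phi> k x) * mu x)"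
      proof (rule set_integral_mono)
        fix x
        have "(exp (min (u x) (real K)) - exp (\<phi> k x)) * mu x \<le> (exp (real K) * \<bar>u x - \<phi> k x\<bar>) * mu x"
          using mu_pos[of x] by (intro mult_right_mono exp_min_le) auto
        also have "\<dots> \<le> (exp (real K) * \<bar>u x - \<phi> k x\<bar>) * (1 / vol1)"
          by (intro mult_left_mono mu_le) auto
        finally show "exp (min (u x) (real K)) * mu x - c * norm (u x - \<phi> k x) \<le> exp (\<phi> k x) * mu x"
          by (simp add: c_def algebra_simps)
      qed (intro set_integral_diff(1) trunc_i set_integrable_mult_right n_i, rule LINT_ball_continuous(1)[OF cc])
      finally show ?thesis using LINT_ball_continuous(2)[OF cc] by simp
    qed
    have "(\<lambda>k. (LINT x:?B|lebesgue. exp (min (u x) (real K)) * mu x) - c * (LINT x:?B|lebesgue. norm (u x - \<phi> k x)))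
        \<longlonglongrightarrow> (LINT x:?B|lebesgue. exp (min (u x) (real K)) * mu x) - c * 0"
      by (intro tendsto_intros L1u)
    then have "\<forall>\<^sub>F k in sequentially. \<theta> / y ^ ?n < (LINT x:?B|lebesgue. exp (min (u x) (real K)) * mu x) - c * (LINT x:?B|lebesgue. norm (u x - \<phi> k x))"
      using K by (intro order_tendstoD(1)) auto
    then show ?thesis
    proof eventually_elim
      case (elim k)
      then have "\<theta> / y ^ ?n \<le> (LINT x:?B|lborel. exp (\<phi> k x) * mu x)" using lower[of k] by linarith
      then show ?case using yn by (simp add: \<theta>_def divide_le_eq mult.commute)
    qed
  qed

  \<comment> \<open>The parameter s divides the energy of the test function between u and the
    approximation error. The coefficient of the error may be large, but it is fixed while the error
    tends to 0.\<close>
  have est: "E - energy_defect y \<le> (1 - s) * (1 / (1 - s)) ^ ?n * P" if y: "1 < y" and s: "0 < s" "s < 1" for y s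
  proof -
    let ?a = "(1 - s) * (1 / (1 - s)) ^ ?n" and ?b = "s * (1 / s) ^ ?n"
    have upper: "(LINT x:?B|lborel. norm (grad (\<phi> k) x + Dm x) ^ ?n)
        \<le> ?a * P + ?b * (LINT x:?B|lebesgue. norm (Du x - grad (\<phi> k) x) ^ ?n)" for k
    proof -
      have cc: "continuous_on UNIV (\<lambda>x. norm (grad (\<phi> k) x + Dm x) ^ ?n)" by (intro continuous_intros t continuous_on_Dm)
      have i: "set_integrable lebesgue ?B (\<lambda>x. ?a * norm (Du x + Dm x) ^ ?n)"
        "set_integrable lebesgue ?B (\<lambda>x. ?b * norm (Du x - grad (\<phi> k) x) ^ ?n)"
        by (intro set_integrable_mult_right Lp_on_integrableD(2) sumL dD)+
      have "(LINT x:?B|lebesgue. norm (grad (\<phi> k) x + Dm x) ^ ?n)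
          \<le> (LINT x:?B|lebesgue. ?a * norm (Du x + Dm x) ^ ?n + ?b * norm (Du x - grad (\<phi> k) x) ^ ?n)"
      proof (rule set_integral_mono)
        fix x
        have "grad (\<phi> k) x + Dm x = (Du x + Dm x) - (Du x - grad (\<phi> k) x)" by simp
        then have "norm (grad (\<phi> k) x + Dm x) \<le> norm (Du x + Dm x) + norm (Du x - grad (\<phi> k) x)"
          using norm_triangle_ineq4 by metis
        then have "norm (grad (\<phi> k) x + Dm x) ^ ?n \<le> (norm (Du x + Dm x) + norm (Du x - grad (\<phi> k) x)) ^ ?n"
          by (intro power_mono) auto
        also have "\<dots> \<le> (1 - s) * (norm (Du x + Dm x) / (1 - s)) ^ ?n + s * (norm (Du x - grad (\<phi> k) x) / s) ^ ?n"
          using s n1 by (intro power_add_convex) auto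
        finally show "norm (grad (\<phi> k) x + Dm x) ^ ?n \<le> ?a * norm (Du x + Dm x) ^ ?n + ?b * norm (Du x - grad (\<phi> k) x) ^ ?n"
          by (simp add: power_divide)
      qed (rule LINT_ball_continuous(1)[OF cc], rule set_integral_add(1)[OF i])
      also have "\<dots> = ?a * P + ?b * (LINT x:?B|lebesgue. norm (Du x - grad (\<phi> k) x) ^ ?n)"
        unfolding P_def using set_integral_add(2)[OF i] by simp
      finally show ?thesis unfolding LINT_ball_continuous(2)[OF cc] .
    qed
    have "\<forall>\<^sub>F k in sequentially. E - energy_defect y \<le> ?a * P + ?b * (LINT x:?B|lebesgue. norm (Du x - grad (\<phi> k) x) ^ ?n)"
      using masses[OF y]
    proof eventually_elim
      case (elim k)
      have "vol1 * q ^ ?n * Q R - energy_defect y \<le> (LINT x:?B|lborel. norm (grad (\<phi> k) x + Dm x) ^ ?n)"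
        by (rule energy_lower_bound[OF t(1) t(3) _ _ elim]) (use y out in auto)
      then show ?case using upper[of k] unfolding E_eq by linarith
    qed
    moreover have "(\<lambda>k. ?a * P + ?b * (LINT x:?B|lebesgue. norm (Du x - grad (\<phi> k) x) ^ ?n)) \<longlonglongrightarrow> ?a * P + ?b * 0"
      by (intro tendsto_intros limD)
    ultimately have "E - energy_defect y \<le> ?a * P + ?b * 0"
      by (intro tendsto_lowerbound[of _ _ sequentially]) auto
    then show ?thesis by simp
  qed
  have "E - energy_defect y \<le> P" if y: "1 < y" for y
  proof -
    have "((\<lambda>s. (1 - s) * (1 / (1 - s)) ^ ?n * P) \<longlongrightarrow> (1 - 0) * (1 / (1 - 0)) ^ ?n * P) (at_right 0)"
      by (intro tendsto_intros) auto
    moreover have "\<forall>\<^sub>F s in at_right 0. E - energy_defect y \<le> (1 - s) * (1 / (1 - s)) ^ ?n * P"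
      unfolding eventually_at_right_field using est[OF y] by (intro exI[of _ 1]) auto
    ultimately have "E - energy_defect y \<le> (1 - 0) * (1 / (1 - 0)) ^ ?n * P"
      by (rule tendsto_lowerbound) simp
    then show ?thesis by simp
  qed
  then have "\<forall>\<^sub>F y in at_right 1. E - energy_defect y \<le> P"
    unfolding eventually_at_right_field by (intro exI[of _ 2]) auto
  moreover have "((\<lambda>y. E - energy_defect y) \<longlongrightarrow> E - 0) (at_right 1)"
    by (intro tendsto_intros energy_defect_tendsto)
  ultimately have "E - 0 \<le> P" by (intro tendsto_upperbound[of _ _ "at_right 1"]) auto
  then show ?thesis unfolding I_eq using beta_pos by simp
qed

text \<open>The weak gradient chosen for the zero function vanishes only almost everywhere, which is
  enough for the integral of \<open>H_integrand\<close>.\<close>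

lemma zero_admissible: "(\<lambda>_ :: real ^ 'n. 0) \<in> admissible_potentials R"
  and I_functional_zero: "I_functional R (\<lambda>_ :: real ^ 'n. 0) = 0"
proof -
  let ?B = "ball (0 :: real ^ 'n) R"
  have n1: "1 \<le> CARD('n)" using n by simp
  have B: "open ?B" "?B \<in> lmeasurable" by auto
  note z = zero_in_sobolev_W1_0[OF B n1]
  show "(\<lambda>_ :: real ^ 'n. 0) \<in> admissible_potentials R"
    unfolding admissible_potentials_def using z(1) LINT_ball_continuous(1)[OF continuous_on_mu]
    by (simp add: theta_def)
  have "AE x in lebesgue. indicat_real ?B x *\<^sub>R H_integrand ?B (\<lambda>_. 0) mu x = 0"
    using z(2) by eventually_elim (auto simp: H_integrand_def indicator_def)
  then have "(LINT x:?B|lebesgue. H_integrand ?B (\<lambda>_. 0) mu x) = 0"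
    unfolding set_lebesgue_integral_def by (rule integral_eq_zero_AE)
  then show "I_functional R (\<lambda>_ :: real ^ 'n. 0) = 0"
    by (simp add: I_functional_def set_lebesgue_integral_def)
qed

end

text \<open>Supremum and infimum are taken in the extended reals, where they are meaningful without
  any boundedness assumption. Each equals 0 by a one-sided inequality together with an admissible
  element at which the value 0 is attained.\<close>

theorem theorem4p1:
  fixes R :: real
  assumes "CARD('n::finite) \<ge> 2" and "R > 0"
  shows "theta TYPE('n) R =
      R ^ CARD('n) / (1 + R powr (real CARD('n) / (real CARD('n) - 1))) ^ (CARD('n) - 1)
    \<and> (let \<mu> = (mu :: real ^ 'n \<Rightarrow> real);
           z = (\<lambda>_ :: real ^ 'n. 0 :: real);
           gap = (\<lambda>\<rho> :: real ^ 'n \<Rightarrow> real. J_functional R \<rho> - J_functional R \<mu>);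
           energy = (\<lambda>u :: real ^ 'n \<Rightarrow> real. I_functional R u);
           S = (SUP \<rho>\<in>admissible_densities R. ereal (gap \<rho>));
           T = (INF u\<in>admissible_potentials R. ereal (energy u))
       in S = T
        \<and> \<mu> \<in> admissible_densities R \<and> ereal (gap \<mu>) = S
        \<and> z \<in> admissible_potentials R \<and> ereal (energy z) = T
        \<and> S = 0 \<and> T = 0)"
proof -
  interpret onofri_ball "TYPE('n)" R "measure lborel (ball (0 :: real ^ 'n) 1)"
    by unfold_locales (use assms in auto)
  have "(SUP \<rho>\<in>admissible_densities R. ereal (J_functional R (\<rho> :: real ^ 'n \<Rightarrow> real) - J_functional R (mu :: real ^ 'n \<Rightarrow> real))) = 0"
  proof (rule antisym)
    show "(SUP \<rho>\<in>admissible_densities R. ereal (J_functional R (\<rho> :: real ^ 'n \<Rightarrow> real) - J_functional R (mu :: real ^ 'n \<Rightarrow> real))) \<le> 0"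
      using J_functional_le by (intro SUP_least) (simp add: zero_ereal_def)
    show "0 \<le> (SUP \<rho>\<in>admissible_densities R. ereal (J_functional R (\<rho> :: real ^ 'n \<Rightarrow> real) - J_functional R (mu :: real ^ 'n \<Rightarrow> real)))"
      by (rule SUP_upper2[OF mu_admissible]) (simp add: zero_ereal_def)
  qed
  moreover have "(INF u\<in>admissible_potentials R. ereal (I_functional R (u :: real ^ 'n \<Rightarrow> real))) = 0"
  proof (rule antisym)
    show "(INF u\<in>admissible_potentials R. ereal (I_functional R (u :: real ^ 'n \<Rightarrow> real))) \<le> 0"
      by (rule INF_lower2[OF zero_admissible]) (simp add: I_functional_zero zero_ereal_def)
    show "0 \<le> (INF u\<in>admissible_potentials R. ereal (I_functional R (u :: real ^ 'n \<Rightarrow> real)))"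
      using I_functional_nonneg by (intro INF_greatest) (simp add: zero_ereal_def)
  qed
  ultimately show ?thesis
    using mu_admissible zero_admissible I_functional_zero theta_eq
    by (simp add: Let_def D_def p_def zero_ereal_def)
qed

end
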